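(* Assume $a$ is (WD) or (SD) with degeneracy constant $K$. If $y$ is a mild solution of $$\begin{cases} y_{tt}(t,x)+(ay_{xx})_{xx}(t,x)=0, & (t,x)\in(0,+\infty)\times(0,1),\\ y(t,0)=y(t,1)=y_x(t,1)=0, & t>0,\\ y_x(t,0)=0\text{ if }a\text{ is (WD)},\quad(ay_{xx})(t,0)=0\text{ if }a\text{ is (SD)}, & t>0,\\ y(0,x)=y_T^0(x),\ y_t(0,x)=y_T^1(x), & x\in(0,1),\end{cases}$$ then $$a(1)\int_0^Ty_{xx}^2(t,1)\,dt\ge\left(T\min\{6-3K,\,K+2\}-(K+4)\max\left\{\frac1{a(1)(2-K)},1\right\}\right)E_y(0)$$ for any $T>0$.
   Context: Degeneracy. $a$ is weakly degenerate (WD) if $a\in C[0,1]\cap C^1(0,1]$, $a(0)=0$, $a>0$ on $(0,1]$ and $K:=\sup_{x\in(0,1]}\frac{x|a'(x)|}{a(x)}\in(0,1)$; $a$ is strongly degenerate (SD) if $a\in C^1[0,1]$, $a(0)=0$, $a>0$ on $(0,1]$ and $K\in[1,2)$. Spaces. If $a$ is (WD), $H^2_{a,0}(0,1)$ is the set of $u\in H^1_0(0,1)$ with $u'$ absolutely continuous on $[0,1]$, $u'(0)=u'(1)=0$, $\sqrt a u''\in L^2(0,1)$. If $a$ is (SD), it is the set of $u\in H^1_0(0,1)$ with $u'$ locally absolutely continuous on $(0,1]$, $u'(1)=0$, $\sqrt a u''\in L^2(0,1)$. $\mathcal H_0:=H^2_{a,0}(0,1)\times L^2(0,1)$ with $\|(u,v)\|^2_{\mathcal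 H_0}=\int_0^1 a(u'')^2dx+\int_0^1v^2dx$. $D(A)$ is the set of $u\in H^2_{a,0}(0,1)$ with $au''\in H^2(0,1)$ and, if $a$ is (SD), $(au'')(0)=0$; $Au:=(au'')''$; $\mathcal A(u,v):=(v,-Au)$ on $D(\mathcal A):=D(A)\times H^2_{a,0}(0,1)$ generates a contraction semigroup $(T(t))_{t\ge0}$ on $\mathcal H_0$. The mild solution with data $(y_T^0,y_T^1)\in\mathcal H_0$ is the first component of $(y(t),y_t(t))=T(t)(y_T^0,y_T^1)$; it is classical if the data are in $D(\mathcal A)$. For mild solutions the trace $y_{xx}(\cdot,1)\in L^2(0,T)$ is the $L^2(0,T)$-limit of the traces of classical solutions whose data converge in $\mathcal H_0$. Energy: $E_y(t):=\frac12\int_0^1(y_t^2(t,x)+a(x)y_{xx}^2(t,x))dx$. *)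

theory Defs
  imports "HOL-Analysis.Analysis"
begin

text \<open>
  Every function of the space variable has type \<^typ>\<open>real \<Rightarrow> real\<close>, and only its values on
  \<open>[0,1]\<close> matter.  Sobolev functions are given by their continuous representatives on \<open>[0,1]\<close>
  (on \<open>(0,1]\<close> for \<open>u'\<close> in the strongly degenerate case); elements of \<open>L\<^sup>2\<close> are arbitrary
  representatives, so that equality in \<open>H\<^sub>0\<close> is rendered as distance zero.
\<close>

section \<open>Derivatives, absolute continuity, Lebesgue and Sobolev spaces\<close>

text \<open>One-sided at the end points; arbitrary where the derivative does not exist.\<close>

definition ddx :: "(real \<Rightarrow> real) \<Rightarrow> real \<Rightarrow> real" where
  "ddx f x = vector_derivative f (at x within {0..1})"

definition differentiable_ae :: "(real \<Rightarrow> real) \<Rightarrow> bool" where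
  "differentiable_ae f \<longleftrightarrow> (AE x in lebesgue_on {0..1}. f differentiable (at x within {0..1}))"

text \<open>
  A family \<open>\<D>\<close> with \<open>\<D> division_of U\<close> is a finite family of nonempty, nonoverlapping compact
  intervals with union \<open>U\<close>; the member \<open>k\<close> is the interval from \<open>Inf k\<close> to \<open>Sup k\<close>.
\<close>

definition absolutely_continuous_on :: "real set \<Rightarrow> (real \<Rightarrow> real) \<Rightarrow> bool" where
  "absolutely_continuous_on S f \<longleftrightarrow>
     (\<forall>\<epsilon>>0. \<exists>\<delta>>0. \<forall>\<D> U. \<D> division_of U \<and> U \<subseteq> S \<and> (\<Sum>k\<in>\<D>. Sup k - Inf k) < \<delta>
        \<longrightarrow> (\<Sum>k\<in>\<D>. \<bar>f (Sup k) - f (Inf k)\<bar>) < \<epsilon>)"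

definition L2 :: "real set \<Rightarrow> (real \<Rightarrow> real) set" where
  "L2 S = {f. f \<in> borel_measurable (lebesgue_on S) \<and> integrable (lebesgue_on S) (\<lambda>x. (f x)\<^sup>2)}"

definition L2_tendsto :: "real set \<Rightarrow> (nat \<Rightarrow> real \<Rightarrow> real) \<Rightarrow> (real \<Rightarrow> real) \<Rightarrow> bool" where
  "L2_tendsto S f g \<longleftrightarrow> (\<forall>n. f n \<in> L2 S) \<and> g \<in> L2 S \<and>
     (\<lambda>n. LINT t|lebesgue_on S. (f n t - g t)\<^sup>2) \<longlonglongrightarrow> 0"

text \<open>
  In one dimension \<open>H\<^sup>1(0,1)\<close> consists of the absolutely continuous functions whose derivative is
  in \<open>L\<^sup>2\<close>.  Here and below, \<^const>\<open>differentiable_ae\<close> says explicitly that the almost everywhere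
  derivative denoted by \<^const>\<open>ddx\<close> exists; by Lebesgue's theorem absolute continuity implies it.
\<close>

definition H1_0 :: "(real \<Rightarrow> real) set" where
  "H1_0 = {u. absolutely_continuous_on {0..1} u \<and> differentiable_ae u \<and> ddx u \<in> L2 {0..1} \<and>
              u 0 = 0 \<and> u 1 = 0}"

definition H2 :: "(real \<Rightarrow> real) set" where
  "H2 = {p. (\<forall>x\<in>{0..1}. p differentiable (at x within {0..1})) \<and>
            absolutely_continuous_on {0..1} (ddx p) \<and> differentiable_ae (ddx p) \<and>
            ddx (ddx p) \<in> L2 {0..1}}"

section \<open>Degenerate coefficients\<close>

definition degeneracy_quotient :: "(real \<Rightarrow> real) \<Rightarrow> real \<Rightarrow> real" where
  "degeneracy_quotient a x = x * \<bar>ddx a x\<bar> / a x"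

definition degeneracy_constant :: "(real \<Rightarrow> real) \<Rightarrow> real" where
  "degeneracy_constant a = (SUP x\<in>{0<..1}. degeneracy_quotient a x)"

text \<open>
  The supremum of an unbounded set of reals is unspecified in HOL, hence the boundedness conditions.
\<close>

definition weakly_degenerate :: "(real \<Rightarrow> real) \<Rightarrow> bool" where
  "weakly_degenerate a \<longleftrightarrow>
     continuous_on {0..1} a \<and>
     (\<forall>x\<in>{0<..1}. a differentiable (at x within {0..1})) \<and> continuous_on {0<..1} (ddx a) \<and>
     a 0 = 0 \<and> (\<forall>x\<in>{0<..1}. a x > 0) \<and>
     bdd_above (degeneracy_quotient a ` {0<..1}) \<and> degeneracy_constant a \<in> {0<..<1}"

definition strongly_degenerate :: "(real \<Rightarrow> real) \<Rightarrow> bool" where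
  "strongly_degenerate a \<longleftrightarrow>
     (\<forall>x\<in>{0..1}. a differentiable (at x within {0..1})) \<and> continuous_on {0..1} (ddx a) \<and>
     a 0 = 0 \<and> (\<forall>x\<in>{0<..1}. a x > 0) \<and>
     bdd_above (degeneracy_quotient a ` {0<..1}) \<and> degeneracy_constant a \<in> {1..<2}"

section \<open>The spaces \<open>H\<^sup>2\<^sub>a\<^sub>,\<^sub>0\<close> and \<open>H\<^sub>0\<close>\<close>

text \<open>
  The two cases exclude each other, and the second branch is only used for strongly degenerate
  coefficients.  That \<open>u'\<close> is (locally) absolutely continuous means that the continuous
  representative \<open>u\<close> is differentiable with (locally) absolutely continuous derivative.
\<close>

definition H2a0 :: "(real \<Rightarrow> real) \<Rightarrow> (real \<Rightarrow> real) set" where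
  "H2a0 a = {u \<in> H1_0.
     (if weakly_degenerate a
      then (\<forall>x\<in>{0..1}. u differentiable (at x within {0..1})) \<and>
           absolutely_continuous_on {0..1} (ddx u) \<and> ddx u 0 = 0 \<and> ddx u 1 = 0
      else (\<forall>x\<in>{0<..1}. u differentiable (at x within {0..1})) \<and>
           (\<forall>c\<in>{0<..<1}. absolutely_continuous_on {c..1} (ddx u)) \<and> ddx u 1 = 0) \<and>
     differentiable_ae (ddx u) \<and>
     (\<lambda>x. sqrt (a x) * ddx (ddx u) x) \<in> L2 {0..1}}"

type_synonym state = "(real \<Rightarrow> real) \<times> (real \<Rightarrow> real)"

definition H0 :: "(real \<Rightarrow> real) \<Rightarrow> state set" where
  "H0 a = H2a0 a \<times> L2 {0..1}"

definition H0_norm :: "(real \<Rightarrow> real) \<Rightarrow> state \<Rightarrow> real" where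
  "H0_norm a w = sqrt ((LINT x|lebesgue_on {0..1}. a x * (ddx (ddx (fst w)) x)\<^sup>2) +
                       (LINT x|lebesgue_on {0..1}. (snd w x)\<^sup>2))"

definition lincomb :: "real \<Rightarrow> state \<Rightarrow> real \<Rightarrow> state \<Rightarrow> state" where
  "lincomb c w d z = (\<lambda>x. c * fst w x + d * fst z x, \<lambda>x. c * snd w x + d * snd z x)"

definition H0_dist :: "(real \<Rightarrow> real) \<Rightarrow> state \<Rightarrow> state \<Rightarrow> real" where
  "H0_dist a w z = H0_norm a (lincomb 1 w (-1) z)"

section \<open>The operator and its semigroup\<close>

text \<open>
  \<open>p\<close> is the \<open>C\<^sup>1\<close> representative of \<open>a u''\<close> witnessing \<open>a u'' \<in> H\<^sup>2(0,1)\<close>; it is unique on \<open>[0,1]\<close>.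
\<close>

definition represents_auxx :: "(real \<Rightarrow> real) \<Rightarrow> (real \<Rightarrow> real) \<Rightarrow> (real \<Rightarrow> real) \<Rightarrow> bool" where
  "represents_auxx a u p \<longleftrightarrow>
     p \<in> H2 \<and> (AE x in lebesgue_on {0..1}. p x = a x * ddx (ddx u) x)"

definition auxx :: "(real \<Rightarrow> real) \<Rightarrow> (real \<Rightarrow> real) \<Rightarrow> (real \<Rightarrow> real)" where
  "auxx a u = (SOME p. represents_auxx a u p)"

definition dom_A :: "(real \<Rightarrow> real) \<Rightarrow> (real \<Rightarrow> real) set" where
  "dom_A a = {u \<in> H2a0 a. (\<exists>p. represents_auxx a u p) \<and>
                           (strongly_degenerate a \<longrightarrow> auxx a u 0 = 0)}"

definition op_A :: "(real \<Rightarrow> real) \<Rightarrow> (real \<Rightarrow> real) \<Rightarrow> (real \<Rightarrow> real)" where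
  "op_A a u = ddx (ddx (auxx a u))"

definition dom_AA :: "(real \<Rightarrow> real) \<Rightarrow> state set" where
  "dom_AA a = dom_A a \<times> H2a0 a"

definition op_AA :: "(real \<Rightarrow> real) \<Rightarrow> state \<Rightarrow> state" where
  "op_AA a w = (snd w, \<lambda>x. - op_A a (fst w) x)"

text \<open>Strongly continuous semigroup of linear contractions, all laws being equalities in \<open>H\<^sub>0\<close>.\<close>

definition contraction_semigroup :: "(real \<Rightarrow> real) \<Rightarrow> (real \<Rightarrow> state \<Rightarrow> state) \<Rightarrow> bool" where
  "contraction_semigroup a S \<longleftrightarrow>
     (\<forall>t\<ge>0. \<forall>w\<in>H0 a. S t w \<in> H0 a) \<and>
     (\<forall>t\<ge>0. \<forall>w\<in>H0 a. \<forall>z\<in>H0 a. \<forall>c d.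
        H0_dist a (S t (lincomb c w d z)) (lincomb c (S t w) d (S t z)) = 0) \<and>
     (\<forall>t\<ge>0. \<forall>w\<in>H0 a. H0_norm a (S t w) \<le> H0_norm a w) \<and>
     (\<forall>w\<in>H0 a. H0_dist a (S 0 w) w = 0) \<and>
     (\<forall>s\<ge>0. \<forall>t\<ge>0. \<forall>w\<in>H0 a. H0_dist a (S (s + t) w) (S s (S t w)) = 0) \<and>
     (\<forall>w\<in>H0 a. ((\<lambda>t. H0_dist a (S t w) w) \<longlongrightarrow> 0) (at_right 0))"

text \<open>
  The graph of the infinitesimal generator of \<open>S\<close> is the graph of \<^const>\<open>op_AA\<close>, both taken up to
  equality in \<open>H\<^sub>0\<close>.
\<close>

definition generated_by_AA :: "(real \<Rightarrow> real) \<Rightarrow> (real \<Rightarrow> state \<Rightarrow> state) \<Rightarrow> bool" where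
  "generated_by_AA a S \<longleftrightarrow>
     (\<forall>w\<in>H0 a. \<forall>z\<in>H0 a.
        ((\<lambda>h. H0_dist a (lincomb (1 / h) (S h w) (- 1 / h) w) z) \<longlongrightarrow> 0) (at_right 0) \<longleftrightarrow>
        (\<exists>w'\<in>dom_AA a. H0_dist a w w' = 0 \<and> H0_dist a z (op_AA a w') = 0))"

section \<open>Solutions, boundary trace, energy\<close>

text \<open>
  \<open>y t\<close> and \<open>yt t\<close> are the functions of \<open>x\<close> given by \<open>y(t,\<cdot>)\<close> and \<open>y\<^sub>t(t,\<cdot>)\<close>.  The semigroup is
  determined by its generator, so the existential quantifier selects it.
\<close>

definition mild_solution ::
  "(real \<Rightarrow> real) \<Rightarrow> (real \<Rightarrow> real) \<Rightarrow> (real \<Rightarrow> real) \<Rightarrow>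
   (real \<Rightarrow> real \<Rightarrow> real) \<Rightarrow> (real \<Rightarrow> real \<Rightarrow> real) \<Rightarrow> bool" where
  "mild_solution a y0 y1 y yt \<longleftrightarrow>
     (y0, y1) \<in> H0 a \<and>
     (\<exists>S. contraction_semigroup a S \<and> generated_by_AA a S \<and>
        (\<forall>t\<ge>0. (y t, yt t) \<in> H0 a \<and> H0_dist a (y t, yt t) (S t (y0, y1)) = 0))"

definition classical_solution ::
  "(real \<Rightarrow> real) \<Rightarrow> (real \<Rightarrow> real) \<Rightarrow> (real \<Rightarrow> real) \<Rightarrow>
   (real \<Rightarrow> real \<Rightarrow> real) \<Rightarrow> (real \<Rightarrow> real \<Rightarrow> real) \<Rightarrow> bool" where
  "classical_solution a y0 y1 y yt \<longleftrightarrow> (y0, y1) \<in> dom_AA a \<and> mild_solution a y0 y1 y yt"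

text \<open>
  \<open>g\<close> is the trace \<open>y\<^sub>x\<^sub>x(\<cdot>,1)\<close> on \<open>(0,T)\<close> of the mild solution \<open>y\<close> with data \<open>(y0, y1)\<close>: the
  \<open>L\<^sup>2(0,T)\<close>-limit of the traces of classical solutions \<open>Y n\<close> whose data converge in \<open>H\<^sub>0\<close> to
  those of \<open>y\<close>.  For \<open>u\<close> in \<^const>\<open>dom_A\<close> the derivative \<open>u'\<close> is \<open>C\<^sup>1\<close> on \<open>(0,1]\<close>, so
  \<open>ddx (ddx u) 1\<close> is a genuine one-sided derivative.
\<close>

definition boundary_trace ::
  "(real \<Rightarrow> real) \<Rightarrow> real \<Rightarrow> (real \<Rightarrow> real) \<Rightarrow> (real \<Rightarrow> real) \<Rightarrow> (real \<Rightarrow> real) \<Rightarrow> bool" where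
  "boundary_trace a T y0 y1 g \<longleftrightarrow>
     (\<exists>Y0 Y1 Y Yt.
        (\<forall>n. classical_solution a (Y0 n) (Y1 n) (Y n) (Yt n)) \<and>
        (\<lambda>n::nat. H0_dist a (Y0 n, Y1 n) (y0, y1)) \<longlonglongrightarrow> 0 \<and>
        L2_tendsto {0..T} (\<lambda>n t. ddx (ddx (Y n t)) 1) g)"

definition energy ::
  "(real \<Rightarrow> real) \<Rightarrow> (real \<Rightarrow> real \<Rightarrow> real) \<Rightarrow> (real \<Rightarrow> real \<Rightarrow> real) \<Rightarrow> real \<Rightarrow> real" where
  "energy a y yt t =
     1 / 2 * (LINT x|lebesgue_on {0..1}. (yt t x)\<^sup>2 + a x * (ddx (ddx (y t)) x)\<^sup>2)"

end

theory Submission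
  imports Defs
begin

text \<open>
  For data in the domain of the generator, differentiate
  \<open>\<rho>(t) = 2 \<integral> x y\<^sub>x y\<^sub>t dx - (K/2) \<integral> y y\<^sub>t dx\<close>.
  With \<open>x \<bar>a'\<bar> \<le> K a\<close>, integration by parts gives
  \<open>\<rho>'(t) \<le> a(1) y\<^sub>x\<^sub>x(t,1)\<^sup>2 - min (6 - 3K) (K + 2) E\<close>, where the energy \<open>E\<close> is constant;
  the boundary terms at \<open>x = 0\<close> vanish by the boundary conditions there and by the pointwise bound
  \<open>x u'(x)\<^sup>2 \<le> (\<integral> a u''\<^sup>2) / (a(1) (2 - K))\<close>, which together with \<open>u(1) = u'(1) = 0\<close> also yields
  \<open>\<bar>\<rho>\<bar> \<le> (2 + K/2) max {1 / (a(1) (2 - K)), 1} E\<close>.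
  Integrating over \<open>(0,T)\<close> proves the inequality for classical solutions, and both sides pass to
  the limit defining the trace.
\<close>

section \<open>Absolutely continuous functions\<close>

text \<open>Two obstacles shape the proof. In the strongly degenerate case \<open>u'\<close> is
  controlled only away from 0 and may be unbounded there, so integral identities come from explicit
  antiderivatives on \<open>[c,1]\<close>, followed by \<open>c\<close> tending to 0. And elements
  of \<open>H0\<close> are representatives, moved forward in time only; so a solution is never
  differentiated in \<open>t\<close> at fixed \<open>x\<close>. Instead a bounded bilinear form is
  differentiated along an orbit, with errors uniform by contractivity, once for both the inner
  product and \<rho>.

  Origin of the constants: the multiplier \<open>2 x y_x\<close> alone gives the weights
  \<open>3 - K\<close> on \<open>\<integral> a y_xx^2\<close> and 1 on
  \<open>\<integral> y_t^2\<close>. The term \<open>-(K/2) y y_t\<close> moves \<open>K/2\<close>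
  from the first to the second, leaving \<open>3 - 3K/2\<close> and \<open>1 + K/2\<close>, both
  positive as \<open>0 < K < 2\<close>. The energy is half the squared norm, hence
  \<open>6 - 3K\<close> and \<open>K + 2\<close>. The bound on \<rho> is used at both
  \<open>t = 0\<close> and \<open>t = T\<close>, which turns \<open>2 + K/2\<close> into
  \<open>K + 4\<close>.\<close>

lemma absolutely_continuous_on_subset:
  "absolutely_continuous_on S f \<Longrightarrow> T \<subseteq> S \<Longrightarrow> absolutely_continuous_on T f"
  unfolding absolutely_continuous_on_def by (meson subset_trans)

text \<open>Henstock--Kurzweil argument. Outside \<open>N\<close> the gauge is taken from
  differentiability; at a point of \<open>N\<close> it stays inside an open \<open>G\<close> of
  measure below the \<delta> of absolute continuity. Intervals tagged outside \<open>N\<close> then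
  contribute an error proportional to their length, and those tagged in \<open>N\<close> contribute
  little by absolute continuity alone.\<close>

lemma absolutely_continuous_on_has_integral:
  fixes f f' :: "real \<Rightarrow> real"
  assumes ac: "absolutely_continuous_on {c..d} f" and "c \<le> d" and N: "negligible N"
    and deriv: "\<And>x. x \<in> {c..d} - N \<Longrightarrow> (f has_vector_derivative f' x) (at x within {c..d})"
  shows "(f' has_integral (f d - f c)) {c..d}"
proof (cases "c = d")
  case True
  then show ?thesis using has_integral_refl(1)[of f' c] by simp
next
  case False
  with \<open>c \<le> d\<close> have "c < d" by simp
  \<comment> \<open>With the derivative redefined as 0 on the null set, only the increments of
    \<open>f\<close> remain to be estimated at tags in \<open>N\<close>.\<close>
  define g where "g = (\<lambda>x. if x \<in> N then 0 else f' x)"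
  have "(g has_integral (f d - f c)) {c..d}"
    unfolding has_integral_factor_content_real
  proof (intro allI impI)
    fix e :: real
    assume "e > 0"
    obtain \<delta> where "\<delta> > 0" and \<delta>: "\<And>\<D> U. \<D> division_of U \<Longrightarrow> U \<subseteq> {c..d} \<Longrightarrow>
        (\<Sum>k\<in>\<D>. Sup k - Inf k) < \<delta> \<Longrightarrow> (\<Sum>k\<in>\<D>. \<bar>f (Sup k) - f (Inf k)\<bar>) < e / 2 * (d - c)"
    proof -
      have "e / 2 * (d - c) > 0" using \<open>e > 0\<close> \<open>c < d\<close> by simp
      from ac[unfolded absolutely_continuous_on_def, rule_format, OF this]
      show thesis using that by blast
    qed
    obtain G where "open G" "N \<subseteq> G" "G \<in> lmeasurable" and G: "measure lebesgue G < \<delta>"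
    proof -
      obtain G where G: "open G" "N \<subseteq> G" "G - N \<in> lmeasurable" "emeasure lebesgue (G - N) < ennreal \<delta>"
        using sets_lebesgue_outer_open[OF negligible_imp_sets[OF N] \<open>\<delta> > 0\<close>] by metis
      have "G \<in> lmeasurable"
        using G N by (metis Diff_partition fmeasurable.Un negligible_imp_measurable)
      moreover have "measure lebesgue G = measure lebesgue (G - N)"
        using N G by (metis measure_Diff_null_set negligible_iff_null_sets lmeasurable_open
            \<open>G \<in> lmeasurable\<close> fmeasurableD)
      moreover have "measure lebesgue (G - N) < \<delta>"
        using G(3,4) \<open>\<delta> > 0\<close> by (simp add: emeasure_eq_measure2 ennreal_less_iff)
      ultimately show thesis using that G by simp
    qed
    have "\<exists>r>0. (x \<in> N \<longrightarrow> ball x r \<subseteq> G) \<and>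
       (x \<in> {c..d} - N \<longrightarrow> (\<forall>y\<in>{c..d}. \<bar>y - x\<bar> < r \<longrightarrow>
           \<bar>f y - f x - (y - x) * f' x\<bar> \<le> e / 2 * \<bar>y - x\<bar>))" for x
    proof (cases "x \<in> {c..d} - N")
      case True
      have "(f has_derivative (\<lambda>h. h * f' x)) (at x within {c..d})"
        using deriv[OF True] by (simp add: has_vector_derivative_def)
      then show ?thesis
        using True \<open>e > 0\<close> unfolding has_derivative_within_alt
        by (auto simp: real_norm_def dest!: spec[where x = "e/2"])
    next
      case False
      show ?thesis
      proof (cases "x \<in> N")
        case True
        then show ?thesis using \<open>open G\<close> \<open>N \<subseteq> G\<close> False by (metis subsetD openE)
      next
        case nN: False
        then show ?thesis using False by (auto intro: exI[of _ 1])
      qed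
    qed
    then obtain r where r: "\<And>x. r x > 0" "\<And>x. x \<in> N \<Longrightarrow> ball x (r x) \<subseteq> G"
      "\<And>x y. x \<in> {c..d} - N \<Longrightarrow> y \<in> {c..d} \<Longrightarrow> \<bar>y - x\<bar> < r x \<Longrightarrow>
           \<bar>f y - f x - (y - x) * f' x\<bar> \<le> e / 2 * \<bar>y - x\<bar>"
      by metis
    show "\<exists>\<gamma>. gauge \<gamma> \<and> (\<forall>p. p tagged_division_of {c..d} \<and> \<gamma> fine p \<longrightarrow>
        norm ((\<Sum>(x, k)\<in>p. measure lborel k *\<^sub>R g x) - (f d - f c)) \<le> e * measure lborel {c..d})"
    proof (intro exI conjI allI impI)
      show "gauge (\<lambda>x. ball x (r x))" using r(1) by (simp add: gauge_def)
      fix p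
      assume p: "p tagged_division_of {c..d} \<and> (\<lambda>x. ball x (r x)) fine p"
      then have td: "p tagged_division_of {c..d}" and fin: "finite p" by auto
      have k: "\<exists>u v. k = {u..v} \<and> u \<le> x \<and> x \<le> v \<and> c \<le> u \<and> v \<le> d \<and> k \<subseteq> ball x (r x)"
        if xk: "(x, k) \<in> p" for x k
      proof -
        obtain u v where uv: "k = cbox u v" using tagged_division_ofD(4)[OF td xk] by blast
        have "x \<in> k" "k \<subseteq> {c..d}" using td that by (auto dest: tagged_division_ofD)
        moreover have "k \<subseteq> ball x (r x)" using p that by (auto simp: fine_def)
        ultimately show ?thesis using uv by (intro exI[of _ u] exI[of _ v]) auto
      qed
      define q where "q = {(x, k) \<in> p. x \<in> N}"
      have q: "q \<subseteq> p" by (auto simp: q_def)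
      have tq: "q tagged_partial_division_of {c..d}"
        using td q by (meson tagged_division_of_def tagged_partial_division_subset)
      have dq: "snd ` q division_of \<Union>(snd ` q)"
        using tq by (rule partial_division_of_tagged_division)
      have tdq: "q tagged_division_of \<Union>(snd ` q)"
        using tq by (rule tagged_partial_division_of_Union_self)
      have qs: "\<Union>(snd ` q) \<subseteq> {c..d}" "\<Union>(snd ` q) \<subseteq> G"
        using k r(2) by (fastforce simp: q_def)+
      have "(\<Sum>k\<in>snd ` q. Sup k - Inf k) = (\<Sum>k\<in>snd ` q. measure lebesgue k)"
        by (rule sum.cong[OF refl]) (use k q in fastforce)
      also have "\<dots> = measure lebesgue (\<Union>(snd ` q))"
        using dq by (rule content_division)
      also have "\<dots> \<le> measure lebesgue G"
        using qs dq \<open>G \<in> lmeasurable\<close> by (intro measure_mono_fmeasurable)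
          (auto dest: lmeasurable_division)
      finally have "(\<Sum>k\<in>snd ` q. \<bar>f (Sup k) - f (Inf k)\<bar>) < e / 2 * (d - c)"
        using \<delta>[OF dq qs(1)] G by linarith
      moreover have "(\<Sum>(x, k)\<in>q. \<bar>f (Sup k) - f (Inf k)\<bar>) = (\<Sum>k\<in>snd ` q. \<bar>f (Sup k) - f (Inf k)\<bar>)"
      proof -
        \<comment> \<open>Two tags can share an interval only if its interior is empty, and there
          the increment is 0. The value at the empty set is fixed by hand because \<open>Sup\<close>
          and \<open>Inf\<close> are unspecified there.\<close>
        let ?h = "\<lambda>k. if k = {} then 0 else \<bar>f (Sup k) - f (Inf k)\<bar>"
        have ne: "k \<noteq> {}" if "(x, k) \<in> q" for x k using k q that by fastforce
        have "(\<Sum>(x, k)\<in>q. ?h k) = (\<Sum>k\<in>snd ` q. ?h k)"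
        proof (rule sum.over_tagged_division_lemma[OF tdq])
          fix u v :: real
          assume "box u v = {}"
          then have "cbox u v = {} \<or> cbox u v = {u}" by auto
          then show "?h (cbox u v) = 0" by auto
        qed
        moreover have "(\<Sum>(x, k)\<in>q. ?h k) = (\<Sum>(x, k)\<in>q. \<bar>f (Sup k) - f (Inf k)\<bar>)"
          using ne by (intro sum.cong) auto
        moreover have "(\<Sum>k\<in>snd ` q. ?h k) = (\<Sum>k\<in>snd ` q. \<bar>f (Sup k) - f (Inf k)\<bar>)"
          using ne by (intro sum.cong) auto
        ultimately show ?thesis by simp
      qed
      ultimately have qsum: "(\<Sum>(x, k)\<in>q. \<bar>f (Sup k) - f (Inf k)\<bar>) < e / 2 * (d - c)" by simp
      have "(\<Sum>(x, k)\<in>p. measure lborel k *\<^sub>R g x) - (f d - f c)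
          = (\<Sum>(x, k)\<in>p. measure lborel k *\<^sub>R g x) - (\<Sum>(x, k)\<in>p. f (Sup k) - f (Inf k))"
        using additive_tagged_division_1[OF \<open>c \<le> d\<close> td, of f] by simp
      also have "\<dots> = (\<Sum>(x, k)\<in>p. measure lborel k * g x - (f (Sup k) - f (Inf k)))"
        by (simp add: sum_subtractf case_prod_unfold)
      also have "\<bar>\<dots>\<bar> \<le> (\<Sum>(x, k)\<in>p. \<bar>measure lborel k * g x - (f (Sup k) - f (Inf k))\<bar>)"
        using sum_abs by (auto simp: case_prod_unfold)
      also have "\<dots> \<le> (\<Sum>(x, k)\<in>p. e / 2 * measure lborel k +
          (if x \<in> N then \<bar>f (Sup k) - f (Inf k)\<bar> else 0))"
      proof (rule sum_mono, clarify)
        fix x k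
        assume xk: "(x, k) \<in> p"
        obtain u v where uv: "k = {u..v}" "u \<le> x" "x \<le> v" "c \<le> u" "v \<le> d" "k \<subseteq> ball x (r x)"
          using k[OF xk] by blast
        then have SI: "Sup k = v" "Inf k = u" "measure lborel k = v - u" by auto
        show "\<bar>measure lborel k * g x - (f (Sup k) - f (Inf k))\<bar> \<le> e / 2 * measure lborel k +
          (if x \<in> N then \<bar>f (Sup k) - f (Inf k)\<bar> else 0)"
        proof (cases "x \<in> N")
          case True
          moreover have "0 \<le> e * (v - u)" using \<open>e > 0\<close> uv by simp
          ultimately show ?thesis by (simp add: g_def SI abs_minus_commute)
        next
          case False
          have "u \<in> k" "v \<in> k" using uv by auto
          then have "u \<in> ball x (r x)" "v \<in> ball x (r x)" using uv(6) by blast+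
          then have "\<bar>u - x\<bar> < r x" "\<bar>v - x\<bar> < r x" by (auto simp: dist_real_def)
          then have "\<bar>f u - f x - (u - x) * f' x\<bar> \<le> e / 2 * \<bar>u - x\<bar>"
            "\<bar>f v - f x - (v - x) * f' x\<bar> \<le> e / 2 * \<bar>v - x\<bar>"
            using r(3)[of x u] r(3)[of x v] uv False by simp_all
          \<comment> \<open>Since \<open>u \<le> x \<le> v\<close>, the errors on the two sides of
            the tag add up to \<open>e / 2\<close> times the full length.\<close>
          then have "\<bar>(v - u) * f' x - (f v - f u)\<bar> \<le> e / 2 * (v - u)"
            using uv by (simp add: abs_if algebra_simps split: if_splits)
          then show ?thesis using False by (simp add: g_def SI)
        qed
      qed
      also have "\<dots> = e / 2 * (\<Sum>(x, k)\<in>p. measure lborel k) +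
           (\<Sum>(x, k)\<in>p. if x \<in> N then \<bar>f (Sup k) - f (Inf k)\<bar> else 0)"
        by (simp add: sum.distrib case_prod_unfold sum_distrib_left)
      also have "(\<Sum>(x, k)\<in>p. measure lborel k) = d - c"
        using additive_content_tagged_division[of p c d] td \<open>c < d\<close> by simp
      also have "(\<Sum>(x, k)\<in>p. if x \<in> N then \<bar>f (Sup k) - f (Inf k)\<bar> else 0)
          = (\<Sum>(x, k)\<in>q. \<bar>f (Sup k) - f (Inf k)\<bar>)"
        unfolding q_def using fin by (intro sum.mono_neutral_cong_right) (auto split: if_splits)
      also have "e / 2 * (d - c) + (\<Sum>(x, k)\<in>q. \<bar>f (Sup k) - f (Inf k)\<bar>)
          \<le> e / 2 * (d - c) + e / 2 * (d - c)"
        using qsum by (intro add_left_mono less_imp_le)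
      also have "\<dots> = e * measure lborel {c..d}" using \<open>c < d\<close> by simp
      finally show "norm ((\<Sum>(x, k)\<in>p. measure lborel k *\<^sub>R g x) - (f d - f c)) \<le> e * measure lborel {c..d}"
        unfolding real_norm_def .
    qed
  qed
  then show ?thesis
    by (rule has_integral_spike[OF N, rotated]) (auto simp: g_def)
qed

lemma absolutely_continuous_on_interval:
  assumes "absolutely_continuous_on {c..d} f" "\<epsilon> > 0"
  obtains \<delta> where "\<delta> > 0"
    "\<And>x y. c \<le> x \<Longrightarrow> x \<le> y \<Longrightarrow> y \<le> d \<Longrightarrow> y - x < \<delta> \<Longrightarrow> \<bar>f y - f x\<bar> < \<epsilon>"
proof -
  obtain \<delta> where "\<delta> > 0" and \<delta>: "\<And>\<D> U. \<D> division_of U \<Longrightarrow> U \<subseteq> {c..d} \<Longrightarrow>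
        (\<Sum>k\<in>\<D>. Sup k - Inf k) < \<delta> \<Longrightarrow> (\<Sum>k\<in>\<D>. \<bar>f (Sup k) - f (Inf k)\<bar>) < \<epsilon>"
    using assms(1)[unfolded absolutely_continuous_on_def, rule_format, OF assms(2)] by blast
  have "\<bar>f y - f x\<bar> < \<epsilon>" if "c \<le> x" "x \<le> y" "y \<le> d" "y - x < \<delta>" for x y
  proof -
    have "{{x..y}} division_of {x..y}"
      using that division_of_self[of x y] by simp
    from \<delta>[OF this] that show ?thesis by simp
  qed
  then show thesis using that \<open>\<delta> > 0\<close> by blast
qed

lemma absolutely_continuous_on_imp_continuous_on:
  assumes "absolutely_continuous_on {c..d} f"
  shows "continuous_on {c..d} f"
  unfolding continuous_on_iff
proof (intro ballI allI impI)
  fix x \<epsilon> :: real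
  assume x: "x \<in> {c..d}" and "\<epsilon> > 0"
  from absolutely_continuous_on_interval[OF assms \<open>\<epsilon> > 0\<close>] obtain \<delta> where "\<delta> > 0" and
    \<delta>: "\<And>x y. c \<le> x \<Longrightarrow> x \<le> y \<Longrightarrow> y \<le> d \<Longrightarrow> y - x < \<delta> \<Longrightarrow> \<bar>f y - f x\<bar> < \<epsilon>" by metis
  have "dist (f y) (f x) < \<epsilon>" if "y \<in> {c..d}" "dist y x < \<delta>" for y
    using \<delta>[of x y] \<delta>[of y x] that x by (cases "x \<le> y") (auto simp: dist_real_def abs_minus_commute)
  then show "\<exists>\<delta>>0. \<forall>y\<in>{c..d}. dist y x < \<delta> \<longrightarrow> dist (f y) (f x) < \<epsilon>"
    using \<open>\<delta> > 0\<close> by blast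
qed

text \<open>Increments are compared interval by interval, so smallness of the sums transfers. Linear
  combinations, products, \<open>C1\<close> functions and congruence on an interval are instances
  with different \<open>M\<close>.\<close>

lemma absolutely_continuous_on_dominated:
  assumes f: "absolutely_continuous_on S f" and g: "absolutely_continuous_on S g"
    and "M \<ge> 0" and S: "S = {c..d}"
    and dom: "\<And>x y. x \<in> S \<Longrightarrow> y \<in> S \<Longrightarrow> x \<le> y \<Longrightarrow>
      \<bar>h y - h x\<bar> \<le> M * (\<bar>f y - f x\<bar> + \<bar>g y - g x\<bar>)"
  shows "absolutely_continuous_on S h"
  unfolding absolutely_continuous_on_def
proof (intro allI impI)
  fix \<epsilon> :: real
  assume "\<epsilon> > 0"
  \<comment> \<open>\<open>M + 1\<close> in place of \<open>M\<close> covers \<open>M = 0\<close>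
    and makes the final inequality strict.\<close>
  then have e: "\<epsilon> / (2 * (M + 1)) > 0" using \<open>M \<ge> 0\<close> by simp
  obtain \<delta>1 where "\<delta>1 > 0" and \<delta>1: "\<And>\<D> U. \<D> division_of U \<Longrightarrow> U \<subseteq> S \<Longrightarrow>
      (\<Sum>k\<in>\<D>. Sup k - Inf k) < \<delta>1 \<Longrightarrow> (\<Sum>k\<in>\<D>. \<bar>f (Sup k) - f (Inf k)\<bar>) < \<epsilon> / (2 * (M + 1))"
    using f[unfolded absolutely_continuous_on_def, rule_format, OF e] by blast
  obtain \<delta>2 where "\<delta>2 > 0" and \<delta>2: "\<And>\<D> U. \<D> division_of U \<Longrightarrow> U \<subseteq> S \<Longrightarrow>
      (\<Sum>k\<in>\<D>. Sup k - Inf k) < \<delta>2 \<Longrightarrow> (\<Sum>k\<in>\<D>. \<bar>g (Sup k) - g (Inf k)\<bar>) < \<epsilon> / (2 * (M + 1))"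
    using g[unfolded absolutely_continuous_on_def, rule_format, OF e] by blast
  show "\<exists>\<delta>>0. \<forall>\<D> U. \<D> division_of U \<and> U \<subseteq> S \<and> (\<Sum>k\<in>\<D>. Sup k - Inf k) < \<delta>
        \<longrightarrow> (\<Sum>k\<in>\<D>. \<bar>h (Sup k) - h (Inf k)\<bar>) < \<epsilon>"
  proof (intro exI[of _ "min \<delta>1 \<delta>2"] conjI allI impI)
    show "min \<delta>1 \<delta>2 > 0" using \<open>\<delta>1 > 0\<close> \<open>\<delta>2 > 0\<close> by simp
    fix \<D> U
    assume D: "\<D> division_of U \<and> U \<subseteq> S \<and> (\<Sum>k\<in>\<D>. Sup k - Inf k) < min \<delta>1 \<delta>2"
    have "(\<Sum>k\<in>\<D>. \<bar>h (Sup k) - h (Inf k)\<bar>) \<le>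
        (\<Sum>k\<in>\<D>. M * (\<bar>f (Sup k) - f (Inf k)\<bar> + \<bar>g (Sup k) - g (Inf k)\<bar>))"
    proof (rule sum_mono)
      fix k
      assume "k \<in> \<D>"
      then have "\<exists>u v. k = cbox u v" "k \<noteq> {}" "k \<subseteq> S"
        using division_ofD(2-4)[OF conjunct1[OF D] \<open>k \<in> \<D>\<close>] D by auto
      then obtain u v where "k = cbox u v" "k \<noteq> {}" "k \<subseteq> S" by blast
      then have "Sup k = v" "Inf k = u" "u \<le> v" "u \<in> S" "v \<in> S" by auto
      then show "\<bar>h (Sup k) - h (Inf k)\<bar> \<le> M * (\<bar>f (Sup k) - f (Inf k)\<bar> + \<bar>g (Sup k) - g (Inf k)\<bar>)"
        using dom by simp
    qed
    also have "\<dots> = M * ((\<Sum>k\<in>\<D>. \<bar>f (Sup k) - f (Inf k)\<bar>) + (\<Sum>k\<in>\<D>. \<bar>g (Sup k) - g (Inf k)\<bar>))"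
      by (simp add: sum.distrib sum_distrib_left[symmetric])
    also have "\<dots> \<le> M * (\<epsilon> / (2 * (M + 1)) + \<epsilon> / (2 * (M + 1)))"
    proof -
      have "(\<Sum>k\<in>\<D>. Sup k - Inf k) < \<delta>1" "(\<Sum>k\<in>\<D>. Sup k - Inf k) < \<delta>2" using D by auto
      then show ?thesis
        using \<delta>1[of \<D> U] \<delta>2[of \<D> U] D by (intro mult_left_mono[OF _ \<open>M \<ge> 0\<close>] add_mono less_imp_le) auto
    qed
    also have "\<epsilon> / (2 * (M + 1)) + \<epsilon> / (2 * (M + 1)) = \<epsilon> / (M + 1)"
      using field_sum_of_halves[of "\<epsilon> / (M + 1)"] by (simp add: mult.commute)
    also have "M * (\<epsilon> / (M + 1)) = M / (M + 1) * \<epsilon>" by simp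
    also have "\<dots> < 1 * \<epsilon>"
      using \<open>M \<ge> 0\<close> \<open>\<epsilon> > 0\<close> by (intro mult_strict_right_mono) (simp_all add: field_simps)
    also have "\<dots> = \<epsilon>" by simp
    finally show "(\<Sum>k\<in>\<D>. \<bar>h (Sup k) - h (Inf k)\<bar>) < \<epsilon>" .
  qed
qed

lemma absolutely_continuous_on_lincomb:
  assumes "absolutely_continuous_on {l..r} f" "absolutely_continuous_on {l..r} g"
  shows "absolutely_continuous_on {l..r} (\<lambda>x. c * f x + d * g x)"
proof (rule absolutely_continuous_on_dominated[OF assms, of "\<bar>c\<bar> + \<bar>d\<bar>"])
  fix x y
  have "\<bar>c * f y + d * g y - (c * f x + d * g x)\<bar> = \<bar>c * (f y - f x) + d * (g y - g x)\<bar>"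
    by (simp add: algebra_simps)
  also have "\<dots> \<le> \<bar>c\<bar> * \<bar>f y - f x\<bar> + \<bar>d\<bar> * \<bar>g y - g x\<bar>"
    by (metis abs_mult abs_triangle_ineq)
  also have "\<dots> \<le> (\<bar>c\<bar> + \<bar>d\<bar>) * (\<bar>f y - f x\<bar> + \<bar>g y - g x\<bar>)"
    by (simp add: algebra_simps)
  finally show "\<bar>c * f y + d * g y - (c * f x + d * g x)\<bar> \<le>
      (\<bar>c\<bar> + \<bar>d\<bar>) * (\<bar>f y - f x\<bar> + \<bar>g y - g x\<bar>)" .
qed auto

lemma absolutely_continuous_on_mult:
  assumes f: "absolutely_continuous_on {l..r} f" and g: "absolutely_continuous_on {l..r} g"
  shows "absolutely_continuous_on {l..r} (\<lambda>x. f x * g x)"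
proof -
  have "bounded (f ` {l..r})" "bounded (g ` {l..r})"
    using f g by (auto intro!: compact_imp_bounded compact_continuous_image
        dest: absolutely_continuous_on_imp_continuous_on)
  then obtain A B where A: "\<And>x. x \<in> {l..r} \<Longrightarrow> \<bar>f x\<bar> \<le> A" and B: "\<And>x. x \<in> {l..r} \<Longrightarrow> \<bar>g x\<bar> \<le> B"
    by (force simp: bounded_iff)
  show ?thesis
  proof (rule absolutely_continuous_on_dominated[OF f g, of "\<bar>A\<bar> + \<bar>B\<bar>"])
    fix x y
    assume xy: "x \<in> {l..r}" "y \<in> {l..r}"
    have "\<bar>f y * g y - f x * g x\<bar> = \<bar>g y * (f y - f x) + f x * (g y - g x)\<bar>"
      by (simp add: algebra_simps)
    also have "\<dots> \<le> \<bar>g y\<bar> * \<bar>f y - f x\<bar> + \<bar>f x\<bar> * \<bar>g y - g x\<bar>"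
      by (metis abs_mult abs_triangle_ineq)
    also have "\<dots> \<le> (\<bar>A\<bar> + \<bar>B\<bar>) * \<bar>f y - f x\<bar> + (\<bar>A\<bar> + \<bar>B\<bar>) * \<bar>g y - g x\<bar>"
      using A[OF xy(1)] B[OF xy(2)] by (intro add_mono mult_right_mono) auto
    finally show "\<bar>f y * g y - f x * g x\<bar> \<le> (\<bar>A\<bar> + \<bar>B\<bar>) * (\<bar>f y - f x\<bar> + \<bar>g y - g x\<bar>)"
      by (simp add: algebra_simps)
  qed auto
qed

lemma absolutely_continuous_on_ident: "absolutely_continuous_on S (\<lambda>x. x)"
  unfolding absolutely_continuous_on_def
proof (intro allI impI)
  fix \<epsilon> :: real
  assume "\<epsilon> > 0"
  have "(\<Sum>k\<in>\<D>. \<bar>Sup k - Inf k\<bar>) = (\<Sum>k\<in>\<D>. Sup k - Inf k)" if "\<D> division_of U" for \<D> and U :: "real set"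
  proof (rule sum.cong[OF refl])
    fix k
    assume "k \<in> \<D>"
    then have "\<exists>u v. k = cbox u v" "k \<noteq> {}"
      using division_ofD(3,4)[OF that \<open>k \<in> \<D>\<close>] by auto
    then obtain u v where "k = cbox u v" "k \<noteq> {}" by blast
    then show "\<bar>Sup k - Inf k\<bar> = Sup k - Inf k" by auto
  qed
  with \<open>\<epsilon> > 0\<close> show "\<exists>\<delta>>0. \<forall>\<D> U. \<D> division_of U \<and> U \<subseteq> S \<and> (\<Sum>k\<in>\<D>. Sup k - Inf k) < \<delta>
        \<longrightarrow> (\<Sum>k\<in>\<D>. \<bar>Sup k - Inf k\<bar>) < \<epsilon>"
    by (intro exI[of _ \<epsilon>]) auto
qed

text \<open>A bounded derivative makes the function Lipschitz, so its increments are dominated by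
  those of the identity.\<close>

lemma absolutely_continuous_on_C1:
  assumes f: "\<And>x. x \<in> {c..d} \<Longrightarrow> (f has_real_derivative f' x) (at x within {c..d})"
    and "continuous_on {c..d} f'"
  shows "absolutely_continuous_on {c..d} f"
proof -
  have "bounded (f' ` {c..d})"
    using assms(2) by (auto intro!: compact_imp_bounded compact_continuous_image)
  then obtain M where M: "\<And>x. x \<in> {c..d} \<Longrightarrow> \<bar>f' x\<bar> \<le> M" by (force simp: bounded_iff)
  show ?thesis
  proof (rule absolutely_continuous_on_dominated[OF absolutely_continuous_on_ident
        absolutely_continuous_on_ident, of "\<bar>M\<bar>"])
    fix x y
    assume xy: "x \<in> {c..d}" "y \<in> {c..d}" "x \<le> y"
    have "norm (f y - f x) \<le> \<bar>M\<bar> * norm (y - x)"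
    proof (rule field_differentiable_bound[of "{c..d}" f f'])
      show "\<And>z. z \<in> {c..d} \<Longrightarrow> norm (f' z) \<le> \<bar>M\<bar>" using M by fastforce
    qed (use f xy in auto)
    moreover have "0 \<le> \<bar>M\<bar> * \<bar>y - x\<bar>" by simp
    ultimately show "\<bar>f y - f x\<bar> \<le> \<bar>M\<bar> * (\<bar>y - x\<bar> + \<bar>y - x\<bar>)"
      unfolding distrib_left real_norm_def by linarith
  qed auto
qed

lemma absolutely_continuous_on_cong:
  assumes f: "absolutely_continuous_on {l..r} f" and eq: "\<And>x. x \<in> {l..r} \<Longrightarrow> f x = g x"
  shows "absolutely_continuous_on {l..r} g"
  by (rule absolutely_continuous_on_dominated[OF f f, of 1]) (use eq in auto)

section \<open>Square-integrable functions and limits\<close>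

text \<open>The integration lemmas take an explicit negligible set outside which a derivative is
  known; this brings the almost-everywhere clauses of the spaces into that form.\<close>

lemma AE_lebesgue_on_iff_negligible:
  fixes S :: "real set"
  assumes "S \<in> sets lebesgue"
  shows "(AE x in lebesgue_on S. P x) \<longleftrightarrow> (\<exists>N. negligible N \<and> (\<forall>x\<in>S - N. P x))"
proof
  assume "AE x in lebesgue_on S. P x"
  then have "AE x in lebesgue. x \<in> S \<longrightarrow> P x"
    using assms by (subst (asm) AE_restrict_space_iff) auto
  then have "{x. \<not> (x \<in> S \<longrightarrow> P x)} \<in> null_sets lebesgue"
    by (simp add: completion.AE_iff_null_sets)
  then show "\<exists>N. negligible N \<and> (\<forall>x\<in>S - N. P x)"
    by (intro exI[of _ "{x. \<not> (x \<in> S \<longrightarrow> P x)}"]) (auto simp: negligible_iff_null_sets)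
next
  assume "\<exists>N. negligible N \<and> (\<forall>x\<in>S - N. P x)"
  then obtain N where N: "negligible N" "\<And>x. x \<in> S - N \<Longrightarrow> P x" by blast
  have "AE x in lebesgue. x \<in> S \<longrightarrow> P x"
  proof (rule AE_I')
    show "N \<in> null_sets lebesgue" using N(1) by (simp add: negligible_iff_null_sets)
  qed (use N(2) in auto)
  then show "AE x in lebesgue_on S. P x"
    using assms by (subst AE_restrict_space_iff) auto
qed

lemma AE_lebesgue_onI_negligible:
  fixes S :: "real set"
  assumes "negligible N" "\<And>x. x \<in> S - N \<Longrightarrow> P x" "S \<in> sets lebesgue"
  shows "AE x in lebesgue_on S. P x"
  unfolding AE_lebesgue_on_iff_negligible[OF assms(3)] using assms(1,2) by blast

lemma borel_measurable_lebesgue_on_AE: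
  fixes f g :: "real \<Rightarrow> real"
  assumes f: "f \<in> borel_measurable (lebesgue_on S)" and S: "S \<in> sets lebesgue"
    and eq: "AE x in lebesgue_on S. f x = g x"
  shows "g \<in> borel_measurable (lebesgue_on S)"
proof -
  have "(\<lambda>x. if x \<in> S then f x else 0) \<in> borel_measurable lebesgue"
    using f by (subst (asm) borel_measurable_if[OF S, symmetric])
  moreover have "AE x in lebesgue. (if x \<in> S then f x else 0) = (if x \<in> S then g x else 0)"
    using eq S by (subst (asm) AE_restrict_space_iff) (auto elim: AE_mp)
  ultimately have "(\<lambda>x. if x \<in> S then g x else 0) \<in> borel_measurable lebesgue"
    by (rule borel_measurable_AE)
  then show ?thesis by (subst (asm) borel_measurable_if[OF S])
qed

text \<open>\<open>(P + Q)^2 - 4 P Q\<close> is a square. A sum on the right, instead of a geometric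
  mean, lets a pairing be bounded by the two summands of a squared norm.\<close>

lemma two_abs_le_add:
  fixes I P Q :: real
  assumes "I\<^sup>2 \<le> P * Q" "P \<ge> 0" "Q \<ge> 0"
  shows "2 * \<bar>I\<bar> \<le> P + Q"
proof -
  have "0 \<le> (P - Q)\<^sup>2" by simp
  then have "(2 * I)\<^sup>2 \<le> (P + Q)\<^sup>2"
    using assms(1) by (simp add: power2_eq_square algebra_simps)
  then have "\<bar>2 * I\<bar> \<le> \<bar>P + Q\<bar>" by (simp only: abs_le_square_iff)
  then show ?thesis using assms by (simp add: abs_mult)
qed

text \<open>Shared by the Cauchy--Schwarz inequalities for \<open>L2\<close> and for
  \<open>ip\<close>: evaluate at the minimiser \<open>- B / C\<close>, or, when
  \<open>C = 0\<close>, use that an affine function bounded below is constant.\<close>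

lemma nonneg_quadratic_discriminant:
  fixes A B C :: real
  assumes "\<And>t. A + 2 * t * B + t\<^sup>2 * C \<ge> 0" and "C \<ge> 0"
  shows "B\<^sup>2 \<le> A * C"
proof (cases "C = 0")
  case True
  show ?thesis
  proof (cases "B = 0")
    case False
    define t where "t = - (A + 1) / (2 * B)"
    have "2 * t * B = - (A + 1)" using False by (simp add: t_def)
    then have "A + 2 * t * B + t\<^sup>2 * C = -1" using True by simp
    then show ?thesis using assms(1)[of t] by linarith
  qed (simp add: True)
next
  case False
  with \<open>C \<ge> 0\<close> have "C > 0" by simp
  then show ?thesis using assms(1)[of "- B / C"] by (simp add: power2_eq_square field_simps)
qed

section \<open>Square-integrable functions: products, bounds and convergence\<close>

lemma L2_integrable_power2: "f \<in> L2 S \<Longrightarrow> integrable (lebesgue_on S) (\<lambda>x. (f x)\<^sup>2)"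
  and L2_measurable: "f \<in> L2 S \<Longrightarrow> f \<in> borel_measurable (lebesgue_on S)"
  by (simp_all add: L2_def)

lemma L2_integrable_mult:
  assumes f: "f \<in> L2 S" and g: "g \<in> L2 S"
  shows "integrable (lebesgue_on S) (\<lambda>x. f x * g x)"
proof (rule Bochner_Integration.integrable_bound)
  show "integrable (lebesgue_on S) (\<lambda>x. (f x)\<^sup>2 + (g x)\<^sup>2)"
    using assms by (intro Bochner_Integration.integrable_add L2_integrable_power2)
  show "(\<lambda>x. f x * g x) \<in> borel_measurable (lebesgue_on S)"
    using assms by (intro borel_measurable_times L2_measurable)
  have "\<bar>s * t\<bar> \<le> s\<^sup>2 + t\<^sup>2" for s t :: real
  proof -
    have "2 * \<bar>s * t\<bar> \<le> s\<^sup>2 + t\<^sup>2"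
      using sum_squares_bound[of "\<bar>s\<bar>" "\<bar>t\<bar>"] by (simp add: abs_mult)
    then show ?thesis using abs_ge_zero[of "s * t"] by linarith
  qed
  then show "AE x in lebesgue_on S. norm (f x * g x) \<le> norm ((f x)\<^sup>2 + (g x)\<^sup>2)"
    by (intro AE_I2) simp
qed

lemma L2_lincomb:
  assumes f: "f \<in> L2 S" and g: "g \<in> L2 S"
  shows "(\<lambda>x. c * f x + d * g x) \<in> L2 S"
proof -
  have "integrable (lebesgue_on S) (\<lambda>x. c\<^sup>2 * (f x)\<^sup>2 + 2 * c * d * (f x * g x) + d\<^sup>2 * (g x)\<^sup>2)"
    using assms by (intro Bochner_Integration.integrable_add integrable_mult_right
        L2_integrable_power2 L2_integrable_mult)
  moreover have "(\<lambda>x. c\<^sup>2 * (f x)\<^sup>2 + 2 * c * d * (f x * g x) + d\<^sup>2 * (g x)\<^sup>2)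
      = (\<lambda>x. (c * f x + d * g x)\<^sup>2)"
    by (rule ext) (simp add: power2_eq_square algebra_simps)
  ultimately show ?thesis
    using L2_measurable[OF f] L2_measurable[OF g] by (simp add: L2_def)
qed

lemma L2_AE_cong:
  assumes "f \<in> L2 S" "g \<in> borel_measurable (lebesgue_on S)" "AE x in lebesgue_on S. f x = g x"
  shows "g \<in> L2 S"
proof -
  have "integrable (lebesgue_on S) (\<lambda>x. (f x)\<^sup>2) \<longleftrightarrow> integrable (lebesgue_on S) (\<lambda>x. (g x)\<^sup>2)"
    using assms by (intro integrable_cong_AE) (auto simp: L2_def)
  then show ?thesis using assms by (simp add: L2_def)
qed

lemma L2_AE_eq:
  assumes "f \<in> L2 S" "S \<in> sets lebesgue" "AE x in lebesgue_on S. f x = g x"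
  shows "g \<in> L2 S"
  by (rule L2_AE_cong[OF assms(1) borel_measurable_lebesgue_on_AE[OF L2_measurable[OF assms(1)] assms(2,3)] assms(3)])

lemma L2_integral_lincomb:
  assumes "f \<in> L2 S" "g \<in> L2 S" "h \<in> L2 S"
  shows "(LINT x|lebesgue_on S. (c * f x + d * g x) * h x)
    = c * (LINT x|lebesgue_on S. f x * h x) + d * (LINT x|lebesgue_on S. g x * h x)"
proof -
  have "(LINT x|lebesgue_on S. (c * f x + d * g x) * h x) =
      (LINT x|lebesgue_on S. c * (f x * h x) + d * (g x * h x))"
    by (simp add: algebra_simps)
  also have "\<dots> = c * (LINT x|lebesgue_on S. f x * h x) + d * (LINT x|lebesgue_on S. g x * h x)"
    using L2_integrable_mult[OF assms(1,3)] L2_integrable_mult[OF assms(2,3)] by simp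
  finally show ?thesis .
qed

lemma L2_bounded_mult:
  assumes f: "f \<in> L2 S" and h: "h \<in> borel_measurable (lebesgue_on S)"
    and B: "\<And>x. x \<in> S \<Longrightarrow> \<bar>h x\<bar> \<le> B"
  shows "(\<lambda>x. h x * f x) \<in> L2 S"
proof -
  have "integrable (lebesgue_on S) (\<lambda>x. (h x * f x)\<^sup>2)"
  proof (rule Bochner_Integration.integrable_bound)
    show "integrable (lebesgue_on S) (\<lambda>x. B\<^sup>2 * (f x)\<^sup>2)"
      using f by (intro integrable_mult_right L2_integrable_power2)
    show "(\<lambda>x. (h x * f x)\<^sup>2) \<in> borel_measurable (lebesgue_on S)"
      using h L2_measurable[OF f] by simp
    have "(h x * f x)\<^sup>2 \<le> B\<^sup>2 * (f x)\<^sup>2" if "x \<in> S" for x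
      unfolding power_mult_distrib using B[OF that]
      by (intro mult_right_mono) (auto simp: abs_le_square_iff[symmetric])
    then show "AE x in lebesgue_on S. norm ((h x * f x)\<^sup>2) \<le> norm (B\<^sup>2 * (f x)\<^sup>2)"
      by (intro AE_I2) (auto simp: space_restrict_space)
  qed
  then show ?thesis using h L2_measurable[OF f] by (simp add: L2_def)
qed

lemma L2_bounded:
  assumes "h \<in> borel_measurable (lebesgue_on S)" "S \<in> lmeasurable"
    and "\<And>x. x \<in> S \<Longrightarrow> \<bar>h x\<bar> \<le> B"
  shows "h \<in> L2 S"
proof -
  have "(\<lambda>x. 1) \<in> L2 S"
    using assms(2) by (simp add: L2_def finite_measure.integrable_const finite_measure_lebesgue_on)
  from L2_bounded_mult[OF this assms(1,3)] show ?thesis by simp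
qed

lemma L2_continuous_on:
  assumes "continuous_on {c..d} f"
  shows "f \<in> L2 {c..d}"
proof -
  have "bounded (f ` {c..d})"
    using assms by (auto intro!: compact_imp_bounded compact_continuous_image)
  then obtain B where "\<And>x. x \<in> {c..d} \<Longrightarrow> \<bar>f x\<bar> \<le> B" by (force simp: bounded_iff)
  then show ?thesis
    using assms by (intro L2_bounded continuous_imp_measurable_on_sets_lebesgue) auto
qed

lemma L2_Cauchy_Schwarz:
  assumes f: "f \<in> L2 S" and g: "g \<in> L2 S"
  shows "(LINT x|lebesgue_on S. f x * g x)\<^sup>2
    \<le> (LINT x|lebesgue_on S. (f x)\<^sup>2) * (LINT x|lebesgue_on S. (g x)\<^sup>2)"
proof (rule nonneg_quadratic_discriminant)
  fix t :: real
  have "0 \<le> (LINT x|lebesgue_on S. (f x + t * g x)\<^sup>2)" by simp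
  also have "(\<lambda>x. (f x + t * g x)\<^sup>2) = (\<lambda>x. (f x)\<^sup>2 + 2 * t * (f x * g x) + t\<^sup>2 * (g x)\<^sup>2)"
    by (rule ext) (simp add: power2_eq_square algebra_simps)
  also have "(LINT x|lebesgue_on S. (f x)\<^sup>2 + 2 * t * (f x * g x) + t\<^sup>2 * (g x)\<^sup>2) =
      (LINT x|lebesgue_on S. (f x)\<^sup>2) + 2 * t * (LINT x|lebesgue_on S. f x * g x) +
      t\<^sup>2 * (LINT x|lebesgue_on S. (g x)\<^sup>2)"
    using L2_integrable_power2[OF f] L2_integrable_power2[OF g] L2_integrable_mult[OF f g] by simp
  finally show "0 \<le> (LINT x|lebesgue_on S. (f x)\<^sup>2) + 2 * t * (LINT x|lebesgue_on S. f x * g x) +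
      t\<^sup>2 * (LINT x|lebesgue_on S. (g x)\<^sup>2)" .
qed simp

text \<open>Expand the square of \<open>f n = (f n - g) + g\<close>: the square of the difference
  tends to 0 by hypothesis, the mixed term by Cauchy--Schwarz.\<close>

lemma L2_tendsto_integral_power2:
  assumes "L2_tendsto S f g"
  shows "(\<lambda>n. LINT t|lebesgue_on S. (f n t)\<^sup>2) \<longlonglongrightarrow> (LINT t|lebesgue_on S. (g t)\<^sup>2)"
proof -
  have f: "\<And>n. f n \<in> L2 S" and g: "g \<in> L2 S"
    and lim: "(\<lambda>n. LINT t|lebesgue_on S. (f n t - g t)\<^sup>2) \<longlonglongrightarrow> 0"
    using assms by (auto simp: L2_tendsto_def)
  define h where "h = (\<lambda>n t. f n t - g t)"
  have h: "h n \<in> L2 S" for n using L2_lincomb[OF f[of n] g, of 1 "-1"] by (simp add: h_def)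
  have eq: "(LINT t|lebesgue_on S. (f n t)\<^sup>2) = (LINT t|lebesgue_on S. (h n t)\<^sup>2) +
      2 * (LINT t|lebesgue_on S. h n t * g t) + (LINT t|lebesgue_on S. (g t)\<^sup>2)" for n
  proof -
    have "(\<lambda>t. (f n t)\<^sup>2) = (\<lambda>t. (h n t)\<^sup>2 + 2 * (h n t * g t) + (g t)\<^sup>2)"
      by (rule ext) (simp add: h_def power2_eq_square algebra_simps)
    then show ?thesis
      using L2_integrable_power2[OF h] L2_integrable_power2[OF g] L2_integrable_mult[OF h g] by simp
  qed
  have h0: "(\<lambda>n. LINT t|lebesgue_on S. (h n t)\<^sup>2) \<longlonglongrightarrow> 0" using lim by (simp add: h_def)
  have "(\<lambda>n. LINT t|lebesgue_on S. h n t * g t) \<longlonglongrightarrow> 0"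
  proof (rule tendsto_rabs_zero_cancel, rule tendsto_sandwich[OF _ _ tendsto_const])
    have "(\<lambda>n. sqrt ((LINT t|lebesgue_on S. (h n t)\<^sup>2) * (LINT t|lebesgue_on S. (g t)\<^sup>2)))
        \<longlonglongrightarrow> sqrt (0 * (LINT t|lebesgue_on S. (g t)\<^sup>2))"
      by (intro tendsto_intros h0)
    then show "(\<lambda>n. sqrt ((LINT t|lebesgue_on S. (h n t)\<^sup>2) * (LINT t|lebesgue_on S. (g t)\<^sup>2))) \<longlonglongrightarrow> 0"
      by simp
    show "\<forall>\<^sub>F n in sequentially. \<bar>LINT t|lebesgue_on S. h n t * g t\<bar>
        \<le> sqrt ((LINT t|lebesgue_on S. (h n t)\<^sup>2) * (LINT t|lebesgue_on S. (g t)\<^sup>2))"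
      using L2_Cauchy_Schwarz[OF h g] by (intro always_eventually allI real_le_rsqrt) simp
  qed auto
  then have "(\<lambda>n. (LINT t|lebesgue_on S. (h n t)\<^sup>2) + 2 * (LINT t|lebesgue_on S. h n t * g t) +
      (LINT t|lebesgue_on S. (g t)\<^sup>2)) \<longlonglongrightarrow> 0 + 2 * 0 + (LINT t|lebesgue_on S. (g t)\<^sup>2)"
    by (intro tendsto_intros h0)
  then show ?thesis by (simp add: eq)
qed

section \<open>Integration up to the degenerate end point\<close>

lemma lebesgue_on_integrable_subset:
  fixes f :: "real \<Rightarrow> real"
  assumes "integrable (lebesgue_on S) f" "T \<subseteq> S" "S \<in> sets lebesgue" "T \<in> sets lebesgue"
  shows "integrable (lebesgue_on T) f"
proof -
  have "set_integrable lebesgue S f"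
    using assms(1) unfolding set_integrable_def
    by (subst (asm) integrable_restrict_space) (use assms(3) in auto)
  then have "set_integrable lebesgue T f"
    by (rule set_integrable_subset[OF _ assms(4,2)])
  then show ?thesis
    unfolding set_integrable_def by (subst integrable_restrict_space) (use assms(4) in auto)
qed

lemma L2_subset:
  assumes "f \<in> L2 S" "T \<subseteq> S" "S \<in> sets lebesgue" "T \<in> sets lebesgue"
  shows "f \<in> L2 T"
proof -
  have "integrable (lebesgue_on T) (\<lambda>x. (f x)\<^sup>2)"
    by (rule lebesgue_on_integrable_subset[OF L2_integrable_power2[OF assms(1)] assms(2-4)])
  moreover have "f \<in> borel_measurable (lebesgue_on T)"
    by (rule measurable_restrict_mono[OF L2_measurable[OF assms(1)] assms(2)])
  ultimately show ?thesis by (simp add: L2_def)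
qed

text \<open>Absolute continuity is available only on \<open>[c,1]\<close>, so the lower boundary
  value is replaced by the limit \<open>L\<close>. Integrability of \<open>f\<close> on the whole
  interval makes its integral over \<open>[c,1]\<close> continuous at \<open>c = 0\<close>, which
  permits the passage to the limit.\<close>

lemma LINT_FTC_absolutely_continuous:
  fixes G f :: "real \<Rightarrow> real"
  assumes ac: "\<And>c. c \<in> {0<..<1} \<Longrightarrow> absolutely_continuous_on {c..1} G"
    and N: "negligible N"
    and deriv: "\<And>x. x \<in> {0<..1} - N \<Longrightarrow> (G has_real_derivative f x) (at x within {0..1})"
    and f: "integrable (lebesgue_on {0..1}) f"
    and lim: "(G \<longlongrightarrow> L) (at_right 0)"
  shows "(LINT x|lebesgue_on {0..1}. f x) = G 1 - L"
proof -
  have I: "(f has_integral (LINT x|lebesgue_on {0..1}. f x)) {0..1}"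
    using f by (intro has_integral_integral_lebesgue_on) auto
  then have int: "f integrable_on {0..1}" by blast
  have eq: "integral {c..1} f = G 1 - G c" if c: "c \<in> {0<..<1}" for c
  proof -
    have "(f has_integral (G 1 - G c)) {c..1}"
    proof (rule absolutely_continuous_on_has_integral[OF ac[OF c] _ N])
      fix x
      assume "x \<in> {c..1} - N"
      then have "(G has_real_derivative f x) (at x within {0..1})" using deriv c by auto
      then show "(G has_vector_derivative f x) (at x within {c..1})"
        unfolding has_real_derivative_iff_has_vector_derivative
        by (rule has_vector_derivative_within_subset) (use c in auto)
    qed (use c in auto)
    then show ?thesis by blast
  qed
  have "continuous_on {0..1} (\<lambda>c. integral {c..1} f)"
    using indefinite_integral_continuous_1'[OF int] .
  then have "((\<lambda>c. integral {c..1} f) \<longlongrightarrow> integral {0..1} f) (at 0 within {0..1})"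
    by (simp add: continuous_on_def)
  then have "((\<lambda>c. integral {c..1} f) \<longlongrightarrow> integral {0..1} f) (at_right 0)"
    by (simp add: at_within_Icc_at_right)
  moreover have "\<forall>\<^sub>F c in at_right 0. integral {c..1} f = G 1 - G c"
    using eventually_at_right_less[of 0] eventually_at_right_field[of "\<lambda>x. x < 1" "0::real"]
    by (auto simp: eventually_at_right_field intro!: exI[of _ 1] eq)
  ultimately have "((\<lambda>c. G 1 - G c) \<longlongrightarrow> integral {0..1} f) (at_right 0)"
    by (simp cong: filterlim_cong add: tendsto_cong)
  moreover have "((\<lambda>c. G 1 - G c) \<longlongrightarrow> G 1 - L) (at_right 0)" by (intro tendsto_intros lim)
  ultimately have "integral {0..1} f = G 1 - L"
    by (rule tendsto_unique[rotated]) simp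
  then show ?thesis using I by (simp add: has_integral_iff)
qed

text \<open>The value at 0, about which continuity says nothing, is added back as a multiple of an
  indicator.\<close>

lemma borel_measurable_continuous_on_Ioc:
  fixes f :: "real \<Rightarrow> real"
  assumes "continuous_on {0<..1} f"
  shows "f \<in> borel_measurable (lebesgue_on {0..1})"
proof -
  have "f \<in> borel_measurable (lebesgue_on {0<..1})"
    using assms by (intro continuous_imp_measurable_on_sets_lebesgue) auto
  then have "(\<lambda>x. if x \<in> {0<..1} then f x else 0) \<in> borel_measurable lebesgue"
    by (subst (asm) borel_measurable_if[symmetric]) auto
  then have "(\<lambda>x. (if x \<in> {0<..1} then f x else 0) + f 0 * indicator {0} x) \<in> borel_measurable lebesgue"
    by (intro borel_measurable_add borel_measurable_times borel_measurable_indicator) auto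
  then have "(\<lambda>x. (if x \<in> {0<..1} then f x else 0) + f 0 * indicator {0} x) \<in> borel_measurable (lebesgue_on {0..1})"
    by (rule measurable_restrict_space1)
  then show ?thesis
    by (rule subst[OF measurable_cong, rotated]) (auto simp: space_restrict_space indicator_def)
qed

lemma eventually_at_right_0_Ioc: "\<forall>\<^sub>F x in at_right (0::real). x \<in> {0<..1}"
  unfolding eventually_at_right_field by (intro exI[of _ 1]) auto

lemma tendsto_0_at_right_0:
  fixes f :: "real \<Rightarrow> real"
  assumes "\<And>x. x \<in> {0<..1} \<Longrightarrow> \<bar>f x\<bar> \<le> g x" "(g \<longlongrightarrow> 0) (at_right 0)"
  shows "(f \<longlongrightarrow> 0) (at_right 0)"
  by (rule Lim_null_comparison[OF _ assms(2)])
     (rule eventually_mono[OF eventually_at_right_0_Ioc], use assms(1) in auto)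

lemma continuous_on_tendsto_at_right_0:
  fixes f :: "real \<Rightarrow> real"
  assumes "continuous_on {0..1} f"
  shows "(f \<longlongrightarrow> f 0) (at_right 0)"
proof -
  have "(f \<longlongrightarrow> f 0) (at 0 within {0..1})" using assms by (simp add: continuous_on_def)
  then show ?thesis by (simp add: at_within_Icc_at_right)
qed

lemma sqrt_ident_tendsto: "((\<lambda>x. sqrt (x * c)) \<longlongrightarrow> 0) (at_right (0::real))"
  using continuous_on_tendsto_at_right_0[of "\<lambda>x. sqrt (x * c)"] by (simp add: continuous_intros)

text \<open>A semigroup offers forward increments only. The backward increment from \<open>t\<close>
  to \<open>y < t\<close> is a forward one based at \<open>y\<close>, with \<open>\<psi> y\<close>
  in place of \<open>\<psi> t\<close>; a modulus \<eta> uniform in the base point pays for the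
  exchange.\<close>

lemma has_real_derivative_from_increments:
  fixes \<phi> \<psi> \<eta> :: "real \<Rightarrow> real"
  assumes inc: "\<And>s t. 0 \<le> s \<Longrightarrow> s < t \<Longrightarrow> \<bar>\<phi> t - \<phi> s - (t - s) * \<psi> s\<bar> \<le> (t - s) * \<eta> (t - s)"
    and var: "\<And>s t. 0 \<le> s \<Longrightarrow> s < t \<Longrightarrow> \<bar>\<psi> t - \<psi> s\<bar> \<le> \<eta> (t - s)"
    and lim: "(\<eta> \<longlongrightarrow> 0) (at_right 0)" and t: "t \<in> {0..T}"
  shows "(\<phi> has_vector_derivative \<psi> t) (at t within {0..T})"
  unfolding has_vector_derivative_def has_derivative_within_alt
proof (intro conjI allI impI)
  show "bounded_linear (\<lambda>h. h *\<^sub>R \<psi> t)" by (rule bounded_linear_scaleR_left)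
  fix e :: real
  assume "e > 0"
  then have "\<forall>\<^sub>F h in at_right 0. dist (\<eta> h) 0 < e / 2" using lim by (intro tendstoD) auto
  then obtain d where "d > 0" and d: "\<And>h. 0 < h \<Longrightarrow> h < d \<Longrightarrow> \<bar>\<eta> h\<bar> < e / 2"
    unfolding eventually_at_right_field by (auto simp: dist_real_def)
  have "norm (\<phi> y - \<phi> t - (y - t) *\<^sub>R \<psi> t) \<le> e * norm (y - t)"
    if y: "y \<in> {0..T}" "norm (y - t) < d" for y
  proof (cases y t rule: linorder_cases)
    case less
    then have "\<bar>\<eta> (t - y)\<bar> < e / 2" using y by (intro d) auto
    then have \<eta>: "\<eta> (t - y) \<le> e / 2" by linarith
    have "(t - y) * \<eta> (t - y) \<le> (t - y) * (e / 2)" using \<eta> less by (intro mult_left_mono) auto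
    then have "\<bar>\<phi> t - \<phi> y - (t - y) * \<psi> y\<bar> \<le> (t - y) * (e / 2)"
      using inc[of y t] less y by (meson atLeastAtMost_iff order_trans)
    moreover have "\<bar>(t - y) * (\<psi> t - \<psi> y)\<bar> \<le> (t - y) * (e / 2)"
      unfolding abs_mult using var[of y t] less y \<eta> by (intro mult_mono) auto
    \<comment> \<open>Half of \<open>e\<close> is spent on the forward increment from
      \<open>y\<close>, half on replacing \<open>\<psi> y\<close> by
      \<open>\<psi> t\<close>.\<close>
    moreover have "\<phi> y - \<phi> t - (y - t) * \<psi> t =
        - (\<phi> t - \<phi> y - (t - y) * \<psi> y) + (t - y) * (\<psi> t - \<psi> y)"
      by (simp add: algebra_simps)
    moreover have "e * \<bar>y - t\<bar> = (t - y) * (e / 2) + (t - y) * (e / 2)" using less by simp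
    ultimately show ?thesis unfolding real_norm_def real_scaleR_def by linarith
  next
    case greater
    then have "\<bar>\<eta> (y - t)\<bar> < e / 2" using y by (intro d) auto
    then have \<eta>: "\<eta> (y - t) \<le> e" using \<open>e > 0\<close> by linarith
    have "(y - t) * \<eta> (y - t) \<le> (y - t) * e" using \<eta> greater by (intro mult_left_mono) auto
    then have "\<bar>\<phi> y - \<phi> t - (y - t) * \<psi> t\<bar> \<le> (y - t) * e"
      using inc[of t y] greater t by (meson atLeastAtMost_iff order_trans)
    then show ?thesis using greater by (simp add: mult.commute)
  qed simp
  then show "\<exists>d>0. \<forall>y\<in>{0..T}. norm (y - t) < d \<longrightarrow>
      norm (\<phi> y - \<phi> t - (y - t) *\<^sub>R \<psi> t) \<le> e * norm (y - t)"
    using \<open>d > 0\<close> by blast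
qed

section \<open>The degenerate coefficient and bounds in \<open>H\<^sup>2\<^sub>a\<^sub>,\<^sub>0\<close>\<close>

lemma ddx_works:
  "f differentiable (at x within {0..1}) \<Longrightarrow> (f has_real_derivative ddx f x) (at x within {0..1})"
  unfolding ddx_def has_real_derivative_iff_has_vector_derivative
  by (simp add: vector_derivative_works)

lemma ddx_eq:
  assumes "(f has_real_derivative D) (at x within {0..1})" "x \<in> {0..1}"
  shows "ddx f x = D"
  unfolding ddx_def using assms vector_derivative_within_cbox[of 0 1 x f D]
  by (simp add: has_real_derivative_iff_has_vector_derivative)

lemma ddx_cong:
  assumes "\<And>x. x \<in> {0..1} \<Longrightarrow> f x = g x" "x \<in> {0..1}"
  shows "ddx f x = ddx g x"
  unfolding ddx_def using assms by (intro vector_derivative_cong_eq) auto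

lemma has_real_derivative_within_imp_at:
  assumes "(f has_real_derivative D) (at x within {0..1})" "x \<in> {0<..<1}"
  shows "(f has_real_derivative D) (at x)"
proof -
  have "at x within {0..1} = at x" using assms(2) by (intro at_within_interior) auto
  then show ?thesis using assms(1) by simp
qed

locale degenerate_coefficient =
  fixes a :: "real \<Rightarrow> real"
  assumes degenerate: "weakly_degenerate a \<or> strongly_degenerate a"
begin

abbreviation K :: real where "K \<equiv> degeneracy_constant a"

text \<open>
  From \<open>a(s) \<ge> a(1) s\<^sup>K\<close> one gets \<open>x \<integral>\<^sub>x\<^sup>1 1/a \<le> \<integral>\<^sub>x\<^sup>1 s/a(s) ds \<le> C\<close>; by Cauchy--Schwarz and
  \<open>u'(1) = 0\<close> this single weight controls \<open>u'\<close> near the degenerate end point and \<open>u\<close> in \<open>L\<^sup>2\<close>.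
\<close>

definition C :: real where "C = 1 / (a 1 * (2 - K))"

lemma K_bounds: "0 < K" "K < 2"
  using degenerate by (auto simp: weakly_degenerate_def strongly_degenerate_def)

lemma a_pos: "x \<in> {0<..1} \<Longrightarrow> a x > 0"
  and a_0: "a 0 = 0"
  and a_derivative: "x \<in> {0<..1} \<Longrightarrow> (a has_real_derivative ddx a x) (at x within {0..1})"
  and ddx_a_continuous: "continuous_on {0<..1} (ddx a)"
  and a_continuous: "continuous_on {0..1} a"
proof -
  show "x \<in> {0<..1} \<Longrightarrow> a x > 0" "a 0 = 0"
    "x \<in> {0<..1} \<Longrightarrow> (a has_real_derivative ddx a x) (at x within {0..1})"
    using degenerate by (auto simp: weakly_degenerate_def strongly_degenerate_def intro: ddx_works)
  show "continuous_on {0<..1} (ddx a)"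
    using degenerate
    by (auto simp: weakly_degenerate_def strongly_degenerate_def elim!: continuous_on_subset)
  show "continuous_on {0..1} a"
    using degenerate
    by (auto simp: weakly_degenerate_def strongly_degenerate_def continuous_on_eq_continuous_within
        intro: differentiable_imp_continuous_within)
qed

lemma a_nonneg: "x \<in> {0..1} \<Longrightarrow> a x \<ge> 0"
  using a_pos[of x] a_0 by (cases "x = 0") auto

lemma a_1_pos: "a 1 > 0"
  using a_pos by simp

lemma a_nonzero: "0 < c \<Longrightarrow> \<forall>s\<in>{c..1}. a s \<noteq> 0"
  using a_pos by (metis atLeastAtMost_iff greaterThanAtMost_iff less_irrefl less_le_trans)

lemma C_pos: "C > 0"
  using a_1_pos K_bounds by (simp add: C_def)

lemma x_ddx_a_le:
  assumes "x \<in> {0<..1}"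
  shows "x * \<bar>ddx a x\<bar> \<le> K * a x"
proof -
  have "degeneracy_quotient a x \<le> K"
    unfolding degeneracy_constant_def
    using degenerate assms by (intro cSUP_upper) (auto simp: weakly_degenerate_def strongly_degenerate_def)
  then show ?thesis using a_pos[OF assms] by (simp add: degeneracy_quotient_def field_simps)
qed

text \<open>The quotient \<open>s^K / a(s)\<close> is nondecreasing: the numerator of its derivative
  is \<open>s^(K-1) (K a - s a')\<close>, nonnegative by the degeneracy bound. Compare its values at
  \<open>x\<close> and 1.\<close>

lemma a_lower_bound:
  assumes x: "x \<in> {0<..1}"
  shows "a 1 * x powr K \<le> a x"
proof -
  let ?f = "\<lambda>s. s powr K / a s"
  have "?f x \<le> ?f 1"
  proof (rule DERIV_nonneg_imp_increasing_open[of x 1 ?f])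
    show "x \<le> 1" using x by simp
    show "continuous_on {x..1} ?f"
      using x a_nonzero[of x]
      by (intro continuous_intros continuous_on_subset[OF a_continuous]) auto
    fix s
    assume s: "x < s" "s < 1"
    then have s01: "s \<in> {0<..1}" "s \<in> {0<..<1}" "s > 0" using x by auto
    let ?D = "(K * s powr (K - 1) * a s - s powr K * ddx a s) / (a s * a s)"
    have "(?f has_real_derivative ?D) (at s)"
      using s01 a_pos[OF s01(1)] has_real_derivative_within_imp_at[OF a_derivative[OF s01(1)] s01(2)]
      by (auto intro!: derivative_eq_intros)
    moreover have "?D \<ge> 0"
    proof -
      have "s powr K = s powr (K - 1) * s" using s01 by (simp add: powr_diff)
      then have "K * s powr (K - 1) * a s - s powr K * ddx a s = s powr (K - 1) * (K * a s - s * ddx a s)"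
        by (simp only:) (simp add: algebra_simps)
      then have "?D = s powr (K - 1) * (K * a s - s * ddx a s) / (a s * a s)" by (simp only:)
      moreover have "K * a s - s * ddx a s \<ge> 0"
      proof -
        have "s * ddx a s \<le> s * \<bar>ddx a s\<bar>" using s01 by (intro mult_left_mono) auto
        then show ?thesis using x_ddx_a_le[OF s01(1)] by linarith
      qed
      ultimately show ?thesis using s01 by (simp only:) (simp add: zero_le_mult_iff)
    qed
    ultimately show "\<exists>y. (?f has_real_derivative y) (at s) \<and> 0 \<le> y" by blast
  qed
  then show ?thesis using a_pos[OF x] a_1_pos by (simp add: field_simps)
qed

text \<open>The majorant is integrable near 0 because \<open>K < 2\<close>, and it tends to 0
  exactly when \<open>K < 1\<close>; the second fact separates the two types of degeneracy in the
  boundary terms.\<close>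

lemma ident_over_a_le:
  assumes "s \<in> {0<..1}"
  shows "s / a s \<le> s powr (1 - K) / a 1"
proof -
  have "s powr (1 - K) = s / s powr K" using assms by (simp add: powr_diff)
  moreover have "s / a s \<le> s / (a 1 * s powr K)"
    using assms a_lower_bound[OF assms] a_1_pos a_pos[OF assms] by (intro divide_left_mono mult_pos_pos) auto
  ultimately show ?thesis by (simp add: mult.commute)
qed

lemma inverse_a_continuous: "0 < c \<Longrightarrow> continuous_on {c..1} (\<lambda>s. 1 / a s)"
  using a_nonzero[of c] by (intro continuous_intros continuous_on_subset[OF a_continuous]) auto

lemma integral_inverse_a:
  assumes x: "x \<in> {0<..1}"
  shows "x * integral {x..1} (\<lambda>s. 1 / a s) \<le> C"
proof -
  \<comment> \<open>Since \<open>1 - K > -1\<close>, the integral of \<open>s^(1-K)\<close> over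
    \<open>[0,1]\<close> is \<open>1 / (2 - K)\<close>; this is where \<open>C\<close> comes
    from.\<close>
  have I: "((\<lambda>s. s powr (1 - K) / a 1) has_integral C) {0..1}"
  proof -
    have "((\<lambda>s. s powr (1 - K)) has_integral (1 powr (1 - K + 1) / (1 - K + 1))) {0..1}"
      using K_bounds by (intro has_integral_powr_from_0) auto
    then have "((\<lambda>s. s powr (1 - K) / a 1) has_integral (1 powr (1 - K + 1) / (1 - K + 1) / a 1)) {0..1}"
      by (rule has_integral_divide)
    then show ?thesis by (simp add: C_def mult.commute)
  qed
  have I': "(\<lambda>s. s powr (1 - K) / a 1) integrable_on {x..1}"
    by (rule integrable_on_subinterval[of _ "{0..1}"]) (use I x in auto)
  have "x * integral {x..1} (\<lambda>s. 1 / a s) = integral {x..1} (\<lambda>s. x * (1 / a s))"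
    by (rule integral_mult_right[symmetric])
  also have "\<dots> \<le> integral {x..1} (\<lambda>s. s powr (1 - K) / a 1)"
  proof (rule integral_le)
    show "(\<lambda>s. x * (1 / a s)) integrable_on {x..1}"
      using x by (intro integrable_continuous_real continuous_intros inverse_a_continuous) auto
    fix s
    assume "s \<in> {x..1}"
    then have s: "s \<in> {0<..1}" "x \<le> s" using x by auto
    \<comment> \<open>\<open>x \<le> s\<close> absorbs the factor \<open>x\<close> into the weight;
      \<open>1 / a\<close> alone need not be integrable at 0.\<close>
    have "x * (1 / a s) \<le> s / a s" using s a_pos[OF s(1)] by (simp add: divide_right_mono)
    then show "x * (1 / a s) \<le> s powr (1 - K) / a 1" using ident_over_a_le[OF s(1)] by linarith
  qed (rule I')
  also have "\<dots> \<le> integral {0..1} (\<lambda>s. s powr (1 - K) / a 1)"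
    using I I' x a_1_pos by (intro integral_subset_le) auto
  also have "\<dots> = C" using I by blast
  finally show ?thesis .
qed

section \<open>Pointwise and integral bounds in \<open>H2a0\<close>\<close>

lemma H2a0_absolutely_continuous: "u \<in> H2a0 a \<Longrightarrow> absolutely_continuous_on {0..1} u"
  and H2a0_0: "u \<in> H2a0 a \<Longrightarrow> u 0 = 0"
  and H2a0_1: "u \<in> H2a0 a \<Longrightarrow> u 1 = 0"
  and H2a0_ddx_L2: "u \<in> H2a0 a \<Longrightarrow> ddx u \<in> L2 {0..1}"
  by (simp_all add: H2a0_def H1_0_def)

lemma H2a0_continuous: "u \<in> H2a0 a \<Longrightarrow> continuous_on {0..1} u"
  by (intro absolutely_continuous_on_imp_continuous_on H2a0_absolutely_continuous)

lemma H2a0_derivative: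
  "u \<in> H2a0 a \<Longrightarrow> x \<in> {0<..1} \<Longrightarrow> (u has_real_derivative ddx u x) (at x within {0..1})"
  by (intro ddx_works) (auto simp: H2a0_def split: if_splits)

lemma H2a0_ddx_absolutely_continuous:
  "u \<in> H2a0 a \<Longrightarrow> c \<in> {0<..<1} \<Longrightarrow> absolutely_continuous_on {c..1} (ddx u)"
  by (auto simp: H2a0_def split: if_splits intro: absolutely_continuous_on_subset)

lemma H2a0_ddx_1: "u \<in> H2a0 a \<Longrightarrow> ddx u 1 = 0"
  by (auto simp: H2a0_def split: if_splits)

lemma H2a0_ddx2_derivative:
  assumes "u \<in> H2a0 a"
  obtains N where "negligible N"
    "\<And>x. x \<in> {0..1} - N \<Longrightarrow> (ddx u has_real_derivative ddx (ddx u) x) (at x within {0..1})"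
proof -
  have "AE x in lebesgue_on {0..1}. ddx u differentiable (at x within {0..1})"
    using assms by (simp add: H2a0_def differentiable_ae_def)
  then show thesis
    by (subst (asm) AE_lebesgue_on_iff_negligible) (use that ddx_works in auto)
qed

lemma H2a0_L2: "u \<in> H2a0 a \<Longrightarrow> (\<lambda>x. sqrt (a x) * ddx (ddx u) x) \<in> L2 {0..1}"
  by (simp add: H2a0_def)

text \<open>The potential part of the squared \<open>H0\<close> norm. On \<open>H2a0\<close> it
  vanishes only if \<open>u = 0\<close> on \<open>[0,1]\<close>, by \<open>u_bound\<close>.\<close>

definition en :: "(real \<Rightarrow> real) \<Rightarrow> real" where
  "en u = (LINT x|lebesgue_on {0..1}. a x * (ddx (ddx u) x)\<^sup>2)"

lemma en_eq: "en u = (LINT x|lebesgue_on {0..1}. (sqrt (a x) * ddx (ddx u) x)\<^sup>2)"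
  unfolding en_def
  by (rule Bochner_Integration.integral_cong)
     (auto simp: power_mult_distrib space_restrict_space a_nonneg)

lemma en_nonneg: "en u \<ge> 0"
  unfolding en_eq by simp

lemma ddx_continuous_Icc:
  assumes u: "u \<in> H2a0 a" and "0 < c"
  shows "continuous_on {c..1} (ddx u)"
proof (cases "c < 1")
  case True
  then show ?thesis
    using assms by (intro absolutely_continuous_on_imp_continuous_on H2a0_ddx_absolutely_continuous) auto
next
  case False
  then show ?thesis by (cases "c = 1") auto
qed

lemma ddx_continuous_Ioc:
  assumes u: "u \<in> H2a0 a"
  shows "continuous_on {0<..1} (ddx u)"
  unfolding continuous_on_eq_continuous_within
proof
  fix x :: real
  assume x: "x \<in> {0<..1}"
  then have "continuous (at x within {x/2..1}) (ddx u)"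
    using ddx_continuous_Icc[OF u, of "x/2"] by (simp add: continuous_on_eq_continuous_within)
  moreover have "at x within {x/2..1} = at x within {0<..1}"
    using x by (intro at_within_nhd[of _ "{x/2<..}"]) auto
  ultimately show "continuous (at x within {0<..1}) (ddx u)" by simp
qed

text \<open>Write \<open>u'' = (sqrt a u'') (1 / sqrt a)\<close>. The first factor is square
  integrable by definition of the space, the second on \<open>[x,1]\<close> because \<open>a\<close>
  is positive there; the factor \<open>x\<close> compensates the possible divergence of the integral
  of \<open>1 / a\<close>.\<close>

lemma ddx_bound:
  assumes u: "u \<in> H2a0 a" and x: "x \<in> {0<..1}"
  shows "x * (ddx u x)\<^sup>2 \<le> C * en u"
proof (cases "x = 1")
  case True
  then show ?thesis using H2a0_ddx_1[OF u] C_pos en_nonneg[of u] by simp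
next
  case False
  with x have x': "x \<in> {0<..<1}" by simp
  let ?W = "\<lambda>s. sqrt (a s) * ddx (ddx u) s" and ?r = "\<lambda>s. 1 / sqrt (a s)"
  have W: "?W \<in> L2 {x..1}"
    by (rule L2_subset[OF H2a0_L2[OF u]]) (use x in auto)
  have r: "?r \<in> L2 {x..1}"
  proof (rule L2_continuous_on)
    show "continuous_on {x..1} ?r"
      using x a_nonzero[of x]
      by (intro continuous_intros continuous_on_subset[OF a_continuous]) auto
  qed
  have "((\<lambda>s. ?W s * ?r s) has_integral (LINT s|lebesgue_on {x..1}. ?W s * ?r s)) {x..1}"
    by (intro has_integral_integral_lebesgue_on L2_integrable_mult W r) auto
  then have 1: "(ddx (ddx u) has_integral (LINT s|lebesgue_on {x..1}. ?W s * ?r s)) {x..1}"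
  proof (rule has_integral_eq[rotated])
    show "?W s * ?r s = ddx (ddx u) s" if "s \<in> {x..1}" for s
      using a_pos[of s] that x by simp
  qed
  obtain N where N: "negligible N"
    "\<And>x. x \<in> {0..1} - N \<Longrightarrow> (ddx u has_real_derivative ddx (ddx u) x) (at x within {0..1})"
    using H2a0_ddx2_derivative[OF u] by blast
  have "(ddx (ddx u) has_integral (ddx u 1 - ddx u x)) {x..1}"
  proof (rule absolutely_continuous_on_has_integral[OF _ _ N(1)])
    fix s
    assume "s \<in> {x..1} - N"
    then have "(ddx u has_vector_derivative ddx (ddx u) s) (at s within {0..1})"
      using N(2)[of s] x by (auto simp: has_real_derivative_iff_has_vector_derivative)
    then show "(ddx u has_vector_derivative ddx (ddx u) s) (at s within {x..1})"
      by (rule has_vector_derivative_within_subset) (use x in auto)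
  qed (use x H2a0_ddx_absolutely_continuous[OF u x'] in auto)
  \<comment> \<open>Two evaluations of the integral of \<open>u''\<close> over \<open>[x,1]\<close>:
    as a pairing of \<open>L2\<close> functions, and as an increment of the absolutely continuous
    \<open>u'\<close>.\<close>
  with 1 have "ddx u 1 - ddx u x = (LINT s|lebesgue_on {x..1}. ?W s * ?r s)"
    by (rule has_integral_unique[symmetric])
  then have "(ddx u x)\<^sup>2 = (LINT s|lebesgue_on {x..1}. ?W s * ?r s)\<^sup>2"
    using H2a0_ddx_1[OF u] by (metis diff_0 power2_minus)
  also have "\<dots> \<le> (LINT s|lebesgue_on {x..1}. (?W s)\<^sup>2) * (LINT s|lebesgue_on {x..1}. (?r s)\<^sup>2)"
    by (rule L2_Cauchy_Schwarz[OF W r])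
  also have "(LINT s|lebesgue_on {x..1}. (?r s)\<^sup>2) = integral {x..1} (\<lambda>s. (?r s)\<^sup>2)"
    by (intro lebesgue_integral_eq_integral L2_integrable_power2 r) auto
  also have "\<dots> = integral {x..1} (\<lambda>s. 1 / a s)"
    using x a_nonneg by (intro integral_cong) (auto simp: power_divide)
  also have "(LINT s|lebesgue_on {x..1}. (?W s)\<^sup>2) = integral {x..1} (\<lambda>s. (?W s)\<^sup>2)"
    by (intro lebesgue_integral_eq_integral L2_integrable_power2 W) auto
  finally have "(ddx u x)\<^sup>2 \<le> integral {x..1} (\<lambda>s. (?W s)\<^sup>2) * integral {x..1} (\<lambda>s. 1 / a s)" .
  moreover have "integral {x..1} (\<lambda>s. (?W s)\<^sup>2) \<le> en u"
  proof -
    have "integral {x..1} (\<lambda>s. (?W s)\<^sup>2) \<le> integral {0..1} (\<lambda>s. (?W s)\<^sup>2)"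
      using x by (intro integral_subset_le integrable_on_lebesgue_on L2_integrable_power2 W H2a0_L2 u) auto
    also have "\<dots> = en u"
      unfolding en_eq
      by (intro lebesgue_integral_eq_integral[symmetric] L2_integrable_power2 H2a0_L2 u) auto
    finally show ?thesis .
  qed
  moreover have "integral {x..1} (\<lambda>s. 1 / a s) \<ge> 0"
    using x a_nonneg
    by (intro integral_nonneg integrable_continuous_real inverse_a_continuous) auto
  ultimately have "(ddx u x)\<^sup>2 \<le> en u * integral {x..1} (\<lambda>s. 1 / a s)"
    by (meson mult_right_mono order_trans)
  then have "x * (ddx u x)\<^sup>2 \<le> en u * (x * integral {x..1} (\<lambda>s. 1 / a s))"
    using x by (simp add: mult.left_commute mult_left_mono)
  also have "\<dots> \<le> en u * C"
    using integral_inverse_a[OF x] en_nonneg by (intro mult_left_mono)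
  finally show ?thesis by (simp add: mult.commute)
qed

lemma x_ddx_bound:
  assumes u: "u \<in> H2a0 a" and x: "x \<in> {0..1}"
  shows "(x * ddx u x)\<^sup>2 \<le> x * (C * en u)"
proof (cases "x = 0")
  case False
  with x have "x * (x * (ddx u x)\<^sup>2) \<le> x * (C * en u)"
    by (intro mult_left_mono ddx_bound u) auto
  then show ?thesis by (simp add: power2_eq_square algebra_simps)
qed simp

text \<open>Integrate \<open>\<bar>u'(s)\<bar> \<le> M / sqrt s\<close> from \<open>x\<close> to 1
  with \<open>u(1) = 0\<close>; the comparison function is \<open>2 M sqrt s\<close>. This
  singularity is integrable, so the bound holds up to \<open>x = 0\<close>.\<close>

lemma u_bound:
  assumes u: "u \<in> H2a0 a" and x: "x \<in> {0..1}"
  shows "\<bar>u x\<bar> \<le> 2 * sqrt (C * en u) * (1 - sqrt x)"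
proof (cases "x = 1")
  case True
  then show ?thesis using H2a0_1[OF u] by simp
next
  case False
  define M where "M = sqrt (C * en u)"
  have M2: "M\<^sup>2 = C * en u" using C_pos en_nonneg[of u] by (simp add: M_def)
  have "norm (u 1 - u x) \<le> 2 * M * sqrt 1 - 2 * M * sqrt x"
  proof (rule differentiable_bound_general[where f' = "ddx u" and \<phi>' = "\<lambda>s. M / sqrt s"])
    show "x < 1" using False x by simp
    show "continuous_on {x..1} u"
      using H2a0_continuous[OF u] by (rule continuous_on_subset) (use x in auto)
    show "continuous_on {x..1} (\<lambda>x. 2 * M * sqrt x)" by (intro continuous_intros)
    fix s
    assume s: "x < s" "s < 1"
    then have s01: "s \<in> {0<..1}" "s \<in> {0<..<1}" using x by auto
    show "(u has_vector_derivative ddx u s) (at s)"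
      using has_real_derivative_within_imp_at[OF H2a0_derivative[OF u s01(1)] s01(2)]
      by (simp add: has_real_derivative_iff_has_vector_derivative)
    show "((\<lambda>s. 2 * M * sqrt s) has_vector_derivative M / sqrt s) (at s)"
      unfolding has_real_derivative_iff_has_vector_derivative[symmetric]
      using s01 by (auto intro!: derivative_eq_intros simp: field_simps)
    have "(ddx u s)\<^sup>2 \<le> M\<^sup>2 / s"
      using ddx_bound[OF u s01(1)] s01 by (simp add: M2 field_simps)
    then have "(ddx u s)\<^sup>2 \<le> (M / sqrt s)\<^sup>2" using s01 by (simp add: power_divide)
    moreover have "M / sqrt s \<ge> 0" using s01 C_pos en_nonneg[of u] by (simp add: M_def)
    ultimately show "norm (ddx u s) \<le> M / sqrt s"
      using abs_le_square_iff[of "ddx u s" "M / sqrt s"] by simp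
  qed
  then show ?thesis using H2a0_1[OF u] by (simp add: M_def algebra_simps)
qed

lemma u_L2: "u \<in> H2a0 a \<Longrightarrow> u \<in> L2 {0..1}"
  by (intro L2_continuous_on H2a0_continuous)

lemma x_ddx_abs_bound:
  assumes u: "u \<in> H2a0 a" and x: "x \<in> {0..1}"
  shows "\<bar>x * ddx u x\<bar> \<le> sqrt (C * en u)"
proof -
  have "x * (C * en u) \<le> C * en u" 
    using x C_pos en_nonneg[of u] by (intro mult_left_le_one_le) auto
  then show ?thesis using x_ddx_bound[OF assms] by (intro real_le_rsqrt) simp
qed

lemma x_ddx_measurable: "u \<in> H2a0 a \<Longrightarrow> (\<lambda>x. x * ddx u x) \<in> borel_measurable (lebesgue_on {0..1})"
  by (intro borel_measurable_continuous_on_Ioc continuous_intros ddx_continuous_Ioc)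

lemma x_ddx_L2:
  assumes u: "u \<in> H2a0 a"
  shows "(\<lambda>x. x * ddx u x) \<in> L2 {0..1}"
  by (rule L2_bounded[OF x_ddx_measurable[OF u] _ x_ddx_abs_bound[OF u]]) auto

text \<open>The factor \<open>x \<le> 1\<close> of the pointwise bound is dropped, so that both
  pairings in \<open>rho\<close> carry the same constant \<open>C\<close>.\<close>

lemma integral_x_ddx_le:
  assumes u: "u \<in> H2a0 a"
  shows "(LINT x|lebesgue_on {0..1}. (x * ddx u x)\<^sup>2) \<le> C * en u"
proof -
  have "(LINT x|lebesgue_on {0..1}. (x * ddx u x)\<^sup>2) \<le> (LINT x|lebesgue_on {0..1::real}. C * en u)"
  proof (rule integral_mono)
    show "integrable (lebesgue_on {0..1}) (\<lambda>x. (x * ddx u x)\<^sup>2)"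
      by (intro L2_integrable_power2 x_ddx_L2 u)
    show "integrable (lebesgue_on {0..1::real}) (\<lambda>x. C * en u)"
      by (intro finite_measure.integrable_const finite_measure_lebesgue_on) auto
    fix x :: real
    assume "x \<in> space (lebesgue_on {0..1})"
    then have "x \<in> {0..1}" by (simp add: space_restrict_space)
    moreover have "x * (C * en u) \<le> C * en u" 
      using \<open>x \<in> {0..1}\<close> C_pos en_nonneg[of u] by (intro mult_left_le_one_le) auto
    ultimately show "(x * ddx u x)\<^sup>2 \<le> C * en u" using x_ddx_bound[OF u, of x] by linarith
  qed
  then show ?thesis by (simp add: measure_restrict_space)
qed

lemma integral_u_le:
  assumes u: "u \<in> H2a0 a"
  shows "(LINT x|lebesgue_on {0..1}. (u x)\<^sup>2) \<le> C * en u"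
proof -
  have c: "continuous_on {0..1} (\<lambda>x::real. (1 - sqrt x)\<^sup>2)" by (intro continuous_intros)
  \<comment> \<open>The value is \<open>1 - 4/3 + 1/2\<close>. With the factor 4 from squaring the
    pointwise bound it becomes \<open>2/3\<close>, later relaxed to 1.\<close>
  have I: "((\<lambda>x. (1 - sqrt x)\<^sup>2) has_integral (1 / 6)) {0..1::real}"
  proof -
    have "((\<lambda>x. 1 - 2 * x powr (1/2) + x powr 1) has_integral
       (1 - 2 * (1 powr (1/2 + 1) / (1/2 + 1)) + 1 powr (1 + 1) / (1 + 1))) {0..1::real}"
      using has_integral_const_real[of 1 0 "1::real"]
      by (intro has_integral_add has_integral_diff has_integral_mult_right has_integral_powr_from_0) auto
    then have "((\<lambda>x. 1 - 2 * x powr (1/2) + x powr 1) has_integral (1 / 6)) {0..1::real}" by simp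
    then show ?thesis
      by (rule has_integral_eq[rotated])
         (auto simp: powr_half_sqrt power2_eq_square algebra_simps)
  qed
  have "(LINT x|lebesgue_on {0..1}. (u x)\<^sup>2) = integral {0..1} (\<lambda>x. (u x)\<^sup>2)"
    by (intro lebesgue_integral_eq_integral L2_integrable_power2 u_L2 u) auto
  also have "\<dots> \<le> integral {0..1} (\<lambda>x. (4 * (C * en u)) * (1 - sqrt x)\<^sup>2)"
  proof (rule integral_le)
    show "(\<lambda>x. (u x)\<^sup>2) integrable_on {0..1}"
      by (intro integrable_continuous_real continuous_intros H2a0_continuous u)
    show "(\<lambda>x. (4 * (C * en u)) * (1 - sqrt x)\<^sup>2) integrable_on {0..1}"
      by (intro integrable_continuous_real continuous_intros)
    fix x :: real
    assume x: "x \<in> {0..1}"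
    have "(u x)\<^sup>2 \<le> (2 * sqrt (C * en u) * (1 - sqrt x))\<^sup>2"
      using u_bound[OF u x] by (intro abs_le_square_iff[THEN iffD1]) auto
    also have "\<dots> = 4 * (C * en u) * (1 - sqrt x)\<^sup>2"
      using C_pos en_nonneg[of u] by (simp add: power_mult_distrib)
    finally show "(u x)\<^sup>2 \<le> 4 * (C * en u) * (1 - sqrt x)\<^sup>2" .
  qed
  also have "\<dots> = 4 * (C * en u) * (1 / 6)"
    using I by (metis integral_mult_right integral_unique)
  also have "\<dots> \<le> C * en u" using C_pos en_nonneg[of u] by simp
  finally show ?thesis .
qed

section \<open>Integration by parts on the domain of the operator\<close>

lemma dom_A_H2a0: "u \<in> dom_A a \<Longrightarrow> u \<in> H2a0 a"
  by (simp add: dom_A_def)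

lemma auxx_represents: "u \<in> dom_A a \<Longrightarrow> represents_auxx a u (auxx a u)"
  unfolding auxx_def by (rule someI_ex[of "represents_auxx a u"]) (simp add: dom_A_def)

lemma auxx_H2: "u \<in> dom_A a \<Longrightarrow> auxx a u \<in> H2"
  using auxx_represents by (simp add: represents_auxx_def)

lemma auxx_derivative:
  "u \<in> dom_A a \<Longrightarrow> x \<in> {0..1} \<Longrightarrow> (auxx a u has_real_derivative ddx (auxx a u) x) (at x within {0..1})"
  using auxx_H2 by (intro ddx_works) (simp add: H2_def)

lemma ddx_auxx_absolutely_continuous:
  "u \<in> dom_A a \<Longrightarrow> absolutely_continuous_on {0..1} (ddx (auxx a u))"
  using auxx_H2 by (simp add: H2_def)

lemma ddx_auxx_continuous: "u \<in> dom_A a \<Longrightarrow> continuous_on {0..1} (ddx (auxx a u))"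
  by (intro absolutely_continuous_on_imp_continuous_on ddx_auxx_absolutely_continuous)

lemma auxx_absolutely_continuous:
  "u \<in> dom_A a \<Longrightarrow> absolutely_continuous_on {0..1} (auxx a u)"
  by (rule absolutely_continuous_on_C1) (auto intro: auxx_derivative ddx_auxx_continuous)

lemma auxx_continuous: "u \<in> dom_A a \<Longrightarrow> continuous_on {0..1} (auxx a u)"
  by (intro absolutely_continuous_on_imp_continuous_on auxx_absolutely_continuous)

lemma op_A_L2: "u \<in> dom_A a \<Longrightarrow> op_A a u \<in> L2 {0..1}"
  using auxx_H2 by (simp add: H2_def op_A_def)

lemma ddx_auxx_derivative:
  assumes "u \<in> dom_A a"
  obtains N where "negligible N"
    "\<And>x. x \<in> {0..1} - N \<Longrightarrow> (ddx (auxx a u) has_real_derivative op_A a u x) (at x within {0..1})"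
proof -
  have "AE x in lebesgue_on {0..1}. ddx (auxx a u) differentiable (at x within {0..1})"
    using auxx_H2[OF assms] by (simp add: H2_def differentiable_ae_def)
  then show thesis
    by (subst (asm) AE_lebesgue_on_iff_negligible) (use that ddx_works in \<open>auto simp: op_A_def\<close>)
qed

lemma auxx_eq:
  assumes "u \<in> dom_A a"
  obtains N where "negligible N" "\<And>x. x \<in> {0..1} - N \<Longrightarrow> auxx a u x = a x * ddx (ddx u) x"
proof -
  have "AE x in lebesgue_on {0..1}. auxx a u x = a x * ddx (ddx u) x"
    using auxx_represents[OF assms] by (simp add: represents_auxx_def)
  then show thesis
    by (subst (asm) AE_lebesgue_on_iff_negligible) (use that in auto)
qed

lemma auxx_bounded:
  assumes u: "u \<in> dom_A a"
  obtains B where "B \<ge> 0" "\<And>x. x \<in> {0..1} \<Longrightarrow> \<bar>auxx a u x\<bar> \<le> B"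
proof -
  have "bounded (auxx a u ` {0..1})"
    using auxx_continuous[OF u] by (auto intro!: compact_imp_bounded compact_continuous_image)
  then obtain B where B: "\<And>x. x \<in> {0..1} \<Longrightarrow> \<bar>auxx a u x\<bar> \<le> B" by (force simp: bounded_iff)
  from B[of 0] have "B \<ge> 0" by simp
  then show thesis using B that by blast
qed

text \<open>The boundary condition \<open>(a u'')(0) = 0\<close> and the boundedness of
  \<open>(a u'')'\<close> give linear decay, which makes up for the missing control of
  \<open>u'\<close> at 0.\<close>

lemma auxx_linear_bound:
  assumes u: "u \<in> dom_A a" and sd: "strongly_degenerate a"
  obtains B where "B \<ge> 0" "\<And>x. x \<in> {0..1} \<Longrightarrow> \<bar>auxx a u x\<bar> \<le> B * x"
proof -
  have "bounded (ddx (auxx a u) ` {0..1})"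
    using ddx_auxx_continuous[OF u] by (auto intro!: compact_imp_bounded compact_continuous_image)
  then obtain B where B: "\<And>x. x \<in> {0..1} \<Longrightarrow> \<bar>ddx (auxx a u) x\<bar> \<le> B" by (force simp: bounded_iff)
  from B[of 0] have "B \<ge> 0" by simp
  have "\<bar>auxx a u x\<bar> \<le> B * x" if x: "x \<in> {0..1}" for x
  proof -
    have "norm (auxx a u x - auxx a u 0) \<le> B * norm (x - 0)"
      by (rule field_differentiable_bound[of "{0..1}" _ "ddx (auxx a u)"])
         (use x B auxx_derivative[OF u] in auto)
    moreover have "auxx a u 0 = 0" using u sd by (simp add: dom_A_def)
    ultimately show ?thesis using x by simp
  qed
  then show thesis using that \<open>B \<ge> 0\<close> by blast
qed

section \<open>Boundary terms at the degenerate end point\<close>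

lemma x_ddx_tendsto:
  assumes v: "v \<in> H2a0 a"
  shows "((\<lambda>x. x * ddx v x) \<longlongrightarrow> 0) (at_right 0)"
proof (rule tendsto_0_at_right_0[OF _ sqrt_ident_tendsto])
  fix x :: real
  assume "x \<in> {0<..1}"
  then show "\<bar>x * ddx v x\<bar> \<le> sqrt (x * (C * en v))"
    using x_ddx_bound[OF v, of x] by (intro real_le_rsqrt) simp
qed

text \<open>Weakly degenerate: \<open>v'\<close> is continuous with \<open>v'(0) = 0\<close>.
  Strongly degenerate: \<open>v'\<close> may blow up, but \<open>a u''\<close> supplies a factor
  \<open>x\<close>, and \<open>x v'\<close> tends to 0.\<close>

lemma auxx_ddx_tendsto:
  assumes u: "u \<in> dom_A a" and v: "v \<in> H2a0 a"
  shows "((\<lambda>x. auxx a u x * ddx v x) \<longlongrightarrow> 0) (at_right 0)"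
proof (cases "weakly_degenerate a")
  case True
  then have "continuous_on {0..1} (ddx v)" "ddx v 0 = 0"
    using v by (auto simp: H2a0_def intro: absolutely_continuous_on_imp_continuous_on)
  then show ?thesis
    using continuous_on_tendsto_at_right_0[of "\<lambda>x. auxx a u x * ddx v x"] auxx_continuous[OF u]
    by (simp add: continuous_intros)
next
  case False
  with degenerate have "strongly_degenerate a" by simp
  then obtain B where B: "B \<ge> 0" "\<And>x. x \<in> {0..1} \<Longrightarrow> \<bar>auxx a u x\<bar> \<le> B * x"
    using auxx_linear_bound[OF u] by blast
  show ?thesis
  proof (rule tendsto_0_at_right_0)
    fix x :: real
    assume x: "x \<in> {0<..1}"
    have "\<bar>auxx a u x * ddx v x\<bar> \<le> (B * x) * \<bar>ddx v x\<bar>"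
      unfolding abs_mult using B(2)[of x] x by (intro mult_right_mono) auto
    then show "\<bar>auxx a u x * ddx v x\<bar> \<le> B * \<bar>x * ddx v x\<bar>"
      using x by (simp add: abs_mult mult.assoc)
  next
    show "((\<lambda>x. B * \<bar>x * ddx v x\<bar>) \<longlongrightarrow> 0) (at_right 0)"
      by (intro tendsto_mult_right_zero tendsto_rabs_zero x_ddx_tendsto v)
  qed
qed

text \<open>The weight is at most a multiple of \<open>x^(1-K)\<close>. If \<open>K < 1\<close>, it
  tends to 0 and boundedness of \<open>a u''\<close> is enough; if \<open>K \<ge> 1\<close>, the
  linear decay of \<open>a u''\<close> contributes \<open>x^2\<close>, and the exponent becomes
  \<open>3 - K > 0\<close>.\<close>

lemma auxx_square_over_a_tendsto:
  assumes u: "u \<in> dom_A a"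
  shows "((\<lambda>x. x / a x * (auxx a u x)\<^sup>2) \<longlongrightarrow> 0) (at_right 0)"
proof (cases "weakly_degenerate a")
  case True
  then have "K < 1" by (simp add: weakly_degenerate_def)
  obtain B where B: "B \<ge> 0" "\<And>x. x \<in> {0..1} \<Longrightarrow> \<bar>auxx a u x\<bar> \<le> B"
    using auxx_bounded[OF u] by blast
  show ?thesis
  proof (rule tendsto_0_at_right_0)
    fix x :: real
    assume x: "x \<in> {0<..1}"
    have "(auxx a u x)\<^sup>2 \<le> B\<^sup>2" using B(1) B(2)[of x] x by (simp add: abs_le_square_iff[symmetric])
    then have "x / a x * (auxx a u x)\<^sup>2 \<le> x powr (1 - K) / a 1 * B\<^sup>2"
      using x a_pos[OF x] a_1_pos by (intro mult_mono ident_over_a_le) auto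
    then show "\<bar>x / a x * (auxx a u x)\<^sup>2\<bar> \<le> x powr (1 - K) * (B\<^sup>2 / a 1)"
      using x a_pos[OF x] by (simp add: abs_mult)
  next
    have "((\<lambda>x::real. x powr (1 - K)) \<longlongrightarrow> 0 powr (1 - K)) (at_right 0)"
      using \<open>K < 1\<close> by (intro tendsto_powr2 tendsto_intros) (auto simp: eventually_at_filter)
    then show "((\<lambda>x. x powr (1 - K) * (B\<^sup>2 / a 1)) \<longlongrightarrow> 0) (at_right 0)"
      by (intro tendsto_mult_left_zero) simp
  qed
next
  case False
  with degenerate have "strongly_degenerate a" by simp
  then obtain B where B: "B \<ge> 0" "\<And>x. x \<in> {0..1} \<Longrightarrow> \<bar>auxx a u x\<bar> \<le> B * x"
    using auxx_linear_bound[OF u] by blast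
  show ?thesis
  proof (rule tendsto_0_at_right_0)
    fix x :: real
    assume x: "x \<in> {0<..1}"
    have "\<bar>auxx a u x\<bar> \<le> \<bar>B * x\<bar>" using B(1) B(2)[of x] x by simp
    then have "(auxx a u x)\<^sup>2 \<le> (B * x)\<^sup>2" by (simp only: abs_le_square_iff)
    then have "x / a x * (auxx a u x)\<^sup>2 \<le> x powr (1 - K) / a 1 * (B * x)\<^sup>2"
      using x a_pos[OF x] a_1_pos by (intro mult_mono ident_over_a_le) auto
    also have "\<dots> = x powr (1 - K) * x powr 2 * (B\<^sup>2 / a 1)" using x by (simp add: power_mult_distrib)
    also have "x powr (1 - K) * x powr 2 = x powr (3 - K)" by (simp add: powr_add[symmetric])
    finally show "\<bar>x / a x * (auxx a u x)\<^sup>2\<bar> \<le> x powr (3 - K) * (B\<^sup>2 / a 1)"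
      using x a_pos[OF x] by (simp add: abs_mult)
  next
    have "((\<lambda>x::real. x powr (3 - K)) \<longlongrightarrow> 0 powr (3 - K)) (at_right 0)"
      using K_bounds by (intro tendsto_powr2 tendsto_intros) (auto simp: eventually_at_filter)
    then show "((\<lambda>x. x powr (3 - K) * (B\<^sup>2 / a 1)) \<longlongrightarrow> 0) (at_right 0)"
      by (intro tendsto_mult_left_zero) simp
  qed
qed

text \<open>With \<open>p = a u''\<close>, the antiderivative \<open>p v' - p' v\<close> has
  derivative \<open>p v'' - p'' v\<close>. It vanishes at 1 by \<open>v(1) = v'(1) = 0\<close> and
  tends to 0 at the other end by \<open>auxx_ddx_tendsto\<close> and \<open>v(0) = 0\<close>. This
  symmetry underlies the conservation of energy.\<close>

lemma Green_formula:
  assumes u: "u \<in> dom_A a" and v: "v \<in> H2a0 a"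
  shows "(LINT x|lebesgue_on {0..1}. a x * ddx (ddx u) x * ddx (ddx v) x)
    = (LINT x|lebesgue_on {0..1}. v x * op_A a u x)"
proof -
  let ?p = "auxx a u"
  let ?W = "\<lambda>u x. sqrt (a x) * ddx (ddx u) x"
  \<comment> \<open>The coefficients 1 and -1 are spelled out to match the shape in
    \<open>absolutely_continuous_on_lincomb\<close>.\<close>
  let ?G = "\<lambda>x. 1 * (?p x * ddx v x) + (-1) * (ddx ?p x * v x)"
  \<comment> \<open>Splitting \<open>a\<close> as \<open>sqrt a * sqrt a\<close> exhibits a product
    of \<open>L2\<close> functions; \<open>u''\<close> alone need not be square integrable.\<close>
  let ?f = "\<lambda>x. ?W u x * ?W v x - v x * op_A a u x"
  obtain N1 where N1: "negligible N1"
    "\<And>x. x \<in> {0..1} - N1 \<Longrightarrow> (ddx v has_real_derivative ddx (ddx v) x) (at x within {0..1})"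
    using H2a0_ddx2_derivative[OF v] by blast
  obtain N2 where N2: "negligible N2"
    "\<And>x. x \<in> {0..1} - N2 \<Longrightarrow> (ddx ?p has_real_derivative op_A a u x) (at x within {0..1})"
    using ddx_auxx_derivative[OF u] by blast
  obtain N3 where N3: "negligible N3" "\<And>x. x \<in> {0..1} - N3 \<Longrightarrow> ?p x = a x * ddx (ddx u) x"
    using auxx_eq[OF u] by blast
  have i1: "integrable (lebesgue_on {0..1}) (\<lambda>x. ?W u x * ?W v x)"
    by (intro L2_integrable_mult H2a0_L2 dom_A_H2a0 u v)
  have i2: "integrable (lebesgue_on {0..1}) (\<lambda>x. v x * op_A a u x)"
    by (intro L2_integrable_mult u_L2 op_A_L2 u v)
  have "(LINT x|lebesgue_on {0..1}. ?f x) = ?G 1 - 0"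
  proof (rule LINT_FTC_absolutely_continuous[where G = ?G and L = 0])
    show "negligible (N1 \<union> N2 \<union> N3)" using N1 N2 N3 by (intro negligible_Un)
    show "absolutely_continuous_on {c..1} ?G" if c: "c \<in> {0<..<1}" for c
      by (intro absolutely_continuous_on_lincomb absolutely_continuous_on_mult
          H2a0_ddx_absolutely_continuous[OF v c]
          absolutely_continuous_on_subset[OF auxx_absolutely_continuous[OF u]]
          absolutely_continuous_on_subset[OF ddx_auxx_absolutely_continuous[OF u]]
          absolutely_continuous_on_subset[OF H2a0_absolutely_continuous[OF v]]) (use c in auto)
    show "integrable (lebesgue_on {0..1}) ?f" using i1 i2 by simp
    show "(?G has_real_derivative ?f x) (at x within {0..1})" if x: "x \<in> {0<..1} - (N1 \<union> N2 \<union> N3)" for x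
    proof -
      have "?f x = ?p x * ddx (ddx v) x - v x * op_A a u x"
        using N3(2)[of x] x a_nonneg[of x] by (auto simp: algebra_simps)
      moreover have "(?G has_real_derivative (?p x * ddx (ddx v) x - v x * op_A a u x)) (at x within {0..1})"
        using x by (auto intro!: derivative_eq_intros auxx_derivative u N1(2) N2(2) H2a0_derivative v
            simp: algebra_simps)
      ultimately show ?thesis by (simp only:)
    qed
    have "((\<lambda>x. ddx ?p x * v x) \<longlongrightarrow> ddx ?p 0 * v 0) (at_right 0)"
      by (intro continuous_on_tendsto_at_right_0 continuous_intros ddx_auxx_continuous u H2a0_continuous v)
    then have "((\<lambda>x. ddx ?p x * v x) \<longlongrightarrow> 0) (at_right 0)" by (simp add: H2a0_0[OF v])
    then show "(?G \<longlongrightarrow> 0) (at_right 0)"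
      using tendsto_diff[OF auxx_ddx_tendsto[OF u v], of _ 0] by simp
  qed
  then have "(LINT x|lebesgue_on {0..1}. ?f x) = 0" by (simp add: H2a0_1[OF v] H2a0_ddx_1[OF v])
  moreover have "(LINT x|lebesgue_on {0..1}. ?W u x * ?W v x)
      = (LINT x|lebesgue_on {0..1}. a x * ddx (ddx u) x * ddx (ddx v) x)"
    by (rule Bochner_Integration.integral_cong) (auto simp: space_restrict_space a_nonneg algebra_simps)
  ultimately show ?thesis using i1 i2 by simp
qed

text \<open>The antiderivative \<open>x v^2\<close> vanishes at both ends. With
  \<open>v = y_t\<close>, the multiplier \<open>2 x y_x\<close> thereby produces minus the kinetic
  integral.\<close>

lemma integral_x_ddx_mult_self:
  assumes v: "v \<in> H2a0 a"
  shows "2 * (LINT x|lebesgue_on {0..1}. x * ddx v x * v x) = - (LINT x|lebesgue_on {0..1}. (v x)\<^sup>2)"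
proof -
  let ?G = "\<lambda>x. x * (v x * v x)"
  have i1: "integrable (lebesgue_on {0..1}) (\<lambda>x. x * ddx v x * v x)"
    by (intro L2_integrable_mult x_ddx_L2 u_L2 v)
  have i2: "integrable (lebesgue_on {0..1}) (\<lambda>x. (v x)\<^sup>2)"
    by (intro L2_integrable_power2 u_L2 v)
  have "(LINT x|lebesgue_on {0..1}. 2 * (x * ddx v x * v x) + (v x)\<^sup>2) = ?G 1 - 0"
  proof (rule LINT_FTC_absolutely_continuous[where G = ?G and L = 0])
    show "negligible {}" by simp
    show "absolutely_continuous_on {c..1} ?G" if c: "c \<in> {0<..<1}" for c
      by (intro absolutely_continuous_on_mult absolutely_continuous_on_ident
          absolutely_continuous_on_subset[OF H2a0_absolutely_continuous[OF v]]) (use c in auto)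
    show "integrable (lebesgue_on {0..1}) (\<lambda>x. 2 * (x * ddx v x * v x) + (v x)\<^sup>2)"
      using i1 i2 by simp
    show "(?G has_real_derivative 2 * (x * ddx v x * v x) + (v x)\<^sup>2) (at x within {0..1})"
      if x: "x \<in> {0<..1} - {}" for x
      using x by (auto intro!: derivative_eq_intros H2a0_derivative v simp: power2_eq_square algebra_simps)
    have "(?G \<longlongrightarrow> ?G 0) (at_right 0)"
      by (intro continuous_on_tendsto_at_right_0 continuous_intros H2a0_continuous v)
    then show "(?G \<longlongrightarrow> 0) (at_right 0)" by simp
  qed
  then show ?thesis using i1 i2 by (simp add: H2a0_1[OF v])
qed

text \<open>The equation \<open>a u'' = p\<close> is known only almost everywhere and might fail at
  the single point 1. Near 1, however, \<open>u'\<close> is an integral of the continuous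
  \<open>p / a\<close>, hence differentiable at 1 with the expected value.\<close>

lemma ddx_ddx_1:
  assumes u: "u \<in> dom_A a"
  shows "ddx (ddx u) 1 = auxx a u 1 / a 1"
proof (rule ddx_eq)
  let ?q = "\<lambda>x. auxx a u x / a x"
  have q: "continuous_on {1/2..1} ?q"
    using a_nonzero[of "1/2"]
    by (intro continuous_intros continuous_on_subset[OF auxx_continuous[OF u]]
        continuous_on_subset[OF a_continuous]) auto
  obtain N1 where N1: "negligible N1"
    "\<And>x. x \<in> {0..1} - N1 \<Longrightarrow> (ddx u has_real_derivative ddx (ddx u) x) (at x within {0..1})"
    using H2a0_ddx2_derivative[OF dom_A_H2a0[OF u]] by blast
  obtain N3 where N3: "negligible N3" "\<And>x. x \<in> {0..1} - N3 \<Longrightarrow> auxx a u x = a x * ddx (ddx u) x"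
    using auxx_eq[OF u] by blast
  have eq: "ddx u (1/2) + integral {1/2..x} ?q = ddx u x" if x: "x \<in> {1/2..1}" for x
  proof -
    have "(?q has_integral (ddx u x - ddx u (1/2))) {1/2..x}"
    proof (rule absolutely_continuous_on_has_integral)
      show "absolutely_continuous_on {1/2..x} (ddx u)"
        by (rule absolutely_continuous_on_subset[OF
              H2a0_ddx_absolutely_continuous[OF dom_A_H2a0[OF u], of "1/2"]]) (use x in auto)
      show "negligible (N1 \<union> N3)" using N1 N3 by (intro negligible_Un)
      fix s
      assume s: "s \<in> {1/2..x} - (N1 \<union> N3)"
      then have "s \<in> {0..1} - N1" "s \<in> {0..1} - N3" "a s > 0" using x a_pos[of s] by auto
      then have "(ddx u has_vector_derivative ?q s) (at s within {0..1})"
        using N1(2)[of s] N3(2)[of s] by (simp add: has_real_derivative_iff_has_vector_derivative)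
      then show "(ddx u has_vector_derivative ?q s) (at s within {1/2..x})"
        by (rule has_vector_derivative_within_subset) (use x in auto)
    qed (use x in auto)
    then have "integral {1/2..x} ?q = ddx u x - ddx u (1/2)" by blast
    then show ?thesis by simp
  qed
  have "((\<lambda>x. integral {1/2..x} ?q) has_real_derivative ?q 1) (at 1 within {1/2..1})"
    by (rule integral_has_real_derivative[OF q]) auto
  then have "((\<lambda>x. ddx u (1/2) + integral {1/2..x} ?q) has_real_derivative ?q 1) (at 1 within {1/2..1})"
    by (auto intro!: derivative_eq_intros)
  then have "(ddx u has_real_derivative ?q 1) (at 1 within {1/2..1})"
    by (rule has_field_derivative_transform_within[OF _ zero_less_one]) (use eq in auto)
  moreover have "at (1::real) within {1/2..1} = at 1 within {0..1}"
    by (intro at_within_nhd[of _ "{1/2<..}"]) auto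
  ultimately show "(ddx u has_real_derivative ?q 1) (at 1 within {0..1})" by simp
qed simp

lemma ident_over_a_absolutely_continuous:
  assumes c: "c \<in> {0<..<1}"
  shows "absolutely_continuous_on {c..1} (\<lambda>x. x / a x)"
proof (rule absolutely_continuous_on_C1)
  show "((\<lambda>x. x / a x) has_real_derivative (a x - x * ddx a x) / (a x * a x)) (at x within {c..1})"
    if x: "x \<in> {c..1}" for x
  proof -
    have x': "x \<in> {0<..1}" using x c by auto
    have "(a has_real_derivative ddx a x) (at x within {c..1})"
      by (rule DERIV_subset[OF a_derivative[OF x']]) (use c in auto)
    then show ?thesis using a_pos[OF x'] by (auto intro!: derivative_eq_intros)
  qed
  show "continuous_on {c..1} (\<lambda>x. (a x - x * ddx a x) / (a x * a x))"
    using a_nonzero[of c] c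
    by (intro continuous_intros continuous_on_subset[OF a_continuous]
        continuous_on_subset[OF ddx_a_continuous]) auto
qed

text \<open>The derivative of \<open>a\<close> enters the integrals only through this quotient,
  which stays bounded by \<open>K\<close> even where \<open>a'\<close> is unbounded.\<close>

lemma quotient_measurable: "(\<lambda>x. x * ddx a x / a x) \<in> borel_measurable (lebesgue_on {0..1})"
  using a_pos
  by (intro borel_measurable_continuous_on_Ioc continuous_intros ddx_a_continuous
      continuous_on_subset[OF a_continuous]) (auto simp: less_le)

lemma quotient_abs_le: "x \<in> {0..1} \<Longrightarrow> \<bar>x * ddx a x / a x\<bar> \<le> K"
proof (cases "x = 0")
  case False
  assume "x \<in> {0..1}"
  with False have "x \<in> {0<..1}" by auto
  then show ?thesis using x_ddx_a_le[of x] a_pos[of x] by (simp add: abs_mult field_simps)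
qed (use K_bounds in simp)

text \<open>A Rellich-type identity: multiplied by -2, the integral equals the boundary term
  \<open>p(1)^2 / a(1) = a(1) u''(1)^2\<close>, minus \<open>3 \<integral> a u''^2\<close>, plus
  \<open>\<integral> x a' u''^2\<close>. The last term is at most
  \<open>K \<integral> a u''^2\<close>, which gives \<open>3 - K\<close>.\<close>

lemma integral_multiplier:
  assumes u: "u \<in> dom_A a"
  shows "- 2 * (LINT x|lebesgue_on {0..1}. x * ddx u x * op_A a u x)
    \<le> a 1 * (ddx (ddx u) 1)\<^sup>2 - (3 - K) * en u"
proof -
  note u' = dom_A_H2a0[OF u]
  let ?p = "auxx a u"
  let ?W = "\<lambda>x. sqrt (a x) * ddx (ddx u) x"
  let ?h = "\<lambda>x. x * ddx a x / a x"
  \<comment> \<open>antiderivative obtained by integrating \<open>x u' p''\<close> by parts twice, with \<open>p = a u''\<close>\<close>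
  let ?F = "\<lambda>x. 1 * (1 * ((x * ddx u x) * ddx ?p x) + (-1) * (ddx u x * ?p x)) + (-1/2) * ((x / a x) * (?p x * ?p x))"
  let ?f = "\<lambda>x. x * ddx u x * op_A a u x - (3 * (?W x)\<^sup>2 - ?h x * ?W x * ?W x) / 2"
  obtain N1 where N1: "negligible N1"
    "\<And>x. x \<in> {0..1} - N1 \<Longrightarrow> (ddx u has_real_derivative ddx (ddx u) x) (at x within {0..1})"
    using H2a0_ddx2_derivative[OF u'] by blast
  obtain N2 where N2: "negligible N2"
    "\<And>x. x \<in> {0..1} - N2 \<Longrightarrow> (ddx ?p has_real_derivative op_A a u x) (at x within {0..1})"
    using ddx_auxx_derivative[OF u] by blast
  obtain N3 where N3: "negligible N3" "\<And>x. x \<in> {0..1} - N3 \<Longrightarrow> ?p x = a x * ddx (ddx u) x"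
    using auxx_eq[OF u] by blast
  have i1: "integrable (lebesgue_on {0..1}) (\<lambda>x. x * ddx u x * op_A a u x)"
    by (intro L2_integrable_mult x_ddx_L2 op_A_L2 u u')
  have i2: "integrable (lebesgue_on {0..1}) (\<lambda>x. (?W x)\<^sup>2)"
    by (intro L2_integrable_power2 H2a0_L2 u')
  have i3: "integrable (lebesgue_on {0..1}) (\<lambda>x. ?h x * ?W x * ?W x)"
    by (intro L2_integrable_mult L2_bounded_mult[OF _ quotient_measurable quotient_abs_le] H2a0_L2 u')
  have "(LINT x|lebesgue_on {0..1}. ?f x) = ?F 1 - 0"
  proof (rule LINT_FTC_absolutely_continuous[where G = ?F and L = 0])
    show "negligible (N1 \<union> N2 \<union> N3)" using N1 N2 N3 by (intro negligible_Un)
    show "absolutely_continuous_on {c..1} ?F" if c: "c \<in> {0<..<1}" for c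
      by (intro absolutely_continuous_on_lincomb absolutely_continuous_on_mult
          absolutely_continuous_on_ident ident_over_a_absolutely_continuous
          H2a0_ddx_absolutely_continuous[OF u' c] c
          absolutely_continuous_on_subset[OF auxx_absolutely_continuous[OF u]]
          absolutely_continuous_on_subset[OF ddx_auxx_absolutely_continuous[OF u]]) (use c in auto)
    show "integrable (lebesgue_on {0..1}) ?f" using i1 i2 i3 by simp
    show "(?F has_real_derivative ?f x) (at x within {0..1})" if x: "x \<in> {0<..1} - (N1 \<union> N2 \<union> N3)" for x
    proof -
      have x': "x \<in> {0<..1}" "x \<in> {0..1} - N1" "x \<in> {0..1} - N2" "x \<in> {0..1} - N3" "x \<in> {0..1}"
        using x by auto
      define q where "q = ddx (ddx u) x"
      define b where "b = ddx a x"
      have pos: "a x > 0" by (rule a_pos[OF x'(1)])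
      have p: "?p x = a x * q" using N3(2)[OF x'(4)] by (simp add: q_def)
      have dp: "(?p has_real_derivative ddx ?p x) (at x within {0..1})" by (rule auxx_derivative[OF u x'(5)])
      have du: "(ddx u has_real_derivative q) (at x within {0..1})" using N1(2)[OF x'(2)] by (simp add: q_def)
      have ddp: "(ddx ?p has_real_derivative op_A a u x) (at x within {0..1})" by (rule N2(2)[OF x'(3)])
      have da: "(a has_real_derivative b) (at x within {0..1})" unfolding b_def by (rule a_derivative[OF x'(1)])
      have "(?F has_real_derivative
          (ddx u x * ddx ?p x + x * q * ddx ?p x + x * ddx u x * op_A a u x
           - (q * ?p x + ddx u x * ddx ?p x)
           - ((a x - x * b) / (a x * a x) * (?p x * ?p x) + x / a x * (2 * ?p x * ddx ?p x)) / 2))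
          (at x within {0..1})"
        using pos by (auto intro!: derivative_eq_intros dp du ddp da simp: field_simps)
      \<comment> \<open>All terms with \<open>p'\<close> cancel, using \<open>p = a q\<close>. Of
        the factor \<open>3/2\<close>, the unit comes from \<open>- u' p\<close> and the half from
        \<open>- x p^2 / (2 a)\<close>; the derivative of the weight \<open>x / a\<close> leaves
        \<open>x b q^2 / 2\<close>.\<close>
      also have "(ddx u x * ddx ?p x + x * q * ddx ?p x + x * ddx u x * op_A a u x
           - (q * ?p x + ddx u x * ddx ?p x)
           - ((a x - x * b) / (a x * a x) * (?p x * ?p x) + x / a x * (2 * ?p x * ddx ?p x)) / 2)
          = x * ddx u x * op_A a u x - (3 * (a x * q\<^sup>2) - x * b / a x * (a x * q\<^sup>2)) / 2"
        unfolding p using pos by (simp add: field_simps power2_eq_square)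
      also have "a x * q\<^sup>2 = (?W x)\<^sup>2" using pos by (simp add: power_mult_distrib q_def)
      finally show ?thesis by (simp add: b_def power2_eq_square mult.assoc)
    qed
    have "(?F \<longlongrightarrow> 1 * (1 * (0 * ddx ?p 0) + (-1) * 0) + (-1/2) * 0) (at_right 0)"
    proof (intro tendsto_intros x_ddx_tendsto u' continuous_on_tendsto_at_right_0 ddx_auxx_continuous u)
      show "((\<lambda>x. ddx u x * ?p x) \<longlongrightarrow> 0) (at_right 0)"
        using auxx_ddx_tendsto[OF u u'] by (simp add: mult.commute)
      show "((\<lambda>x. x / a x * (?p x * ?p x)) \<longlongrightarrow> 0) (at_right 0)"
        using auxx_square_over_a_tendsto[OF u] by (simp add: power2_eq_square)
    qed
    then show "(?F \<longlongrightarrow> 0) (at_right 0)" by simp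
  qed
  \<comment> \<open>At 1 the terms containing \<open>u'\<close> vanish, leaving
    \<open>- p(1)^2 / (2 a(1))\<close>.\<close>
  also have "?F 1 - 0 = - (a 1 * (ddx (ddx u) 1)\<^sup>2) / 2"
    using a_1_pos by (simp add: H2a0_ddx_1[OF u'] ddx_ddx_1[OF u] power2_eq_square)
  finally have F: "(LINT x|lebesgue_on {0..1}. ?f x) = - (a 1 * (ddx (ddx u) 1)\<^sup>2) / 2" .
  have "(LINT x|M. A x - (3 * B x - D x) / 2) = (LINT x|M. A x) - (3 * (LINT x|M. B x) - (LINT x|M. D x)) / 2"
    if "integrable M A" "integrable M B" "integrable M D" for M :: "real measure" and A B D :: "real \<Rightarrow> real"
    using that by simp
  note split = this[OF i1 i2 i3]
  have arith: "- 2 * R \<le> s - (3 - K) * E"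
    if "X = R - (3 * E - H) / 2" "X = - s / 2" "H \<le> K * E" for X R E H s
    using that by (simp add: algebra_simps)
  show ?thesis
    unfolding en_eq
  proof (rule arith[OF split F])
    have "(LINT x|lebesgue_on {0..1}. ?h x * ?W x * ?W x) \<le> (LINT x|lebesgue_on {0..1}. K * (?W x)\<^sup>2)"
    proof (rule integral_mono)
      show "integrable (lebesgue_on {0..1}) (\<lambda>x. K * (?W x)\<^sup>2)" using i2 by simp
      fix x :: real
      assume "x \<in> space (lebesgue_on {0..1})"
      then have "x \<in> {0..1}" by (simp add: space_restrict_space)
      from abs_le_D1[OF quotient_abs_le[OF this]] have "?h x \<le> K" .
      then have "?h x * (?W x)\<^sup>2 \<le> K * (?W x)\<^sup>2" by (intro mult_right_mono) auto
      then show "?h x * ?W x * ?W x \<le> K * (?W x)\<^sup>2" by (simp only: power2_eq_square mult.assoc)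
    qed (rule i3)
    also have "\<dots> = K * (LINT x|lebesgue_on {0..1}. (?W x)\<^sup>2)" by simp
    finally show "(LINT x|lebesgue_on {0..1}. ?h x * ?W x * ?W x) \<le> K * (LINT x|lebesgue_on {0..1}. (?W x)\<^sup>2)" .
  qed
qed

section \<open>Bounded bilinear forms on \<open>H\<^sub>0\<close>\<close>

text \<open>Restricted to \<open>x > 0\<close>, since for a strongly degenerate coefficient elements
  of the space need not be differentiable at 0.\<close>

lemma ddx_lincomb:
  assumes u: "u \<in> H2a0 a" and z: "z \<in> H2a0 a" and x: "x \<in> {0<..1}"
  shows "((\<lambda>x. c * u x + d * z x) has_real_derivative (c * ddx u x + d * ddx z x)) (at x within {0..1})"
    and "ddx (\<lambda>x. c * u x + d * z x) x = c * ddx u x + d * ddx z x"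
proof -
  show "((\<lambda>x. c * u x + d * z x) has_real_derivative (c * ddx u x + d * ddx z x)) (at x within {0..1})"
    using H2a0_derivative[OF u x] H2a0_derivative[OF z x] by (auto intro!: derivative_eq_intros)
  then show "ddx (\<lambda>x. c * u x + d * z x) x = c * ddx u x + d * ddx z x"
    by (rule ddx_eq) (use x in auto)
qed

lemma ddx2_lincomb:
  assumes u: "u \<in> H2a0 a" and z: "z \<in> H2a0 a"
  obtains N where "negligible N"
    "\<And>x. x \<in> {0..1} - N \<Longrightarrow> (ddx (\<lambda>x. c * u x + d * z x) has_real_derivative
       c * ddx (ddx u) x + d * ddx (ddx z) x) (at x within {0..1})"
    "\<And>x. x \<in> {0..1} - N \<Longrightarrow> ddx (ddx (\<lambda>x. c * u x + d * z x)) x = c * ddx (ddx u) x + d * ddx (ddx z) x"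
proof -
  let ?w = "\<lambda>x. c * u x + d * z x"
  obtain N1 where N1: "negligible N1"
    "\<And>x. x \<in> {0..1} - N1 \<Longrightarrow> (ddx u has_real_derivative ddx (ddx u) x) (at x within {0..1})"
    using H2a0_ddx2_derivative[OF u] by blast
  obtain N2 where N2: "negligible N2"
    "\<And>x. x \<in> {0..1} - N2 \<Longrightarrow> (ddx z has_real_derivative ddx (ddx z) x) (at x within {0..1})"
    using H2a0_ddx2_derivative[OF z] by blast
  have der: "(ddx ?w has_real_derivative c * ddx (ddx u) x + d * ddx (ddx z) x) (at x within {0..1})"
    if x: "x \<in> {0..1} - (N1 \<union> N2 \<union> {0})" for x
  proof (rule has_field_derivative_transform_within)
    show "((\<lambda>x. c * ddx u x + d * ddx z x) has_real_derivative c * ddx (ddx u) x + d * ddx (ddx z) x)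
        (at x within {0..1})"
      using x by (auto intro!: derivative_eq_intros N1(2) N2(2))
    \<comment> \<open>All points within distance \<open>x\<close> of \<open>x\<close> are positive,
      so the first-order formula applies to them; this is why 0 joins the exceptional set.\<close>
    show "0 < x" "x \<in> {0..1}" using x by auto
    show "c * ddx u y + d * ddx z y = ddx ?w y" if "y \<in> {0..1}" "dist y x < x" for y
      using ddx_lincomb(2)[OF u z, of y] that by (auto simp: dist_real_def)
  qed
  show thesis
  proof (rule that[of "N1 \<union> N2 \<union> {0}"])
    show "negligible (N1 \<union> N2 \<union> {0})" using N1 N2 by (intro negligible_Un) auto
    show "ddx (ddx ?w) x = c * ddx (ddx u) x + d * ddx (ddx z) x"
      if "x \<in> {0..1} - (N1 \<union> N2 \<union> {0})" for x
      by (rule ddx_eq[OF der]) (use that in auto)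
  qed (rule der)
qed

text \<open>Turns the weighted norm of \<open>u''\<close> into an ordinary \<open>L2\<close> norm,
  at the price of being linear in \<open>u\<close> only almost everywhere.\<close>

definition W :: "(real \<Rightarrow> real) \<Rightarrow> real \<Rightarrow> real" where
  "W u x = sqrt (a x) * ddx (ddx u) x"

lemma W_L2: "u \<in> H2a0 a \<Longrightarrow> W u \<in> L2 {0..1}"
  using H2a0_L2[of u] by (simp add: W_def[abs_def])

lemma en_W: "en u = (LINT x|lebesgue_on {0..1}. (W u x)\<^sup>2)"
  by (simp add: en_eq W_def)

lemma W_lincomb:
  assumes u: "u \<in> H2a0 a" and z: "z \<in> H2a0 a"
  shows "AE x in lebesgue_on {0..1}. c * W u x + d * W z x = W (\<lambda>x. c * u x + d * z x) x"
proof -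
  obtain N where N: "negligible N" 
    "\<And>x. x \<in> {0..1} - N \<Longrightarrow> ddx (ddx (\<lambda>x. c * u x + d * z x)) x = c * ddx (ddx u) x + d * ddx (ddx z) x"
    by (rule ddx2_lincomb[OF u z, of c d], rule that; assumption)
  show ?thesis
  proof (rule AE_lebesgue_onI_negligible[OF N(1)])
    fix x
    assume "x \<in> {0..1} - N"
    from N(2)[OF this] show "c * W u x + d * W z x = W (\<lambda>x. c * u x + d * z x) x"
      by (simp add: W_def distrib_left mult.left_commute)
  qed simp
qed

text \<open>Linearity of \<open>ddx\<close> on \<open>(0,1]\<close>, and almost everywhere for its
  iterate, carries the clauses over. The weakly degenerate case repeats the computation on the
  closed interval because it prescribes \<open>u'(0)\<close>.\<close>

lemma H2a0_lincomb:
  assumes u: "u \<in> H2a0 a" and z: "z \<in> H2a0 a"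
  shows "(\<lambda>x. c * u x + d * z x) \<in> H2a0 a"
proof -
  let ?w = "\<lambda>x. c * u x + d * z x"
  have diff: "?w differentiable (at x within {0..1})" if "x \<in> {0<..1}" for x
    using ddx_lincomb(1)[OF u z that, of c d] real_differentiable_def by blast
  have ac: "absolutely_continuous_on {0..1} ?w"
    by (intro absolutely_continuous_on_lincomb H2a0_absolutely_continuous u z)
  have neg0: "negligible {0::real}" by simp
  have d1: "differentiable_ae ?w"
    unfolding differentiable_ae_def
    by (rule AE_lebesgue_onI_negligible[OF neg0 diff]) auto
  have eq: "AE x in lebesgue_on {0..1}. c * ddx u x + d * ddx z x = ddx ?w x"
    by (rule AE_lebesgue_onI_negligible[OF neg0 ddx_lincomb(2)[OF u z, symmetric]]) auto
  have l1: "ddx ?w \<in> L2 {0..1}"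
    by (rule L2_AE_eq[OF L2_lincomb[OF H2a0_ddx_L2[OF u] H2a0_ddx_L2[OF z]] _ eq]) simp
  have d2: "differentiable_ae (ddx ?w)"
  proof -
    obtain N where N: "negligible N"
      "\<And>x. x \<in> {0..1} - N \<Longrightarrow> (ddx ?w has_real_derivative
       c * ddx (ddx u) x + d * ddx (ddx z) x) (at x within {0..1})"
      by (rule ddx2_lincomb[OF u z, of c d], rule that; assumption)
    show ?thesis
      unfolding differentiable_ae_def
    proof (rule AE_lebesgue_onI_negligible[OF N(1)])
      fix x
      assume "x \<in> {0..1} - N"
      from N(2)[OF this] show "ddx ?w differentiable (at x within {0..1})"
        using real_differentiable_def by blast
    qed simp
  qed
  have l2: "(\<lambda>x. sqrt (a x) * ddx (ddx ?w) x) \<in> L2 {0..1}"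
    using L2_AE_eq[OF L2_lincomb[OF W_L2[OF u] W_L2[OF z]] _ W_lincomb[OF u z]]
    by (simp add: W_def[abs_def])
  have one: "ddx ?w 1 = 0" using ddx_lincomb(2)[OF u z, of 1] H2a0_ddx_1[OF u] H2a0_ddx_1[OF z] by simp
  show ?thesis
  proof (cases "weakly_degenerate a")
    case True
    have du: "(u has_real_derivative ddx u x) (at x within {0..1})"
      and dz: "(z has_real_derivative ddx z x) (at x within {0..1})" if "x \<in> {0..1}" for x
      using True u z that by (auto simp: H2a0_def intro!: ddx_works)
    have dw: "(?w has_real_derivative (c * ddx u x + d * ddx z x)) (at x within {0..1})" if "x \<in> {0..1}" for x
      using du[OF that] dz[OF that] by (auto intro!: derivative_eq_intros)
    have eqw: "c * ddx u x + d * ddx z x = ddx ?w x" if "x \<in> {0..1}" for x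
      using ddx_eq[OF dw[OF that] that] by simp
    have "absolutely_continuous_on {0..1} (ddx u)" "absolutely_continuous_on {0..1} (ddx z)"
      and zero: "ddx u 0 = 0" "ddx z 0 = 0"
      using True u z by (auto simp: H2a0_def)
    then have "absolutely_continuous_on {0..1} (ddx ?w)"
      by (intro absolutely_continuous_on_cong[OF absolutely_continuous_on_lincomb eqw])
    moreover have "ddx ?w 0 = 0" using eqw[of 0] zero by simp
    moreover have "\<forall>x\<in>{0..1}. ?w differentiable (at x within {0..1})"
      using dw real_differentiable_def by blast
    ultimately show ?thesis
      using True ac d1 d2 l1 l2 one H2a0_0[OF u] H2a0_0[OF z] H2a0_1[OF u] H2a0_1[OF z]
      by (simp add: H2a0_def H1_0_def)
  next
    case False
    have "absolutely_continuous_on {r..1} (ddx ?w)" if r: "r \<in> {0<..<1}" for r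
    proof (rule absolutely_continuous_on_cong)
      show "absolutely_continuous_on {r..1} (\<lambda>x. c * ddx u x + d * ddx z x)"
        by (intro absolutely_continuous_on_lincomb H2a0_ddx_absolutely_continuous u z r)
      show "c * ddx u x + d * ddx z x = ddx ?w x" if "x \<in> {r..1}" for x
        using ddx_lincomb(2)[OF u z, of x] that r by simp
    qed
    then show ?thesis
      using False ac d1 d2 l1 l2 one diff H2a0_0[OF u] H2a0_0[OF z] H2a0_1[OF u] H2a0_1[OF z]
      by (simp add: H2a0_def H1_0_def)
  qed
qed

section \<open>States, the inner product and the multiplier form\<close>

lemma H0_lincomb:
  assumes "w \<in> H0 a" "z \<in> H0 a"
  shows "lincomb c w d z \<in> H0 a"
  using assms by (auto simp: H0_def lincomb_def intro: H2a0_lincomb L2_lincomb)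

lemma H0_fst: "w \<in> H0 a \<Longrightarrow> fst w \<in> H2a0 a" and H0_snd: "w \<in> H0 a \<Longrightarrow> snd w \<in> L2 {0..1}"
  by (auto simp: H0_def)

text \<open>What the inner product and \<open>rho\<close> have in common, so that one product rule
  along orbits serves both. There is no symmetry clause because \<open>rho\<close> is not symmetric;
  linearity is asked for only on \<open>H0\<close>, where the integrals converge.\<close>

definition bounded_form :: "(state \<Rightarrow> state \<Rightarrow> real) \<Rightarrow> real \<Rightarrow> bool" where
  "bounded_form B M \<longleftrightarrow> M \<ge> 0 \<and>
     (\<forall>w\<in>H0 a. \<forall>z\<in>H0 a. \<forall>y\<in>H0 a. \<forall>c d. B (lincomb c w d z) y = c * B w y + d * B z y) \<and>
     (\<forall>w\<in>H0 a. \<forall>z\<in>H0 a. \<forall>y\<in>H0 a. \<forall>c d. B y (lincomb c w d z) = c * B y w + d * B y z) \<and>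
     (\<forall>w\<in>H0 a. \<forall>z\<in>H0 a. \<bar>B w z\<bar> \<le> M * (H0_norm a w * H0_norm a z))"

definition ip :: "state \<Rightarrow> state \<Rightarrow> real" where
  "ip w z = (LINT x|lebesgue_on {0..1}. W (fst w) x * W (fst z) x) +
            (LINT x|lebesgue_on {0..1}. snd w x * snd z x)"

lemma H0_norm_power2: "(H0_norm a w)\<^sup>2 = en (fst w) + (LINT x|lebesgue_on {0..1}. (snd w x)\<^sup>2)"
proof -
  have "0 \<le> (LINT x|lebesgue_on {0..1}. (snd w x)\<^sup>2)" by simp
  then show ?thesis using en_nonneg[of "fst w"] unfolding H0_norm_def en_def[symmetric] by simp
qed

lemma H0_norm_nonneg: "H0_norm a w \<ge> 0"
proof -
  have "0 \<le> (LINT x|lebesgue_on {0..1}. (snd w x)\<^sup>2)" by simp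
  then show ?thesis using en_nonneg[of "fst w"] unfolding H0_norm_def en_def[symmetric] by simp
qed

lemma ip_self: "ip w w = (H0_norm a w)\<^sup>2"
  unfolding H0_norm_power2 en_W ip_def by (simp add: power2_eq_square)

lemma ip_commute: "ip w z = ip z w"
  by (simp add: ip_def mult.commute)

lemma ip_lincomb:
  assumes w: "w \<in> H0 a" and z: "z \<in> H0 a" and y: "y \<in> H0 a"
  shows "ip (lincomb c w d z) y = c * ip w y + d * ip z y"
proof -
  have "(LINT x|lebesgue_on {0..1}. W (\<lambda>x. c * fst w x + d * fst z x) x * W (fst y) x)
      = (LINT x|lebesgue_on {0..1}. (c * W (fst w) x + d * W (fst z) x) * W (fst y) x)"
  proof (rule integral_cong_AE)
    show "(\<lambda>x. W (\<lambda>x. c * fst w x + d * fst z x) x * W (fst y) x) \<in> borel_measurable (lebesgue_on {0..1})"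
      by (intro borel_measurable_times L2_measurable W_L2 H2a0_lincomb H0_fst w z y)
    show "(\<lambda>x. (c * W (fst w) x + d * W (fst z) x) * W (fst y) x) \<in> borel_measurable (lebesgue_on {0..1})"
      by (intro borel_measurable_times L2_measurable L2_lincomb W_L2 H0_fst w z y)
    show "AE x in lebesgue_on {0..1}. W (\<lambda>x. c * fst w x + d * fst z x) x * W (fst y) x =
        (c * W (fst w) x + d * W (fst z) x) * W (fst y) x"
      using W_lincomb[OF H0_fst[OF w] H0_fst[OF z], of c d] by (rule eventually_mono) simp
  qed
  also have "\<dots> = c * (LINT x|lebesgue_on {0..1}. W (fst w) x * W (fst y) x) +
      d * (LINT x|lebesgue_on {0..1}. W (fst z) x * W (fst y) x)"
    by (intro L2_integral_lincomb W_L2 H0_fst w z y)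
  finally show ?thesis
    using L2_integral_lincomb[OF H0_snd[OF w] H0_snd[OF z] H0_snd[OF y], of c d]
    by (simp add: ip_def lincomb_def algebra_simps)
qed

lemma ip_Cauchy_Schwarz:
  assumes w: "w \<in> H0 a" and z: "z \<in> H0 a"
  shows "\<bar>ip w z\<bar> \<le> H0_norm a w * H0_norm a z"
proof -
  have "(ip w z)\<^sup>2 \<le> (H0_norm a w)\<^sup>2 * (H0_norm a z)\<^sup>2"
  proof (rule nonneg_quadratic_discriminant)
    fix t :: real
    let ?y = "lincomb 1 w t z"
    have y: "?y \<in> H0 a" by (rule H0_lincomb[OF w z])
    have "0 \<le> ip ?y ?y" by (simp add: ip_self)
    also have "ip ?y ?y = ip w ?y + t * ip z ?y" using ip_lincomb[OF w z y, of 1 t] by simp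
    also have "ip w ?y = ip w w + t * ip w z"
      using ip_lincomb[OF w z w, of 1 t] by (simp add: ip_commute)
    also have "ip z ?y = ip w z + t * ip z z"
      using ip_lincomb[OF w z z, of 1 t] by (simp add: ip_commute)
    finally show "0 \<le> (H0_norm a w)\<^sup>2 + 2 * t * ip w z + t\<^sup>2 * (H0_norm a z)\<^sup>2"
      by (simp add: ip_self power2_eq_square algebra_simps)
  qed simp
  then have "(ip w z)\<^sup>2 \<le> (H0_norm a w * H0_norm a z)\<^sup>2" by (simp add: power_mult_distrib)
  then have "\<bar>ip w z\<bar> \<le> \<bar>H0_norm a w * H0_norm a z\<bar>" by (simp only: abs_le_square_iff)
  then show ?thesis using H0_norm_nonneg by simp
qed

lemma ip_bounded_form: "bounded_form ip 1"
proof -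
  have "ip y (lincomb c w d z) = c * ip y w + d * ip y z"
    if "w \<in> H0 a" "z \<in> H0 a" "y \<in> H0 a" for w z y c d
    using ip_lincomb[OF that, of c d] by (simp add: ip_commute)
  then show ?thesis by (auto simp: bounded_form_def ip_lincomb ip_Cauchy_Schwarz)
qed

lemma H0_norm_lincomb:
  assumes w: "w \<in> H0 a" and z: "z \<in> H0 a"
  shows "H0_norm a (lincomb c w d z) \<le> \<bar>c\<bar> * H0_norm a w + \<bar>d\<bar> * H0_norm a z"
proof (rule power2_le_imp_le)
  let ?y = "lincomb c w d z"
  have y: "?y \<in> H0 a" by (rule H0_lincomb[OF w z])
  have "(H0_norm a ?y)\<^sup>2 = c * ip w ?y + d * ip z ?y"
    using ip_lincomb[OF w z y, of c d] by (simp add: ip_self)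
  also have "ip w ?y = c * ip w w + d * ip w z"
    using ip_lincomb[OF w z w, of c d] by (simp add: ip_commute)
  also have "ip z ?y = c * ip w z + d * ip z z"
    using ip_lincomb[OF w z z, of c d] by (simp add: ip_commute)
  finally have "(H0_norm a ?y)\<^sup>2 = c\<^sup>2 * (H0_norm a w)\<^sup>2 + 2 * (c * d * ip w z) + d\<^sup>2 * (H0_norm a z)\<^sup>2"
    by (simp add: ip_self power2_eq_square algebra_simps)
  also have "c * d * ip w z \<le> \<bar>c\<bar> * \<bar>d\<bar> * (H0_norm a w * H0_norm a z)"
  proof -
    have "c * d * ip w z \<le> \<bar>c * d\<bar> * \<bar>ip w z\<bar>" using abs_ge_self[of "c * d * ip w z"] by (simp add: abs_mult)
    also have "\<dots> \<le> \<bar>c * d\<bar> * (H0_norm a w * H0_norm a z)"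
      by (intro mult_left_mono ip_Cauchy_Schwarz w z) simp
    finally show ?thesis by (simp add: abs_mult)
  qed
  finally show "(H0_norm a ?y)\<^sup>2 \<le> (\<bar>c\<bar> * H0_norm a w + \<bar>d\<bar> * H0_norm a z)\<^sup>2"
    by (simp add: power2_sum power_mult_distrib algebra_simps)
qed (simp add: H0_norm_nonneg)

text \<open>The functional produced by the multipliers \<open>2 x y\<^sub>x\<close> and \<open>- (K/2) y\<close>.\<close>

definition rho :: "state \<Rightarrow> state \<Rightarrow> real" where
  "rho w z = 2 * (LINT x|lebesgue_on {0..1}. x * ddx (fst w) x * snd z x) -
     K / 2 * (LINT x|lebesgue_on {0..1}. fst w x * snd z x)"

lemma rho_lincomb_left:
  assumes w: "w \<in> H0 a" and z: "z \<in> H0 a" and y: "y \<in> H0 a"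
  shows "rho (lincomb c w d z) y = c * rho w y + d * rho z y"
proof -
  have "(LINT x|lebesgue_on {0..1}. x * ddx (\<lambda>x. c * fst w x + d * fst z x) x * snd y x)
      = (LINT x|lebesgue_on {0..1}. (c * (x * ddx (fst w) x) + d * (x * ddx (fst z) x)) * snd y x)"
  proof (rule Bochner_Integration.integral_cong)
    fix x :: real
    assume "x \<in> space (lebesgue_on {0..1})"
    \<comment> \<open>At \<open>x = 0\<close> linearity of \<open>ddx\<close> may fail, but the
      factor \<open>x\<close> removes that point.\<close>
    then have "x = 0 \<or> x \<in> {0<..1}" by (auto simp: space_restrict_space)
    then show "x * ddx (\<lambda>x. c * fst w x + d * fst z x) x * snd y x =
        (c * (x * ddx (fst w) x) + d * (x * ddx (fst z) x)) * snd y x"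
      using ddx_lincomb(2)[OF H0_fst[OF w] H0_fst[OF z], of x c d] by (auto simp: algebra_simps)
  qed simp
  also have "\<dots> = c * (LINT x|lebesgue_on {0..1}. x * ddx (fst w) x * snd y x) +
      d * (LINT x|lebesgue_on {0..1}. x * ddx (fst z) x * snd y x)"
    by (intro L2_integral_lincomb x_ddx_L2 H0_fst H0_snd w z y)
  finally show ?thesis
    using L2_integral_lincomb[OF u_L2[OF H0_fst[OF w]] u_L2[OF H0_fst[OF z]] H0_snd[OF y], of c d]
    by (simp add: rho_def lincomb_def algebra_simps)
qed

lemma rho_lincomb_right:
  assumes w: "w \<in> H0 a" and z: "z \<in> H0 a" and y: "y \<in> H0 a"
  shows "rho y (lincomb c w d z) = c * rho y w + d * rho y z"
  using L2_integral_lincomb[OF H0_snd[OF w] H0_snd[OF z] u_L2[OF H0_fst[OF y]], of c d]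
    L2_integral_lincomb[OF H0_snd[OF w] H0_snd[OF z] x_ddx_L2[OF H0_fst[OF y]], of c d]
  by (simp add: rho_def lincomb_def mult.commute[of _ "fst y _"] mult.commute[of _ "_ * ddx _ _"]) 
     (simp add: algebra_simps)

text \<open>Applied with \<open>f\<close> equal to \<open>x u'\<close> and to \<open>u\<close>,
  which share the bound \<open>C en\<close>.\<close>

lemma pairing_bound:
  assumes f: "f \<in> L2 {0..1}" and z: "z \<in> H0 a" and u: "w \<in> H0 a"
    and le: "(LINT x|lebesgue_on {0..1}. (f x)\<^sup>2) \<le> C * en (fst w)"
  shows "\<bar>LINT x|lebesgue_on {0..1}. f x * snd z x\<bar> \<le> sqrt C * (H0_norm a w * H0_norm a z)"
proof -
  have v: "0 \<le> (LINT x|lebesgue_on {0..1}. (snd y x)\<^sup>2)" for y :: state by simp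
  have "(LINT x|lebesgue_on {0..1}. f x * snd z x)\<^sup>2
      \<le> (LINT x|lebesgue_on {0..1}. (f x)\<^sup>2) * (LINT x|lebesgue_on {0..1}. (snd z x)\<^sup>2)"
    by (rule L2_Cauchy_Schwarz[OF f H0_snd[OF z]])
  also have "\<dots> \<le> (C * (H0_norm a w)\<^sup>2) * (H0_norm a z)\<^sup>2"
  proof (rule mult_mono)
    have "C * en (fst w) \<le> C * (H0_norm a w)\<^sup>2"
      using v[of w] C_pos by (intro mult_left_mono) (auto simp: H0_norm_power2)
    then show "(LINT x|lebesgue_on {0..1}. (f x)\<^sup>2) \<le> C * (H0_norm a w)\<^sup>2" using le by linarith
    show "(LINT x|lebesgue_on {0..1}. (snd z x)\<^sup>2) \<le> (H0_norm a z)\<^sup>2"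
      using en_nonneg[of "fst z"] by (simp add: H0_norm_power2)
  qed (use C_pos in auto)
  also have "\<dots> = (sqrt C * (H0_norm a w * H0_norm a z))\<^sup>2"
    using C_pos by (simp add: power_mult_distrib)
  finally have "\<bar>LINT x|lebesgue_on {0..1}. f x * snd z x\<bar> \<le> \<bar>sqrt C * (H0_norm a w * H0_norm a z)\<bar>"
    by (simp only: abs_le_square_iff)
  then show ?thesis using H0_norm_nonneg C_pos by simp
qed

text \<open>Only finiteness of this constant matters: it serves differentiation along orbits and
  invariance under equality in \<open>H0\<close>. The constant of the final inequality comes from
  \<open>rho_self_bound\<close>.\<close>

lemma rho_bounded_form: "bounded_form rho ((2 + K / 2) * sqrt C)"
proof -
  have "\<bar>rho w z\<bar> \<le> (2 + K / 2) * sqrt C * (H0_norm a w * H0_norm a z)"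
    if w: "w \<in> H0 a" and z: "z \<in> H0 a" for w z
  proof -
    let ?I = "LINT x|lebesgue_on {0..1}. x * ddx (fst w) x * snd z x"
      and ?J = "LINT x|lebesgue_on {0..1}. fst w x * snd z x"
      and ?R = "sqrt C * (H0_norm a w * H0_norm a z)"
    have I: "\<bar>?I\<bar> \<le> ?R"
      by (intro pairing_bound x_ddx_L2 integral_x_ddx_le H0_fst w z)
    have J: "\<bar>?J\<bar> \<le> ?R"
      by (intro pairing_bound u_L2 integral_u_le H0_fst w z)
    have "\<bar>rho w z\<bar> \<le> \<bar>2 * ?I\<bar> + \<bar>K / 2 * ?J\<bar>" unfolding rho_def by (rule abs_triangle_ineq4)
    also have "\<dots> = 2 * \<bar>?I\<bar> + K / 2 * \<bar>?J\<bar>" using K_bounds by (simp add: abs_mult)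
    also have "\<dots> \<le> 2 * ?R + K / 2 * ?R"
      using K_bounds I J by (intro add_mono mult_left_mono) auto
    finally show ?thesis by (simp add: algebra_simps)
  qed
  then show ?thesis
    using K_bounds C_pos by (auto simp: bounded_form_def rho_lincomb_left rho_lincomb_right)
qed

text \<open>On the diagonal each pairing satisfies
  \<open>2 \<bar>I\<bar> \<le> C en + \<integral> v^2\<close>, and the larger of the coefficients
  \<open>C\<close> and 1 is taken out; hence the maximum in the theorem.\<close>

lemma rho_self_bound:
  assumes w: "w \<in> H0 a"
  shows "\<bar>rho w w\<bar> \<le> (1 + K / 4) * (max C 1 * (H0_norm a w)\<^sup>2)"
proof -
  let ?I = "LINT x|lebesgue_on {0..1}. x * ddx (fst w) x * snd w x"
    and ?J = "LINT x|lebesgue_on {0..1}. fst w x * snd w x"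
    and ?v = "LINT x|lebesgue_on {0..1}. (snd w x)\<^sup>2"
  have v: "0 \<le> ?v" by simp
  have M: "C * en (fst w) + ?v \<le> max C 1 * (H0_norm a w)\<^sup>2"
  proof -
    have "C * en (fst w) \<le> max C 1 * en (fst w)" "1 * ?v \<le> max C 1 * ?v"
      using v en_nonneg[of "fst w"] by (intro mult_right_mono; simp)+
    then show ?thesis unfolding H0_norm_power2 by (simp add: algebra_simps)
  qed
  have "2 * \<bar>?I\<bar> \<le> (LINT x|lebesgue_on {0..1}. (x * ddx (fst w) x)\<^sup>2) + ?v"
    by (intro two_abs_le_add L2_Cauchy_Schwarz x_ddx_L2 H0_fst H0_snd w) auto
  then have I: "2 * \<bar>?I\<bar> \<le> max C 1 * (H0_norm a w)\<^sup>2"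
    using integral_x_ddx_le[OF H0_fst[OF w]] M by linarith
  have "2 * \<bar>?J\<bar> \<le> (LINT x|lebesgue_on {0..1}. (fst w x)\<^sup>2) + ?v"
    by (intro two_abs_le_add L2_Cauchy_Schwarz u_L2 H0_fst H0_snd w) auto
  then have J: "2 * \<bar>?J\<bar> \<le> max C 1 * (H0_norm a w)\<^sup>2"
    using integral_u_le[OF H0_fst[OF w]] M by linarith
  have "\<bar>rho w w\<bar> \<le> \<bar>2 * ?I\<bar> + \<bar>K / 2 * ?J\<bar>" unfolding rho_def by (rule abs_triangle_ineq4)
  also have "\<dots> = 2 * \<bar>?I\<bar> + K / 4 * (2 * \<bar>?J\<bar>)" using K_bounds by (simp add: abs_mult)
  also have "\<dots> \<le> max C 1 * (H0_norm a w)\<^sup>2 + K / 4 * (max C 1 * (H0_norm a w)\<^sup>2)"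
    using K_bounds I J by (intro add_mono mult_left_mono) auto
  finally show ?thesis by (simp add: algebra_simps)
qed

lemma dom_AA_H0:
  assumes "w \<in> dom_AA a"
  shows "w \<in> H0 a" "op_AA a w \<in> H0 a"
proof -
  have u: "fst w \<in> dom_A a" and v: "snd w \<in> H2a0 a" using assms by (auto simp: dom_AA_def)
  show "w \<in> H0 a" using dom_A_H2a0[OF u] u_L2[OF v] by (auto simp: H0_def mem_Times_iff)
  show "op_AA a w \<in> H0 a"
    using v L2_lincomb[OF op_A_L2[OF u] op_A_L2[OF u], of "-1" 0] by (simp add: H0_def op_AA_def)
qed

text \<open>Skew-symmetry of the generator: the Green formula makes
  \<open>\<integral> a u'' v''\<close> cancel against
  \<open>\<integral> v (a u'')''\<close>.\<close>

lemma ip_dissipation: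
  assumes "w \<in> dom_AA a"
  shows "ip (op_AA a w) w + ip w (op_AA a w) = 0"
proof -
  have u: "fst w \<in> dom_A a" and v: "snd w \<in> H2a0 a" using assms by (auto simp: dom_AA_def)
  have "(LINT x|lebesgue_on {0..1}. W (fst w) x * W (snd w) x)
      = (LINT x|lebesgue_on {0..1}. a x * ddx (ddx (fst w)) x * ddx (ddx (snd w)) x)"
    by (rule Bochner_Integration.integral_cong) (auto simp: W_def space_restrict_space a_nonneg algebra_simps)
  also have "\<dots> = (LINT x|lebesgue_on {0..1}. snd w x * op_A a (fst w) x)"
    by (rule Green_formula[OF u v])
  finally have "ip w (op_AA a w) = 0" by (simp add: ip_def op_AA_def)
  then show ?thesis by (simp add: ip_commute)
qed

text \<open>For \<open>w = (u, v)\<close>, the first summand is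
  \<open>-(1 + K/2) \<integral> v^2\<close> by the identity for \<open>x v' v\<close>. The second is
  at most the trace term plus \<open>K/2 - (3 - K)\<close> times \<open>en u\<close>, by the
  multiplier inequality and the Green formula with \<open>v = u\<close>. The smaller weight is half
  of \<open>min (6 - 3 * K) (K + 2)\<close>.\<close>

lemma rho_derivative_bound:
  assumes "w \<in> dom_AA a"
  shows "rho (op_AA a w) w + rho w (op_AA a w)
    \<le> a 1 * (ddx (ddx (fst w)) 1)\<^sup>2 - min (6 - 3 * K) (K + 2) / 2 * (H0_norm a w)\<^sup>2"
proof -
  have u: "fst w \<in> dom_A a" and v: "snd w \<in> H2a0 a" using assms by (auto simp: dom_AA_def)
  let ?P = "LINT x|lebesgue_on {0..1}. x * ddx (fst w) x * op_A a (fst w) x"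
  let ?V = "LINT x|lebesgue_on {0..1}. (snd w x)\<^sup>2"
  have "en (fst w) = (LINT x|lebesgue_on {0..1}. fst w x * op_A a (fst w) x)"
    using Green_formula[OF u dom_A_H2a0[OF u]] by (simp add: en_def power2_eq_square mult.assoc)
  then have "rho w (op_AA a w) = - 2 * ?P + K / 2 * en (fst w)"
    by (simp add: rho_def op_AA_def)
  moreover have "rho (op_AA a w) w = - ?V - K / 2 * ?V"
    using integral_x_ddx_mult_self[OF v] by (simp add: rho_def op_AA_def power2_eq_square)
  moreover have "- 2 * ?P \<le> a 1 * (ddx (ddx (fst w)) 1)\<^sup>2 - (3 - K) * en (fst w)"
    by (rule integral_multiplier[OF u])
  moreover have "min (6 - 3 * K) (K + 2) / 2 * en (fst w) \<le> (3 - 3 * K / 2) * en (fst w)"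
    using en_nonneg[of "fst w"] by (intro mult_right_mono) (auto simp: field_simps)
  moreover have "min (6 - 3 * K) (K + 2) / 2 * ?V \<le> (1 + K / 2) * ?V"
    by (intro mult_right_mono) (auto simp: field_simps)
  moreover have "r1 + r2 \<le> g - m * (e + v)"
    if "r2 = - 2 * P + K / 2 * e" "r1 = - v - K / 2 * v" "- 2 * P \<le> g - (3 - K) * e"
      "m * e \<le> (3 - 3 * K / 2) * e" "m * v \<le> (1 + K / 2) * v" for r1 r2 P g e v m :: real
    using that by (simp add: algebra_simps)
  ultimately show ?thesis
    unfolding H0_norm_power2 by blast
qed

text \<open>At distance 0 the difference has \<open>en = 0\<close>, and \<open>u_bound\<close> then
  forces it to vanish at every point. Hence the trace does not depend on the representative.\<close>

lemma H0_dist_0_fst_eq: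
  assumes w: "w \<in> H0 a" and z: "z \<in> H0 a" and "H0_dist a w z = 0" and x: "x \<in> {0..1}"
  shows "fst w x = fst z x"
proof -
  let ?y = "lincomb 1 w (-1) z"
  have y: "fst ?y \<in> H2a0 a" by (intro H0_fst H0_lincomb w z)
  have "(H0_norm a ?y)\<^sup>2 = 0" using assms by (simp add: H0_dist_def)
  moreover have "0 \<le> (LINT x|lebesgue_on {0..1}. (snd ?y x)\<^sup>2)" by simp
  ultimately have "en (fst ?y) = 0" using en_nonneg[of "fst ?y"] unfolding H0_norm_power2 by linarith
  then have "fst ?y x = 0" using u_bound[OF y x] by simp
  then show ?thesis by (simp add: lincomb_def)
qed

lemma H0_dist_0_trace_eq:
  assumes "w \<in> H0 a" "z \<in> H0 a" "H0_dist a w z = 0"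
  shows "ddx (ddx (fst w)) 1 = ddx (ddx (fst z)) 1"
  using H0_dist_0_fst_eq[OF assms] by (intro ddx_cong) auto

section \<open>The semigroup and the observability inequality\<close>

text \<open>Equality in the Hilbert space, for functions serving as representatives. Membership is
  included so that the relation chains without side conditions.\<close>

definition eqv :: "state \<Rightarrow> state \<Rightarrow> bool" where
  "eqv w z \<longleftrightarrow> w \<in> H0 a \<and> z \<in> H0 a \<and> H0_dist a w z = 0"

lemma bounded_form_left:
  "bounded_form B M \<Longrightarrow> w \<in> H0 a \<Longrightarrow> z \<in> H0 a \<Longrightarrow> y \<in> H0 a \<Longrightarrow>
    B (lincomb c w d z) y = c * B w y + d * B z y"
  and bounded_form_right:
  "bounded_form B M \<Longrightarrow> w \<in> H0 a \<Longrightarrow> z \<in> H0 a \<Longrightarrow> y \<in> H0 a \<Longrightarrow>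
    B y (lincomb c w d z) = c * B y w + d * B y z"
  and bounded_form_bound:
  "bounded_form B M \<Longrightarrow> w \<in> H0 a \<Longrightarrow> z \<in> H0 a \<Longrightarrow> \<bar>B w z\<bar> \<le> M * (H0_norm a w * H0_norm a z)"
  and bounded_form_nonneg: "bounded_form B M \<Longrightarrow> M \<ge> 0"
  by (simp_all add: bounded_form_def)

text \<open>A bounded form vanishes as soon as one argument has norm 0, so by bilinearity it cannot
  distinguish representatives.\<close>

lemma eqv_form:
  assumes B: "bounded_form B M" and w: "eqv w w'" and z: "eqv z z'"
  shows "B w z = B w' z'"
proof -
  have H: "w \<in> H0 a" "w' \<in> H0 a" "z \<in> H0 a" "z' \<in> H0 a"
    and n: "H0_norm a (lincomb 1 w (-1) w') = 0" "H0_norm a (lincomb 1 z (-1) z') = 0"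
    using w z by (auto simp: eqv_def H0_dist_def)
  have "B w z - B w' z = 0"
    using bounded_form_bound[OF B H0_lincomb[OF H(1,2)] H(3), of 1 "-1"]
      bounded_form_left[OF B H(1,2,3), of 1 "-1"] n by simp
  moreover have "B w' z - B w' z' = 0"
    using bounded_form_bound[OF B H(2) H0_lincomb[OF H(3,4)], of 1 "-1"]
      bounded_form_right[OF B H(3,4,2), of 1 "-1"] n by simp
  ultimately show ?thesis by simp
qed

lemma eqv_norm:
  assumes "eqv w w'"
  shows "H0_norm a w = H0_norm a w'"
proof -
  have "(H0_norm a w)\<^sup>2 = (H0_norm a w')\<^sup>2"
    using eqv_form[OF ip_bounded_form assms assms] by (simp add: ip_self)
  then show ?thesis using H0_norm_nonneg by (simp add: power2_eq_iff_nonneg)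
qed

lemma H0_dist_nonneg: "H0_dist a w z \<ge> 0"
  by (simp add: H0_dist_def H0_norm_nonneg)

lemma eqv_refl: "w \<in> H0 a \<Longrightarrow> eqv w w"
proof -
  assume w: "w \<in> H0 a"
  have "lincomb 1 w (-1) w = lincomb 0 w 0 w" by (simp add: lincomb_def)
  then have "H0_dist a w w \<le> 0"
    unfolding H0_dist_def using H0_norm_lincomb[OF w w, of 0 0] by simp
  then show ?thesis using w H0_dist_nonneg[of w w] by (simp add: eqv_def)
qed

lemma H0_dist_triangle:
  assumes "w \<in> H0 a" "z \<in> H0 a" "y \<in> H0 a"
  shows "H0_dist a w y \<le> H0_dist a w z + H0_dist a z y"
proof -
  have "lincomb 1 w (-1) y = lincomb 1 (lincomb 1 w (-1) z) 1 (lincomb 1 z (-1) y)"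
    by (simp add: lincomb_def)
  then show ?thesis
    unfolding H0_dist_def
    using H0_norm_lincomb[of "lincomb 1 w (-1) z" "lincomb 1 z (-1) y" 1 1] assms
    by (simp add: H0_lincomb)
qed

lemma H0_dist_commute:
  assumes "w \<in> H0 a" "z \<in> H0 a"
  shows "H0_dist a w z = H0_dist a z w"
proof -
  have "H0_dist a w z \<le> H0_dist a z w" if "w \<in> H0 a" "z \<in> H0 a" for w z
  proof -
    have "lincomb 1 w (-1) z = lincomb (-1) (lincomb 1 z (-1) w) 0 w" by (simp add: lincomb_def)
    then show ?thesis
      unfolding H0_dist_def
      using H0_norm_lincomb[of "lincomb 1 z (-1) w" w "-1" 0] that by (simp add: H0_lincomb)
  qed
  then show ?thesis using assms by (intro antisym)
qed

lemma eqv_sym: "eqv w z \<Longrightarrow> eqv z w"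
  by (auto simp: eqv_def H0_dist_commute)

lemma eqv_trans: "eqv w z \<Longrightarrow> eqv z y \<Longrightarrow> eqv w y"
  unfolding eqv_def using H0_dist_triangle[of w z y] H0_dist_nonneg[of w y] by auto

lemma eqv_lincomb:
  assumes w: "eqv w w'" and z: "eqv z z'"
  shows "eqv (lincomb c w d z) (lincomb c w' d z')"
proof -
  have H: "w \<in> H0 a" "w' \<in> H0 a" "z \<in> H0 a" "z' \<in> H0 a"
    and n: "H0_norm a (lincomb 1 w (-1) w') = 0" "H0_norm a (lincomb 1 z (-1) z') = 0"
    using w z by (auto simp: eqv_def H0_dist_def)
  have "lincomb 1 (lincomb c w d z) (-1) (lincomb c w' d z')
      = lincomb c (lincomb 1 w (-1) w') d (lincomb 1 z (-1) z')"
    by (simp add: lincomb_def algebra_simps)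
  then have "H0_dist a (lincomb c w d z) (lincomb c w' d z') \<le> 0"
    unfolding H0_dist_def
    using H0_norm_lincomb[OF H0_lincomb[OF H(1,2)] H0_lincomb[OF H(3,4)], of c 1 "-1" d 1 "-1"] n
    by simp
  then show ?thesis
    using H H0_dist_nonneg[of "lincomb c w d z" "lincomb c w' d z'"] by (simp add: eqv_def H0_lincomb)
qed

lemma eqv_dist: "eqv w w' \<Longrightarrow> eqv z z' \<Longrightarrow> H0_dist a w z = H0_dist a w' z'"
  unfolding H0_dist_def by (intro eqv_norm eqv_lincomb)

end

section \<open>Orbits of the semigroup with data in the domain\<close>

locale degenerate_semigroup = degenerate_coefficient +
  fixes S :: "real \<Rightarrow> state \<Rightarrow> state"
  assumes semigroup: "contraction_semigroup a S" and generator: "generated_by_AA a S"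
begin

lemma S_H0: "t \<ge> 0 \<Longrightarrow> w \<in> H0 a \<Longrightarrow> S t w \<in> H0 a"
  and S_norm: "t \<ge> 0 \<Longrightarrow> w \<in> H0 a \<Longrightarrow> H0_norm a (S t w) \<le> H0_norm a w"
  and S_tendsto: "w \<in> H0 a \<Longrightarrow> ((\<lambda>t. H0_dist a (S t w) w) \<longlongrightarrow> 0) (at_right 0)"
  using semigroup by (simp_all add: contraction_semigroup_def)

lemma S_lincomb:
  "t \<ge> 0 \<Longrightarrow> w \<in> H0 a \<Longrightarrow> z \<in> H0 a \<Longrightarrow> eqv (S t (lincomb c w d z)) (lincomb c (S t w) d (S t z))"
  using semigroup by (simp add: contraction_semigroup_def eqv_def H0_lincomb)

lemma S_0: "w \<in> H0 a \<Longrightarrow> eqv (S 0 w) w"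
  using semigroup by (simp add: contraction_semigroup_def eqv_def)

lemma S_add: "s \<ge> 0 \<Longrightarrow> t \<ge> 0 \<Longrightarrow> w \<in> H0 a \<Longrightarrow> eqv (S (s + t) w) (S s (S t w))"
  using semigroup by (simp add: contraction_semigroup_def eqv_def)

lemma S_dist:
  assumes "t \<ge> 0" "w \<in> H0 a" "z \<in> H0 a"
  shows "H0_dist a (S t w) (S t z) \<le> H0_dist a w z"
  unfolding H0_dist_def
  using eqv_norm[OF S_lincomb[OF assms, of 1 "-1"]] S_norm[OF assms(1) H0_lincomb[OF assms(2,3)], of 1 "-1"]
  by simp

text \<open>Error of the difference quotient at time 0. By contractivity it also bounds the error at
  every later time.\<close>

definition quot_err :: "state \<Rightarrow> real \<Rightarrow> real" where
  "quot_err w h = H0_dist a (lincomb (1 / h) (S h w) (- 1 / h) w) (op_AA a w)"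

lemma quot_err_tendsto:
  assumes w: "w \<in> dom_AA a"
  shows "(quot_err w \<longlongrightarrow> 0) (at_right 0)"
proof -
  have "H0_dist a w w = 0" "H0_dist a (op_AA a w) (op_AA a w) = 0"
    using dom_AA_H0[OF w] eqv_refl by (auto simp: eqv_def)
  then show ?thesis
    using generator dom_AA_H0[OF w] w unfolding generated_by_AA_def quot_err_def[abs_def] by blast
qed

text \<open>Up to equality in \<open>H0\<close>, the remainder at \<open>s\<close> is
  \<open>S s\<close> applied to the remainder at 0, and a contraction does not enlarge it; so
  differentiability is uniform in \<open>s\<close>.\<close>

lemma orbit_increment:
  assumes w: "w \<in> dom_AA a" and "s \<ge> 0" "h > 0"
  shows "H0_norm a (lincomb 1 (lincomb 1 (S (s + h) w) (-1) (S s w)) (- h) (S s (op_AA a w)))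
    \<le> h * quot_err w h"
proof -
  let ?z = "op_AA a w"
  note H = dom_AA_H0[OF w]
  have h: "h \<ge> 0" using \<open>h > 0\<close> by simp
  let ?R = "lincomb 1 (lincomb 1 (S h w) (-1) w) (- h) ?z"
  have R: "?R \<in> H0 a" by (intro H0_lincomb S_H0 H h)
  have "eqv (S s ?R) (lincomb 1 (S s (lincomb 1 (S h w) (-1) w)) (- h) (S s ?z))"
    by (intro S_lincomb H0_lincomb S_H0 H h \<open>s \<ge> 0\<close>)
  moreover have "eqv (lincomb 1 (S s (lincomb 1 (S h w) (-1) w)) (- h) (S s ?z))
      (lincomb 1 (lincomb 1 (S s (S h w)) (-1) (S s w)) (- h) (S s ?z))"
    by (intro eqv_lincomb S_lincomb eqv_refl S_H0 H h \<open>s \<ge> 0\<close>)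
  moreover have "eqv (lincomb 1 (lincomb 1 (S s (S h w)) (-1) (S s w)) (- h) (S s ?z))
      (lincomb 1 (lincomb 1 (S (s + h) w) (-1) (S s w)) (- h) (S s ?z))"
    by (intro eqv_lincomb eqv_sym[OF S_add] eqv_refl S_H0 H h \<open>s \<ge> 0\<close>)
  ultimately have "H0_norm a (lincomb 1 (lincomb 1 (S (s + h) w) (-1) (S s w)) (- h) (S s ?z))
      = H0_norm a (S s ?R)"
    by (metis eqv_norm)
  also have "\<dots> \<le> H0_norm a ?R" by (rule S_norm[OF \<open>s \<ge> 0\<close> R])
  \<comment> \<open>The second coefficient is 0: a scalar multiple is written as a
    \<open>lincomb\<close>, so that one norm inequality covers it.\<close>
  also have "?R = lincomb h (lincomb 1 (lincomb (1 / h) (S h w) (- 1 / h) w) (-1) ?z) 0 ?z"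
    using \<open>h > 0\<close> by (simp add: lincomb_def algebra_simps)
  also have "H0_norm a \<dots> \<le> \<bar>h\<bar> * H0_norm a (lincomb 1 (lincomb (1 / h) (S h w) (- 1 / h) w) (-1) ?z)
      + \<bar>0\<bar> * H0_norm a ?z"
    by (intro H0_norm_lincomb H0_lincomb S_H0 H h)
  finally show ?thesis using \<open>h > 0\<close> by (simp add: quot_err_def H0_dist_def)
qed

text \<open>Difference quotients of the orbit at \<open>t\<close> are images under
  \<open>S t\<close> of those at 0, hence converge to \<open>S t (op_AA a w)\<close>. The
  equivalence that identifies the generator then yields a representative \<open>w'\<close> in the
  domain, where the integral identities are available.\<close>

lemma orbit_generator:
  assumes w: "w \<in> dom_AA a" and "t \<ge> 0"
  obtains w' where "w' \<in> dom_AA a" "eqv (S t w) w'" "eqv (S t (op_AA a w)) (op_AA a w')"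
proof -
  let ?z = "op_AA a w"
  note H = dom_AA_H0[OF w]
  have St: "S t w \<in> H0 a" "S t ?z \<in> H0 a" using S_H0 \<open>t \<ge> 0\<close> H by auto
  have "((\<lambda>h. H0_dist a (lincomb (1 / h) (S h (S t w)) (- 1 / h) (S t w)) (S t ?z)) \<longlongrightarrow> 0) (at_right 0)"
  proof (rule tendsto_sandwich[OF _ _ tendsto_const quot_err_tendsto[OF w]])
    show "\<forall>\<^sub>F h in at_right 0. 0 \<le> H0_dist a (lincomb (1 / h) (S h (S t w)) (- 1 / h) (S t w)) (S t ?z)"
      by (intro always_eventually allI H0_dist_nonneg)
    have "H0_dist a (lincomb (1 / h) (S h (S t w)) (- 1 / h) (S t w)) (S t ?z) \<le> quot_err w h"
      if "h > 0" for h
    proof -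
      have h: "h \<ge> 0" using that by simp
      have "eqv (S h (S t w)) (S t (S h w))"
        using S_add[OF h \<open>t \<ge> 0\<close> H(1)] S_add[OF \<open>t \<ge> 0\<close> h H(1)] eqv_trans eqv_sym
        by (metis add.commute)
      then have "eqv (lincomb (1 / h) (S h (S t w)) (- 1 / h) (S t w))
          (lincomb (1 / h) (S t (S h w)) (- 1 / h) (S t w))"
        by (intro eqv_lincomb eqv_refl St)
      then have "eqv (lincomb (1 / h) (S h (S t w)) (- 1 / h) (S t w))
          (S t (lincomb (1 / h) (S h w) (- 1 / h) w))"
        by (rule eqv_trans) (intro eqv_sym[OF S_lincomb] S_H0 H h \<open>t \<ge> 0\<close>)
      then have "H0_dist a (lincomb (1 / h) (S h (S t w)) (- 1 / h) (S t w)) (S t ?z)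
          = H0_dist a (S t (lincomb (1 / h) (S h w) (- 1 / h) w)) (S t ?z)"
        by (rule eqv_dist[OF _ eqv_refl[OF St(2)]])
      also have "\<dots> \<le> quot_err w h"
        unfolding quot_err_def by (intro S_dist H0_lincomb S_H0 H h \<open>t \<ge> 0\<close>)
      finally show ?thesis .
    qed
    then show "\<forall>\<^sub>F h in at_right 0.
        H0_dist a (lincomb (1 / h) (S h (S t w)) (- 1 / h) (S t w)) (S t ?z) \<le> quot_err w h"
      by (intro eventually_mono[OF eventually_at_right_less]) auto
  qed
  then obtain w' where "w' \<in> dom_AA a" "H0_dist a (S t w) w' = 0" "H0_dist a (S t ?z) (op_AA a w') = 0"
    using generator St unfolding generated_by_AA_def by blast
  then show thesis using that St dom_AA_H0 by (auto simp: eqv_def)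
qed

text \<open>The product rule along an orbit, integrated. The criterion for forward increments also
  asks that the derivative vary with a uniform modulus; this follows from strong continuity of the
  semigroup at \<open>op_AA a w\<close>.\<close>

lemma form_along_orbit_has_integral:
  assumes B: "bounded_form B M" and w: "w \<in> dom_AA a" and "T \<ge> 0"
  shows "((\<lambda>t. B (S t (op_AA a w)) (S t w) + B (S t w) (S t (op_AA a w))) has_integral
    (B (S T w) (S T w) - B (S 0 w) (S 0 w))) {0..T}"
proof (rule fundamental_theorem_of_calculus[OF \<open>T \<ge> 0\<close>])
  let ?z = "op_AA a w"
  let ?nw = "H0_norm a w" and ?nz = "H0_norm a ?z"
  let ?\<delta> = "quot_err w"
  define \<epsilon> where "\<epsilon> = (\<lambda>h. H0_dist a (S h ?z) ?z)"
  note H = dom_AA_H0[OF w]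
  note M = bounded_form_nonneg[OF B]
  note n = H0_norm_nonneg
  \<comment> \<open>Three sources of error: the remainder of the difference quotient, the
    displacement \<epsilon> of the orbit of \<open>op_AA a w\<close>, and the displacement of the
    orbit of \<open>w\<close>, at most \<open>h * ?\<delta> h + h * ?nz\<close>. One modulus is made
    large enough for both hypotheses of the criterion.\<close>
  define \<eta> where "\<eta> = (\<lambda>h. M * (2 * (?\<delta> h * ?nw) + 2 * (\<epsilon> h * ?nw) + 2 * (?nz * (h * ?\<delta> h + h * ?nz))))"
  fix t
  assume t: "t \<in> {0..T}"
  show "((\<lambda>t. B (S t w) (S t w)) has_vector_derivative B (S t ?z) (S t w) + B (S t w) (S t ?z))
      (at t within {0..T})"
  proof (rule has_real_derivative_from_increments[OF _ _ _ t, where \<eta> = \<eta>])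
    have "(\<eta> \<longlongrightarrow> M * (2 * (0 * ?nw) + 2 * (0 * ?nw) + 2 * (?nz * (0 * 0 + 0 * ?nz)))) (at_right 0)"
      unfolding \<eta>_def \<epsilon>_def by (intro tendsto_intros quot_err_tendsto[OF w] S_tendsto H)
    then show "(\<eta> \<longlongrightarrow> 0) (at_right 0)" by simp
  next
    fix s t :: real
    assume st: "0 \<le> s" "s < t"
    define h where "h = t - s"
    have h: "h > 0" "t = s + h" using st by (auto simp: h_def)
    then have t0: "t \<ge> 0" using st by simp
    define X where "X = S s w"
    define X' where "X' = S t w"
    define Z where "Z = S s ?z"
    define Z' where "Z' = S t ?z"
    define D where "D = lincomb 1 X' (-1) X"
    define E where "E = lincomb 1 Z' (-1) Z"
    define R where "R = lincomb 1 D (- h) Z"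
    have in_H0: "X \<in> H0 a" "X' \<in> H0 a" "Z \<in> H0 a" "Z' \<in> H0 a"
      using S_H0 H st t0 by (auto simp: X_def X'_def Z_def Z'_def)
    then have DE: "D \<in> H0 a" "E \<in> H0 a" by (auto simp: D_def E_def H0_lincomb)
    then have R: "R \<in> H0 a" using in_H0 by (simp add: R_def H0_lincomb)
    have nX: "H0_norm a X \<le> ?nw" "H0_norm a X' \<le> ?nw" "H0_norm a Z \<le> ?nz" "H0_norm a Z' \<le> ?nz"
      using S_norm H st t0 by (auto simp: X_def X'_def Z_def Z'_def)
    have nR: "H0_norm a R \<le> h * ?\<delta> h"
      using orbit_increment[OF w st(1) h(1)] by (simp add: R_def D_def X_def X'_def Z_def h(2))
    have nD: "H0_norm a D \<le> h * ?\<delta> h + h * ?nz"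
    proof -
      have "D = lincomb 1 R h Z" by (simp add: R_def lincomb_def)
      then have "H0_norm a D \<le> \<bar>1\<bar> * H0_norm a R + \<bar>h\<bar> * H0_norm a Z"
        using H0_norm_lincomb[OF R in_H0(3), of 1 h] by simp
      also have "\<dots> \<le> 1 * (h * ?\<delta> h) + h * ?nz"
        using h nR nX by (intro add_mono mult_mono) (auto simp: n)
      finally show ?thesis by simp
    qed
    have nE: "H0_norm a E \<le> \<epsilon> h"
    proof -
      have "H0_norm a E = H0_dist a Z' Z" by (simp add: E_def H0_dist_def)
      also have "\<dots> = H0_dist a (S s (S h ?z)) (S s ?z)"
        unfolding Z_def Z'_def h(2) using st h H
        by (intro eqv_dist S_add eqv_refl S_H0) auto
      also have "\<dots> \<le> \<epsilon> h"
        unfolding \<epsilon>_def using st h H by (intro S_dist S_H0) auto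
      finally show ?thesis .
    qed
    have \<delta>0: "?\<delta> h \<ge> 0" and \<epsilon>0: "\<epsilon> h \<ge> 0" by (auto simp: quot_err_def \<epsilon>_def H0_dist_nonneg)
    have bound: "\<bar>B p q\<bar> \<le> M * (P * Q)"
      if "p \<in> H0 a" "q \<in> H0 a" "H0_norm a p \<le> P" "H0_norm a q \<le> Q" for p q P Q
    proof -
      have "H0_norm a p * H0_norm a q \<le> P * Q"
        using that n[of p] n[of q] by (intro mult_mono) auto
      then have "M * (H0_norm a p * H0_norm a q) \<le> M * (P * Q)" using M by (intro mult_left_mono)
      then show ?thesis using bounded_form_bound[OF B that(1,2)] by linarith
    qed
    let ?G = "h * ?\<delta> h + h * ?nz"
    have \<eta>: "\<eta> h = 2 * (M * (?\<delta> h * ?nw)) + 2 * (M * (\<epsilon> h * ?nw)) + 2 * (M * (?nz * ?G))"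
      unfolding \<eta>_def by (simp add: algebra_simps)
    have pos: "M * (\<epsilon> h * ?nw) \<ge> 0" "M * (?nz * ?G) \<ge> 0" "M * (?\<delta> h * ?nw) \<ge> 0"
      using M \<delta>0 \<epsilon>0 n[of w] n[of ?z] h by simp_all
    have BD: "B D q = B X' q - B X q" "B q D = B q X' - B q X" if "q \<in> H0 a" for q
      using bounded_form_left[OF B in_H0(2,1) that, of 1 "-1"]
        bounded_form_right[OF B in_H0(2,1) that, of 1 "-1"] by (simp_all add: D_def)
    have BE: "B E q = B Z' q - B Z q" "B q E = B q Z' - B q Z" if "q \<in> H0 a" for q
      using bounded_form_left[OF B in_H0(4,3) that, of 1 "-1"]
        bounded_form_right[OF B in_H0(4,3) that, of 1 "-1"] by (simp_all add: E_def)
    have BR: "B R q = B D q - h * B Z q" "B q R = B q D - h * B q Z" if "q \<in> H0 a" for q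
      using bounded_form_left[OF B DE(1) in_H0(3) that, of 1 "- h"]
        bounded_form_right[OF B DE(1) in_H0(3) that, of 1 "- h"] by (simp_all add: R_def)
    show "\<bar>B (S t w) (S t w) - B (S s w) (S s w) - (t - s) * (B (S s ?z) (S s w) + B (S s w) (S s ?z))\<bar>
        \<le> (t - s) * \<eta> (t - s)"
    proof -
      \<comment> \<open>\<open>B X' X' - B X X = B D X' + B X D\<close> with
        \<open>D = R + h Z\<close>; replacing \<open>B Z X'\<close> by \<open>B Z X\<close> costs
        \<open>B Z D\<close>.\<close>
      have "B X' X' - B X X - h * (B Z X + B X Z) = B R X' + B X R + h * B Z D"
        unfolding BR(1)[OF in_H0(2)] BR(2)[OF in_H0(1)] BD(1)[OF in_H0(2)] BD(2)[OF in_H0(1)] BD(2)[OF in_H0(3)]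
        by (simp add: algebra_simps)
      moreover have "\<bar>B R X'\<bar> \<le> M * ((h * ?\<delta> h) * ?nw)" "\<bar>B X R\<bar> \<le> M * (?nw * (h * ?\<delta> h))"
        using in_H0 R nX nR by (auto intro!: bound)
      moreover have "\<bar>h * B Z D\<bar> \<le> h * (M * (?nz * ?G))"
        using in_H0 DE nX nD h by (auto intro!: bound simp: abs_mult)
      moreover have "h * \<eta> h \<ge> M * ((h * ?\<delta> h) * ?nw) + M * (?nw * (h * ?\<delta> h)) + h * (M * (?nz * ?G))"
      proof -
        have "h * \<eta> h = 2 * (h * (M * (?\<delta> h * ?nw))) + 2 * (h * (M * (\<epsilon> h * ?nw))) + 2 * (h * (M * (?nz * ?G)))"
          unfolding \<eta> by (simp only: distrib_left mult.left_commute)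
        moreover have "0 \<le> h * (M * (\<epsilon> h * ?nw))" "0 \<le> h * (M * (?nz * ?G))"
          using pos h by simp_all
        moreover have "M * ((h * ?\<delta> h) * ?nw) = h * (M * (?\<delta> h * ?nw))"
          "M * (?nw * (h * ?\<delta> h)) = h * (M * (?\<delta> h * ?nw))" by simp_all
        moreover have "l1 + l2 + g \<le> E"
          if "E = 2 * d + 2 * e + 2 * g" "0 \<le> e" "0 \<le> g" "l1 = d" "l2 = d" for l1 l2 g E d e :: real
          using that by linarith
        ultimately show ?thesis by blast
      qed
      ultimately show ?thesis
        unfolding X_def[symmetric] X'_def[symmetric] Z_def[symmetric] h_def[symmetric] by linarith
    qed
    show "\<bar>B (S t ?z) (S t w) + B (S t w) (S t ?z) - (B (S s ?z) (S s w) + B (S s w) (S s ?z))\<bar>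
        \<le> \<eta> (t - s)"
    proof -
      have "B Z' X' + B X' Z' - (B Z X + B X Z) = B E X' + B Z D + B D Z' + B X E"
        using BD(1)[OF in_H0(4)] BD(2)[OF in_H0(3)] BE(1)[OF in_H0(2)] BE(2)[OF in_H0(1)] by simp
      moreover have "\<bar>B E X'\<bar> \<le> M * (\<epsilon> h * ?nw)" "\<bar>B X E\<bar> \<le> M * (?nw * \<epsilon> h)"
        "\<bar>B Z D\<bar> \<le> M * (?nz * ?G)" "\<bar>B D Z'\<bar> \<le> M * (?G * ?nz)"
        using in_H0 DE nX nD nE by (auto intro!: bound)
      moreover have "M * (?nw * \<epsilon> h) = M * (\<epsilon> h * ?nw)" "M * (?G * ?nz) = M * (?nz * ?G)"
        by (simp_all only: mult.commute)
      ultimately show ?thesis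
        unfolding X_def[symmetric] X'_def[symmetric] Z_def[symmetric] Z'_def[symmetric] h_def[symmetric] \<eta>
        using pos by linarith
    qed
  qed
qed

text \<open>Contractivity alone gives one inequality. Equality holds because the derivative of the
  squared norm, evaluated on representatives in the domain, is 0 by skew-symmetry.\<close>

lemma S_norm_eq:
  assumes w: "w \<in> dom_AA a" and "t \<ge> 0"
  shows "H0_norm a (S t w) = H0_norm a w"
proof -
  have "ip (S s (op_AA a w)) (S s w) + ip (S s w) (S s (op_AA a w)) = 0" if s: "s \<in> {0..t}" for s
  proof -
    obtain w' where w': "w' \<in> dom_AA a" "eqv (S s w) w'" "eqv (S s (op_AA a w)) (op_AA a w')"
      using orbit_generator[OF w, of s] s by auto
    show ?thesis
      using eqv_form[OF ip_bounded_form w'(2,3)] eqv_form[OF ip_bounded_form w'(3,2)]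
        ip_dissipation[OF w'(1)] by simp
  qed
  then have "((\<lambda>s. ip (S s (op_AA a w)) (S s w) + ip (S s w) (S s (op_AA a w))) has_integral 0) {0..t}"
    by (rule has_integral_is_0)
  with form_along_orbit_has_integral[OF ip_bounded_form w \<open>t \<ge> 0\<close>]
  have "ip (S t w) (S t w) - ip (S 0 w) (S 0 w) = 0" by (rule has_integral_unique)
  then have "(H0_norm a (S t w))\<^sup>2 = (H0_norm a (S 0 w))\<^sup>2" by (simp add: ip_self)
  then have "H0_norm a (S t w) = H0_norm a (S 0 w)"
    using H0_norm_nonneg by (simp add: power2_eq_iff_nonneg)
  then show ?thesis using eqv_norm[OF S_0[OF dom_AA_H0(1)[OF w]]] by simp
qed

text \<open>The trace is read off some representative \<open>y\<close> of the state at time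
  \<open>t\<close>, since a solution agrees with the orbit only up to distance 0.\<close>

lemma observability_classical:
  assumes w: "w \<in> dom_AA a" and "T > 0" and g: "g \<in> L2 {0..T}"
    and trace: "\<And>t. t \<in> {0..T} \<Longrightarrow> \<exists>y. eqv y (S t w) \<and> g t = ddx (ddx (fst y)) 1"
  shows "(T * min (6 - 3 * K) (K + 2) - (K + 4) * max C 1) * (1 / 2 * (H0_norm a w)\<^sup>2)
    \<le> a 1 * (LINT t|lebesgue_on {0..T}. (g t)\<^sup>2)"
proof -
  let ?m = "min (6 - 3 * K) (K + 2)" and ?N = "(H0_norm a w)\<^sup>2"
  let ?\<psi> = "\<lambda>t. rho (S t (op_AA a w)) (S t w) + rho (S t w) (S t (op_AA a w))"
  have T: "T \<ge> 0" using \<open>T > 0\<close> by simp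
  have le: "?\<psi> t \<le> a 1 * (g t)\<^sup>2 - ?m / 2 * ?N" if t: "t \<in> {0..T}" for t
  proof -
    have t0: "t \<ge> 0" using t by simp
    obtain w' where w': "w' \<in> dom_AA a" "eqv (S t w) w'" "eqv (S t (op_AA a w)) (op_AA a w')"
      using orbit_generator[OF w t0] by blast
    obtain y where y: "eqv y (S t w)" "g t = ddx (ddx (fst y)) 1" using trace[OF t] by blast
    have "eqv y w'" by (rule eqv_trans[OF y(1) w'(2)])
    then have "g t = ddx (ddx (fst w')) 1"
      using y(2) H0_dist_0_trace_eq by (auto simp: eqv_def)
    moreover have "H0_norm a w' = H0_norm a w"
      using eqv_norm[OF w'(2)] S_norm_eq[OF w t0] by simp
    ultimately show ?thesis
      using rho_derivative_bound[OF w'(1)] eqv_form[OF rho_bounded_form w'(2,3)]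
        eqv_form[OF rho_bounded_form w'(3,2)] by simp
  qed
  let ?I = "LINT t|lebesgue_on {0..T}. (g t)\<^sup>2"
  have "((\<lambda>t. (g t)\<^sup>2) has_integral ?I) {0..T}"
    by (intro has_integral_integral_lebesgue_on L2_integrable_power2 g) auto
  then have "((\<lambda>t. a 1 * (g t)\<^sup>2 - ?m / 2 * ?N) has_integral (a 1 * ?I - T * (?m / 2 * ?N))) {0..T}"
    using has_integral_const_real[of "?m / 2 * ?N" 0 T] T
    by (intro has_integral_diff has_integral_mult_right) auto
  with form_along_orbit_has_integral[OF rho_bounded_form w T]
  have "rho (S T w) (S T w) - rho (S 0 w) (S 0 w) \<le> a 1 * ?I - T * (?m / 2 * ?N)"
    by (rule has_integral_le) (rule le)
  moreover have "\<bar>rho (S t w) (S t w)\<bar> \<le> (1 + K / 4) * (max C 1 * ?N)" if "t \<ge> 0" for t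
    using rho_self_bound[OF S_H0[OF that dom_AA_H0(1)[OF w]]] S_norm_eq[OF w that] by simp
  from this[OF T] this[of 0] have "\<bar>rho (S T w) (S T w)\<bar> \<le> (1 + K / 4) * (max C 1 * ?N)"
    "\<bar>rho (S 0 w) (S 0 w)\<bar> \<le> (1 + K / 4) * (max C 1 * ?N)" by simp_all
  \<comment> \<open>Both ends of the time interval contribute \<open>1 + K/4\<close>, and
    \<open>2 (1 + K/4)\<close> times the squared norm is \<open>K + 4\<close> times the
    energy.\<close>
  ultimately have "T * (?m / 2 * ?N) - 2 * ((1 + K / 4) * (max C 1 * ?N)) \<le> a 1 * ?I" by linarith
  then show ?thesis by (simp add: algebra_simps)
qed

end

section \<open>From orbits to solutions, and passage to the limit\<close>

context degenerate_coefficient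
begin

lemma energy_eq:
  assumes "(y t, yt t) \<in> H0 a"
  shows "energy a y yt t = 1 / 2 * (H0_norm a (y t, yt t))\<^sup>2"
proof -
  have u: "y t \<in> H2a0 a" and v: "yt t \<in> L2 {0..1}" using assms by (auto simp: H0_def)
  have "(LINT x|lebesgue_on {0..1}. (yt t x)\<^sup>2 + a x * (ddx (ddx (y t)) x)\<^sup>2)
      = (LINT x|lebesgue_on {0..1}. (yt t x)\<^sup>2 + (W (y t) x)\<^sup>2)"
    by (rule Bochner_Integration.integral_cong)
       (auto simp: W_def power_mult_distrib space_restrict_space a_nonneg)
  also have "\<dots> = (LINT x|lebesgue_on {0..1}. (yt t x)\<^sup>2) + en (y t)"
    using L2_integrable_power2[OF v] L2_integrable_power2[OF W_L2[OF u]] by (simp add: en_W)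
  finally show ?thesis by (simp add: energy_def H0_norm_power2)
qed

text \<open>A solution is tied to its data through \<open>S 0\<close>, which is the identity only up
  to equality in \<open>H0\<close>; the norm respects that equality.\<close>

lemma mild_solution_energy_0:
  assumes "mild_solution a y0 y1 y yt"
  shows "energy a y yt 0 = 1 / 2 * (H0_norm a (y0, y1))\<^sup>2"
proof -
  from assms obtain S where S: "contraction_semigroup a S" "generated_by_AA a S"
    and y: "(y 0, yt 0) \<in> H0 a" "H0_dist a (y 0, yt 0) (S 0 (y0, y1)) = 0" and y0: "(y0, y1) \<in> H0 a"
    unfolding mild_solution_def by auto
  interpret degenerate_semigroup a S by unfold_locales (fact S)+
  have "eqv (y 0, yt 0) (S 0 (y0, y1))" using y y0 S_H0[of 0] by (simp add: eqv_def)
  then have "eqv (y 0, yt 0) (y0, y1)" using S_0[OF y0] eqv_trans by blast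
  then show ?thesis using energy_eq[of y 0 yt, OF y(1)] eqv_norm by simp
qed

lemma observability_classical_solution:
  assumes "classical_solution a y0 y1 y yt" "T > 0"
    and g: "(\<lambda>t. ddx (ddx (y t)) 1) \<in> L2 {0..T}"
  shows "(T * min (6 - 3 * K) (K + 2) - (K + 4) * max C 1) * (1 / 2 * (H0_norm a (y0, y1))\<^sup>2)
    \<le> a 1 * (LINT t|lebesgue_on {0..T}. (ddx (ddx (y t)) 1)\<^sup>2)"
proof -
  from assms(1) obtain S where S: "contraction_semigroup a S" "generated_by_AA a S"
    and y: "\<And>t. t \<ge> 0 \<Longrightarrow> (y t, yt t) \<in> H0 a \<and> H0_dist a (y t, yt t) (S t (y0, y1)) = 0"
    and w: "(y0, y1) \<in> dom_AA a"
    unfolding classical_solution_def mild_solution_def by auto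
  interpret degenerate_semigroup a S by unfold_locales (fact S)+
  show ?thesis
  proof (rule observability_classical[OF w \<open>T > 0\<close> g])
    fix t
    assume "t \<in> {0..T}"
    then have "eqv (y t, yt t) (S t (y0, y1))"
      using y[of t] S_H0[of t] dom_AA_H0(1)[OF w] by (simp add: eqv_def)
    then show "\<exists>z. eqv z (S t (y0, y1)) \<and> ddx (ddx (y t)) 1 = ddx (ddx (fst z)) 1" by force
  qed
qed

text \<open>Reverse triangle inequality, obtained by writing each of the two states as a combination
  of the other and their difference.\<close>

lemma H0_norm_tendsto:
  assumes Z: "\<And>n. Z n \<in> H0 a" and w: "w \<in> H0 a"
    and lim: "(\<lambda>n. H0_dist a (Z n) w) \<longlonglongrightarrow> 0"
  shows "(\<lambda>n. H0_norm a (Z n)) \<longlonglongrightarrow> H0_norm a w"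
proof -
  have "\<bar>H0_norm a (Z n) - H0_norm a w\<bar> \<le> H0_dist a (Z n) w" for n
  proof -
    let ?d = "lincomb 1 (Z n) (-1) w"
    have d: "?d \<in> H0 a" by (intro H0_lincomb Z w)
    have "Z n = lincomb 1 ?d 1 w" "w = lincomb 1 (Z n) (-1) ?d" by (simp_all add: lincomb_def)
    then have "H0_norm a (Z n) \<le> H0_norm a ?d + H0_norm a w"
      "H0_norm a w \<le> H0_norm a (Z n) + H0_norm a ?d"
      using H0_norm_lincomb[OF d w, of 1 1] H0_norm_lincomb[OF Z[of n] d, of 1 "-1"] by simp_all
    then show ?thesis by (simp add: H0_dist_def)
  qed
  then have "(\<lambda>n. H0_norm a (Z n) - H0_norm a w) \<longlonglongrightarrow> 0"
    by (intro Lim_null_comparison[OF _ lim]) simp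
  then show ?thesis by (simp add: LIM_zero_iff)
qed

end

theorem theorem3p7:
  fixes a yT0 yT1 yxx1 :: "real \<Rightarrow> real" and y yt :: "real \<Rightarrow> real \<Rightarrow> real" and K T :: real
  assumes "weakly_degenerate a \<or> strongly_degenerate a"
    and "K = degeneracy_constant a"
    and "mild_solution a yT0 yT1 y yt"
    and "T > 0"
    and "boundary_trace a T yT0 yT1 yxx1"
  shows "a 1 * (LINT t|lebesgue_on {0..T}. (yxx1 t)\<^sup>2)
       \<ge> (T * min (6 - 3 * K) (K + 2) - (K + 4) * max (1 / (a 1 * (2 - K))) 1) * energy a y yt 0"
proof -
  interpret degenerate_coefficient a by unfold_locales (fact assms(1))
  from assms(5) obtain Y0 Y1 Y Yt
    where cl: "\<And>n. classical_solution a (Y0 n) (Y1 n) (Y n) (Yt n)"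
      and lim: "(\<lambda>n::nat. H0_dist a (Y0 n, Y1 n) (yT0, yT1)) \<longlonglongrightarrow> 0"
      and tr: "L2_tendsto {0..T} (\<lambda>n t. ddx (ddx (Y n t)) 1) yxx1"
    unfolding boundary_trace_def by auto
  let ?c = "T * min (6 - 3 * K) (K + 2) - (K + 4) * max (1 / (a 1 * (2 - K))) 1"
  have H0: "(Y0 n, Y1 n) \<in> H0 a" for n
    using cl[of n] by (simp add: classical_solution_def mild_solution_def)
  have y0: "(yT0, yT1) \<in> H0 a" using assms(3) by (simp add: mild_solution_def)
  have "(\<lambda>n. ?c * (1 / 2 * (H0_norm a (Y0 n, Y1 n))\<^sup>2)) \<longlonglongrightarrow> ?c * (1 / 2 * (H0_norm a (yT0, yT1))\<^sup>2)"
    by (intro tendsto_intros H0_norm_tendsto[OF H0 y0 lim])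
  moreover have "(\<lambda>n. a 1 * (LINT t|lebesgue_on {0..T}. (ddx (ddx (Y n t)) 1)\<^sup>2))
      \<longlonglongrightarrow> a 1 * (LINT t|lebesgue_on {0..T}. (yxx1 t)\<^sup>2)"
    by (intro tendsto_intros L2_tendsto_integral_power2[OF tr])
  \<comment> \<open>Each approximating solution brings its own semigroup. These need not be
    identified with one another, because the inequality involves only the data and the
    trace.\<close>
  moreover have "?c * (1 / 2 * (H0_norm a (Y0 n, Y1 n))\<^sup>2)
      \<le> a 1 * (LINT t|lebesgue_on {0..T}. (ddx (ddx (Y n t)) 1)\<^sup>2)" for n
    using observability_classical_solution[OF cl assms(4)] tr
    unfolding C_def assms(2) by (simp add: L2_tendsto_def)
  ultimately have "?c * (1 / 2 * (H0_norm a (yT0, yT1))\<^sup>2) \<le> a 1 * (LINT t|lebesgue_on {0..T}. (yxx1 t)\<^sup>2)"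
    by (intro LIMSEQ_le) auto
  then show ?thesis unfolding mild_solution_energy_0[OF assms(3)] .
qed

end
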